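(* Let $(L,L')$ be a cross on a germ of smooth complex surface $(S,o)$ and let $C$ be a curve singularity on $(S,o)$ such that neither $L$ nor $L'$ is a branch of $C$. Then the strict transform $C_{L,L'}$ of $C$ by the Newton modification $\psi^C_{L,L'}$ intersects the boundary $\partial S_{\mathcal F_{L,L'}(C)}$ of the toroidal surface $(S_{\mathcal F_{L,L'}(C)},\partial S_{\mathcal F_{L,L'}(C)})$ only at smooth points of it. Moreover, if $\rho$ is a ray of the Newton fan $\mathcal F_{L,L'}(C)$ different from the edges of $\sigma_0$, then $C_{L,L'}$ intersects the corresponding component $\overline O_\rho$ of the exceptional divisor of $\psi^C_{L,L'}$ only inside the orbit $O_\rho$, and the number of intersection points counted with multiplicities is equal to the integral length of the edge of the Newton polygon $\mathcal N_{L,L'}(C)$ which is orthogonal to the ray $\rho$.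
   Context: A curve singularity on $(S,o)$ is a formal germ of effective divisor, defined by a nonzero non-unit $f\in\hat{\mathcal O}_{S,o}\simeq\mathbb C[[x,y]]$; its branches are its irreducible components. A cross is an ordered pair $(L,L')$ of transversal smooth branches; coordinates $(x,y)$ define it if $L=Z(x)$, $L'=Z(y)$. Let $(x,y)$ define the cross and let $f\in\mathbb C[[x,y]]$ define $C$. The Newton polygon $\mathcal N_{L,L'}(C)$ is the convex hull of $\mathrm{Supp}(f)+\mathbb R_+^2$ in $M_{\mathbb R}$, where $M\simeq\mathbb Z^2$ is the lattice of exponents of monomials in $(x,y)$. Let $N$ be the dual lattice of $M$, with basis $(e_1,e_2)$ dual to the canonical one, and $\sigma_0=\mathbb R_+e_1+\mathbb R_+e_2$. The Newton fan $\mathcal F_{L,L'}(C)$ is the fan subdividing $\sigma_0$ along the rays orthogonal to the compact edges of $\mathcal N_{L,L'}(C)$. Identifying $(S,o)$ with $(\mathbb C^2,0)$ by $(x,y)$, the toric modification $X_{\mathcal F_{L,L'}(C)}\to\mathbb C^2$ defines (over $S$) the Newton modification $\psi^C_{L,L'}:S_{\mathcal F_{L,L'}(C)}\to S$. The boundary $\partial S_{\mathcal F_{L,L'}(C)}$ is the reduced preimage of $L+L'$; its components are the (germs along the preimage of $o$ of the) orbit closures $\overline O_\rho$ of the one-dimensional orbits $O_\rho$ associated with the rays $\rho$ of the fan, those with $\rho$ interior to $\sigma_0$ being the components of the exceptional divisor $(\psi^C_{L,L'})^{-1}(o)$. The integral length of a segment with endpoints in the lattice $M$ is the integer $\ell$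 such that the difference of its endpoints is $\ell$ times a primitive vector of $M$. *)

theory Defs
  imports
    "HOL-Analysis.Analysis"
    "HOL-Computational_Algebra.Formal_Power_Series"
    "HOL-Library.Extended_Nat"
    "HOL-Algebra.QuotRing"
    "HOL-Algebra.Embedded_Algebras"
begin

section \<open>Curve singularities, crosses and their coordinates\<close>

text \<open>
  A ring of formal power series in two variables over the complex numbers is the type
  \<^typ>\<open>complex fps fps\<close>; the inner series variable is the first variable, the outer one the second.
  The same type serves both as the completed local ring of \<open>(S,o)\<close>, written in some fixed
  auxiliary coordinates, and as the ring of power series in coordinates \<open>(x,y)\<close> adapted to a cross.
\<close>

definition coeff2 :: "complex fps fps \<Rightarrow> nat \<Rightarrow> nat \<Rightarrow> complex" where
  "coeff2 f i j = fps_nth (fps_nth f j) i"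

definition curve_singularity :: "complex fps fps \<Rightarrow> bool" where
  "curve_singularity h \<longleftrightarrow> h \<noteq> 0 \<and> \<not> h dvd 1"

text \<open>\<open>Z(l)\<close> is an irreducible component of \<open>Z(h)\<close>.\<close>

definition is_branch :: "complex fps fps \<Rightarrow> complex fps fps \<Rightarrow> bool" where
  "is_branch l h \<longleftrightarrow> Factorial_Ring.irreducible l \<and> l dvd h"

text \<open>
  \<open>Z(x)\<close> and \<open>Z(y)\<close> are smooth germs through \<open>o\<close> with different tangent lines, i.e. the linear parts
  of \<open>x\<close> and \<open>y\<close> are linearly independent.
\<close>

definition defines_cross :: "complex fps fps \<Rightarrow> complex fps fps \<Rightarrow> bool" where
  "defines_cross x y \<longleftrightarrow>
     coeff2 x 0 0 = 0 \<and> coeff2 y 0 0 = 0 \<and>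
     coeff2 x 1 0 * coeff2 y 0 1 - coeff2 x 0 1 * coeff2 y 1 0 \<noteq> 0"

text \<open>
  \<open>h = f(x,y)\<close>, that is, \<open>f\<close> is the expansion of \<open>h\<close> in the coordinates \<open>(x,y)\<close>. As \<open>x\<close> and \<open>y\<close> have
  no constant term, only the monomials \<open>x\<^sup>i y\<^sup>j\<close> with \<open>i + j \<le> m + n\<close> contribute to the coefficient
  with index \<open>(m,n)\<close>.
\<close>

definition is_expansion ::
    "complex fps fps \<Rightarrow> complex fps fps \<Rightarrow> complex fps fps \<Rightarrow> complex fps fps \<Rightarrow> bool" where
  "is_expansion x y h f \<longleftrightarrow>
     (\<forall>m n. coeff2 h m n =
        (\<Sum>(i, j) \<in> {(i, j). i + j \<le> m + n}. coeff2 f i j * coeff2 (x ^ i * y ^ j) m n))"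

section \<open>Newton polygon and Newton fan\<close>

text \<open>
  The lattice \<open>M\<close> of exponents is \<^typ>\<open>int \<times> int\<close>. Both \<open>M\<^sub>\<real>\<close> and \<open>N\<^sub>\<real>\<close> are \<^typ>\<open>real \<times> real\<close>, in dual
  bases, so that the pairing between them is the inner product. The set \<open>quadrant\<close> is
  \<open>\<sigma>\<^sub>0\<close> in \<open>N\<^sub>\<real>\<close> as well as \<open>\<real>\<^sub>+\<^sup>2\<close> in \<open>M\<^sub>\<real>\<close>.
\<close>

type_synonym lattice = "int \<times> int"
type_synonym cone = "(real \<times> real) set"

definition pt :: "lattice \<Rightarrow> real \<times> real" where
  "pt m = (real_of_int (fst m), real_of_int (snd m))"

definition quadrant :: "(real \<times> real) set" where
  "quadrant = {v. 0 \<le> fst v \<and> 0 \<le> snd v}"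

definition edge1 :: cone where "edge1 = {w. 0 \<le> fst w \<and> snd w = 0}"
definition edge2 :: cone where "edge2 = {w. fst w = 0 \<and> 0 \<le> snd w}"

text \<open>The coefficients of a power series, extended by zero to all of \<open>M\<close>.\<close>

definition lattice_coeff :: "complex fps fps \<Rightarrow> lattice \<Rightarrow> complex" where
  "lattice_coeff f m =
     (if 0 \<le> fst m \<and> 0 \<le> snd m then coeff2 f (nat (fst m)) (nat (snd m)) else 0)"

definition newton_polygon :: "complex fps fps \<Rightarrow> (real \<times> real) set" where
  "newton_polygon f = convex hull {pt m + v | m v. lattice_coeff f m \<noteq> 0 \<and> v \<in> quadrant}"

definition orthogonal_to_segment :: "cone \<Rightarrow> (real \<times> real) set \<Rightarrow> bool" where
  "orthogonal_to_segment \<rho> e \<longleftrightarrow> (\<forall>w\<in>\<rho>. \<forall>u\<in>e. \<forall>v\<in>e. w \<bullet> (u - v) = 0)"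

definition newton_rays :: "complex fps fps \<Rightarrow> cone set" where
  "newton_rays f = {edge1, edge2} \<union>
     {{w \<in> quadrant. \<forall>u\<in>e. \<forall>v\<in>e. w \<bullet> (u - v) = 0} | e. e edge_of newton_polygon f \<and> compact e}"

text \<open>The two-dimensional cones are those spanned by two consecutive rays.\<close>

definition fan_of_rays :: "cone set \<Rightarrow> cone set" where
  "fan_of_rays Rs = {{0}} \<union> Rs \<union>
     {convex hull (\<rho> \<union> \<rho>') | \<rho> \<rho>'. \<rho> \<in> Rs \<and> \<rho>' \<in> Rs \<and> \<rho> \<noteq> \<rho>' \<and>
        (\<forall>\<rho>''\<in>Rs. \<rho>'' \<subseteq> convex hull (\<rho> \<union> \<rho>') \<longrightarrow> \<rho>'' = \<rho> \<or> \<rho>'' = \<rho>')}"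

definition newton_fan :: "complex fps fps \<Rightarrow> cone set" where
  "newton_fan f = fan_of_rays (newton_rays f)"

definition has_integral_length :: "(real \<times> real) set \<Rightarrow> nat \<Rightarrow> bool" where
  "has_integral_length e l \<longleftrightarrow>
     (\<exists>A B u. e = closed_segment (pt A) (pt B) \<and> coprime (fst u) (snd u) \<and>
        fst B - fst A = int l * fst u \<and> snd B - snd A = int l * snd u)"

section \<open>The toric surface of a fan, its orbits and its boundary\<close>

text \<open>The semigroup \<open>\<sigma>\<^sup>\<or> \<inter> M\<close> and the group \<open>\<sigma>\<^sup>\<bottom> \<inter> M\<close>.\<close>

definition dual_cone :: "cone \<Rightarrow> lattice set" where
  "dual_cone \<tau> = {m. \<forall>w\<in>\<tau>. 0 \<le> w \<bullet> pt m}"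

definition perp :: "cone \<Rightarrow> lattice set" where
  "perp \<tau> = {m. \<forall>w\<in>\<tau>. w \<bullet> pt m = 0}"

text \<open>
  The closed points of the affine chart \<open>X\<^sub>\<tau> = Spec \<complex>[\<tau>\<^sup>\<or> \<inter> M]\<close> are the monoid homomorphisms from
  \<open>\<tau>\<^sup>\<or> \<inter> M\<close> to \<open>(\<complex>, \<cdot>)\<close>, here extended by zero to all of \<open>M\<close>. The orbit \<open>O\<^sub>\<tau>\<close> consists of those
  which vanish exactly outside \<open>\<tau>\<^sup>\<bottom>\<close>.
\<close>

definition chart :: "cone \<Rightarrow> (lattice \<Rightarrow> complex) set" where
  "chart \<tau> = {p. p 0 = 1 \<and> (\<forall>a\<in>dual_cone \<tau>. \<forall>b\<in>dual_cone \<tau>. p (a + b) = p a * p b) \<and>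
                 (\<forall>m. m \<notin> dual_cone \<tau> \<longrightarrow> p m = 0)}"

definition torus_orbit :: "cone \<Rightarrow> (lattice \<Rightarrow> complex) set" where
  "torus_orbit \<tau> = {p \<in> chart \<tau>. \<forall>m. p m \<noteq> 0 \<longleftrightarrow> m \<in> perp \<tau>}"

text \<open>
  A point of the toric surface lies in exactly one orbit; it is encoded as a pair consisting of the
  cone of that orbit and of the point as an element of the chart of that cone.
\<close>

type_synonym point = "cone \<times> (lattice \<Rightarrow> complex)"

definition toric_surface :: "cone set \<Rightarrow> point set" where
  "toric_surface F = {(\<tau>, p). \<tau> \<in> F \<and> p \<in> torus_orbit \<tau>}"

definition orbit :: "cone \<Rightarrow> point set" where
  "orbit \<rho> = {\<rho>} \<times> torus_orbit \<rho>"

text \<open>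
  The orbit \<open>O\<^sub>\<rho>\<close> meets the chart \<open>X\<^sub>\<tau>\<close> iff \<open>\<rho>\<close> is a face of \<open>\<tau>\<close>, the inclusion into \<open>X\<^sub>\<tau>\<close> being
  restriction to \<open>\<tau>\<^sup>\<or> \<inter> M\<close>. The analytic topology of \<open>X\<^sub>\<tau>\<close> is that of pointwise convergence, which
  is the topology of the function type.
\<close>

definition orbit_closure :: "cone set \<Rightarrow> cone \<Rightarrow> point set" where
  "orbit_closure F \<rho> = {(\<tau>, p) \<in> toric_surface F. \<rho> face_of \<tau> \<and>
     p \<in> closure ((\<lambda>q m. if m \<in> dual_cone \<tau> then q m else 0) ` torus_orbit \<rho>)}"

text \<open>The toric modification \<open>X\<^sub>F \<rightarrow> \<complex>\<^sup>2\<close> for a fan \<open>F\<close> subdividing \<open>\<sigma>\<^sub>0\<close>.\<close>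

definition modification_map :: "point \<Rightarrow> complex \<times> complex" where
  "modification_map P = (snd P (1, 0), snd P (0, 1))"

text \<open>The preimage of \<open>L + L'\<close>, that is, of \<open>xy = 0\<close>.\<close>

definition boundary :: "cone set \<Rightarrow> point set" where
  "boundary F = {P \<in> toric_surface F. fst (modification_map P) * snd (modification_map P) = 0}"

text \<open>
  The reduced boundary is defined in \<open>X\<^sub>\<tau>\<close> by the radical of the ideal generated by \<open>xy = \<chi>\<^sup>(\<^sup>1\<^sup>,\<^sup>1\<^sup>)\<close>,
  which is spanned by the monomials \<open>\<chi>\<^sup>m\<close> it contains.
\<close>

definition boundary_monomials :: "cone \<Rightarrow> lattice set" where
  "boundary_monomials \<tau> =
     {m \<in> dual_cone \<tau>. \<exists>k::nat. (int k * fst m - 1, int k * snd m - 1) \<in> dual_cone \<tau>}"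

text \<open>
  The Zariski tangent space at \<open>p\<close> of the reduced boundary: the derivations at \<open>p\<close> of
  \<open>\<complex>[\<tau>\<^sup>\<or> \<inter> M]\<close> that kill the ideal of the boundary, given by their values on monomials.
\<close>

definition boundary_tangent_space :: "point \<Rightarrow> (lattice \<Rightarrow> complex) set" where
  "boundary_tangent_space = (\<lambda>(\<tau>, p). {D.
     (\<forall>a\<in>dual_cone \<tau>. \<forall>b\<in>dual_cone \<tau>. D (a + b) = p a * D b + p b * D a) \<and>
     (\<forall>m\<in>boundary_monomials \<tau>. D m = 0) \<and> (\<forall>m. m \<notin> dual_cone \<tau> \<longrightarrow> D m = 0)})"

text \<open>
  The boundary is a curve, all of whose components have dimension one; so it is smooth at a point iff
  its Zariski tangent space there is a line.
\<close>

definition smooth_point_of_boundary :: "point \<Rightarrow> bool" where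
  "smooth_point_of_boundary P \<longleftrightarrow>
     (\<exists>D\<in>boundary_tangent_space P. D \<noteq> (\<lambda>_. 0) \<and>
        (\<forall>D'\<in>boundary_tangent_space P. \<exists>c. D' = (\<lambda>m. c * D m)))"

section \<open>Formal functions and the strict transform\<close>

text \<open>
  The ring of formal functions along the orbit \<open>O\<^sub>\<tau>\<close>, which is closed in \<open>X\<^sub>\<tau>\<close>: the completion of
  \<open>\<complex>[\<tau>\<^sup>\<or> \<inter> M]\<close> with respect to the ideal of \<open>O\<^sub>\<tau>\<close>, spanned by the \<open>\<chi>\<^sup>m\<close> with \<open>m \<in> \<tau>\<^sup>\<or> - \<tau>\<^sup>\<bottom>\<close>. An
  element \<open>\<Sum> g\<^sub>m \<chi>\<^sup>m\<close> is given by its coefficients. If \<open>\<tau>\<close> is an interior ray, this is a ring of power series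
  in one variable over a ring of Laurent polynomials; if \<open>\<tau>\<close> is two-dimensional, it is the
  complete local ring \<open>\<complex>[[\<tau>\<^sup>\<or> \<inter> M]]\<close>. Completing is needed because \<open>f\<close> is only a formal series.
\<close>

definition formal_functions :: "cone \<Rightarrow> (lattice \<Rightarrow> complex) ring" where
  "formal_functions \<tau> =
     \<lparr>carrier = {g. (\<forall>m. g m \<noteq> 0 \<longrightarrow> m \<in> dual_cone \<tau>) \<and>
                    (\<forall>w\<in>rel_interior \<tau>. \<forall>c. finite {m. g m \<noteq> 0 \<and> w \<bullet> pt m \<le> c})},
      mult = (\<lambda>g h m. \<Sum>a | g a \<noteq> 0 \<and> h (m - a) \<noteq> 0. g a * h (m - a)),
      one = (\<lambda>m. if m = 0 then 1 else 0),
      zero = (\<lambda>_. 0),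
      add = (\<lambda>g h m. g m + h m)\<rparr>"

definition monomial :: "lattice \<Rightarrow> lattice \<Rightarrow> complex" where
  "monomial m0 = (\<lambda>m. if m = m0 then 1 else 0)"

text \<open>The value of a formal function along \<open>O\<^sub>\<tau>\<close> at a point \<open>p\<close> of \<open>O\<^sub>\<tau>\<close>.\<close>

definition value_at :: "(lattice \<Rightarrow> complex) \<Rightarrow> (lattice \<Rightarrow> complex) \<Rightarrow> complex" where
  "value_at p g = (\<Sum>m | g m \<noteq> 0 \<and> p m \<noteq> 0. g m * p m)"

text \<open>
  The strict transform is the closure of the preimage of \<open>C - {o}\<close>. Along \<open>O\<^sub>\<tau>\<close> its ideal is therefore
  the saturation \<open>((f) : (x,y)\<^sup>\<infinity>)\<close> of the ideal \<open>(f)\<close> of the total transform by the pullback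
  of the maximal ideal of \<open>o\<close>. As the pullback of the monomial \<open>x\<^sup>i y\<^sup>j\<close> is \<open>\<chi>\<^sup>(\<^sup>i\<^sup>,\<^sup>j\<^sup>)\<close>, the pullback of
  \<open>f\<close> has the coefficients of \<open>f\<close>.
\<close>

definition strict_transform_ideal :: "complex fps fps \<Rightarrow> cone \<Rightarrow> (lattice \<Rightarrow> complex) set" where
  "strict_transform_ideal f \<tau> = (let R = formal_functions \<tau> in
     {g \<in> carrier R. \<exists>k::nat.
        monomial (int k, 0) \<otimes>\<^bsub>R\<^esub> g \<in> PIdl\<^bsub>R\<^esub> (lattice_coeff f) \<and>
        monomial (0, int k) \<otimes>\<^bsub>R\<^esub> g \<in> PIdl\<^bsub>R\<^esub> (lattice_coeff f)})"

text \<open>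
  The strict transform is a formal germ along the preimage of \<open>o\<close>, so its closed points lie
  over \<open>o\<close>. The orbits of these points are those of the cones whose relative interior is contained in the interior
  of \<open>\<sigma>\<^sub>0\<close>, and for these cones \<open>f\<close> does define a formal function along the orbit.
\<close>

definition strict_transform :: "complex fps fps \<Rightarrow> point set" where
  "strict_transform f = {(\<tau>, p) \<in> toric_surface (newton_fan f).
     modification_map (\<tau>, p) = (0, 0) \<and> (\<forall>g\<in>strict_transform_ideal f \<tau>. value_at p g = 0)}"

section \<open>Intersection multiplicities\<close>

text \<open>
  The ideal of the orbit closure of \<open>\<rho>\<close> along \<open>O\<^sub>\<tau>\<close>, for a face \<open>\<rho>\<close> of \<open>\<tau>\<close>: it is topologically generated
  by the \<open>\<chi>\<^sup>m\<close> with \<open>m \<in> \<tau>\<^sup>\<or> - \<rho>\<^sup>\<bottom>\<close>.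
\<close>

definition orbit_closure_ideal :: "cone \<Rightarrow> cone \<Rightarrow> (lattice \<Rightarrow> complex) set" where
  "orbit_closure_ideal \<rho> \<tau> = {g \<in> carrier (formal_functions \<tau>). \<forall>m\<in>perp \<rho>. g m = 0}"

text \<open>
  The formal functions whose germ at \<open>p\<close> belongs to the ideal generated by \<open>I\<close> in the local ring \<open>\<O>\<^sub>p\<close>
  (the localization of \<open>R\<close> at the maximal ideal of functions vanishing at \<open>p\<close>).
\<close>

definition local_contraction ::
    "cone \<Rightarrow> (lattice \<Rightarrow> complex) \<Rightarrow> (lattice \<Rightarrow> complex) set \<Rightarrow> (lattice \<Rightarrow> complex) set" where
  "local_contraction \<tau> p I = (let R = formal_functions \<tau> in
     {g \<in> carrier R. \<exists>h\<in>carrier R. value_at p h \<noteq> 0 \<and> h \<otimes>\<^bsub>R\<^esub> g \<in> I})"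

text \<open>The dimension over the complex numbers of a quotient \<open>R/I\<close>, possibly infinite.\<close>

definition quotient_dim :: "(lattice \<Rightarrow> complex) ring \<Rightarrow> (lattice \<Rightarrow> complex) set \<Rightarrow> enat" where
  "quotient_dim R I = (let Q = R Quot I; K = range (\<lambda>c. I +>\<^bsub>R\<^esub> (\<lambda>m. if m = 0 then c else 0)) in
     if \<exists>n. ring.dimension Q n K (carrier Q)
     then enat (THE n. ring.dimension Q n K (carrier Q)) else \<infinity>)"

text \<open>
  The intersection multiplicity at a point \<open>p\<close> of the strict transform \<open>Z(J)\<close> with the orbit closure
  \<open>Z(I)\<close> is \<open>dim\<^sub>\<complex> \<O>\<^sub>p/(J + I)\<O>\<^sub>p\<close>. With \<open>K\<close> the contraction of \<open>(J + I)\<O>\<^sub>p\<close> to the ring \<open>R\<close>, this is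
  \<open>dim\<^sub>\<complex> R/K\<close>: the injection \<open>R/K \<rightarrow> \<O>\<^sub>p/(J + I)\<O>\<^sub>p\<close> is bijective if \<open>R/K\<close> has finite dimension, since a
  function not vanishing at \<open>p\<close> is then already invertible modulo \<open>K\<close>.
\<close>

definition intersection_multiplicity :: "complex fps fps \<Rightarrow> cone \<Rightarrow> point \<Rightarrow> enat" where
  "intersection_multiplicity f \<rho> = (\<lambda>(\<tau>, p). let R = formal_functions \<tau> in
     quotient_dim R (local_contraction \<tau> p
       (strict_transform_ideal f \<tau> <+>\<^bsub>R\<^esub> orbit_closure_ideal \<rho> \<tau>)))"

end

theory Submission
  imports Defs "HOL-Computational_Algebra.Fundamental_Theorem_Algebra"
begin

text \<open>
  Let \<open>\<tau>\<close> be a cone of the Newton fan that meets the interior of \<open>\<sigma>\<^sub>0\<close>. If \<open>\<tau>\<close> is two-dimensional,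
  one vertex \<open>v\<close> of the Newton polygon minimizes all \<open>w \<in> \<tau>\<close>, so \<open>\<chi>\<^sup>-\<^sup>v f\<close> is a formal function which
  belongs to the ideal of the strict transform and whose value at the closed orbit is the coefficient
  of \<open>f\<close> at \<open>v\<close>: the strict transform misses \<open>O\<^sub>\<tau>\<close>. If \<open>\<tau>\<close> is an interior ray, spanned by a primitive
  vector \<open>(p, q)\<close>, and \<open>A\<close> is an end of the orthogonal edge, the ideal is generated by \<open>\<chi>\<^sup>-\<^sup>A f\<close>. Its
  restriction to \<open>O\<^sub>\<tau> \<simeq> \<complex>\<^sup>*\<close> is a polynomial in one variable whose degree is the integral length of
  the edge, with nonzero constant term. So the intersection points are its roots, counted with their
  multiplicities.
\<close>

section \<open>Expansions in the coordinates of a cross\<close>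

text \<open>The hypotheses on branches put a power of \<open>x\<close> and a power of
  \<open>y\<close> into the support of \<open>f\<close>. On a two-dimensional cone bordering an edge
  of \<open>\<sigma>_0\<close> this is what allows powers of both \<open>x\<close> and
  \<open>y\<close> to undo the division by \<open>\<chi>^v\<close>. One vertex serves a whole
  two-dimensional cone because a change of vertex would require a tie between two points of the
  support, and the directions of such ties span rays of the fan. Along an interior ray the obstacle
  is the saturation, which has to be shown principal before it can be restricted to the orbit. This
  rests on the grading by the primitive vector \<open>(p, q)\<close>, in which lowest parts multiply
  without cancellation. A multiplicity is the dimension of a quotient of the completed ring. It is
  computed by filtering this ring by the order of vanishing at the point, the other roots being
  absorbed by multipliers that do not vanish there.\<close>

lemma coeff2_mult: "coeff2 (g * h) m n = (\<Sum>i\<le>m. \<Sum>j\<le>n. coeff2 g i j * coeff2 h (m - i) (n - j))"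
proof -
  have "coeff2 (g * h) m n = (\<Sum>j\<le>n. \<Sum>i\<le>m. coeff2 g i j * coeff2 h (m - i) (n - j))"
    by (simp add: coeff2_def fps_mult_nth fps_sum_nth atLeast0AtMost)
  then show ?thesis by (subst (asm) sum.swap)
qed

lemma coeff2_sum: "coeff2 (sum g A) m n = (\<Sum>a\<in>A. coeff2 (g a) m n)"
  by (simp add: coeff2_def fps_sum_nth)

lemma coeff2_const_mult: "coeff2 (fps_const (fps_const c) * g) m n = c * coeff2 g m n"
  by (simp add: coeff2_def)

lemma fps_fps_eqI: "(\<And>m n. coeff2 g m n = coeff2 h m n) \<Longrightarrow> g = h"
  by (simp add: coeff2_def fps_eq_iff)

text \<open>Membership in the \<open>d\<close>-th power of the maximal ideal, expressed by
  coefficients.\<close>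

definition low_order :: "nat \<Rightarrow> complex fps fps \<Rightarrow> bool" where
  "low_order d g \<longleftrightarrow> (\<forall>m n. m + n < d \<longrightarrow> coeff2 g m n = 0)"

lemma low_order_mult:
  assumes "low_order d g" "low_order e h" shows "low_order (d + e) (g * h)"
  unfolding low_order_def
proof (intro allI impI)
  fix m n assume mn: "m + n < d + e"
  have "coeff2 g i j * coeff2 h (m - i) (n - j) = 0" if "i \<le> m" "j \<le> n" for i j
  proof (cases "i + j < d")
    case False
    then have "(m - i) + (n - j) < e" using mn that by simp
    then show ?thesis using assms by (simp add: low_order_def)
  qed (use assms in \<open>simp add: low_order_def\<close>)
  then show "coeff2 (g * h) m n = 0" unfolding coeff2_mult by (intro sum.neutral ballI) auto
qed

lemma low_order_power: "low_order 1 g \<Longrightarrow> low_order d (g ^ d)"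
proof (induction d)
  case 0
  then show ?case by (simp add: low_order_def)
next
  case (Suc d)
  then show ?case using low_order_mult[of 1 g d "g ^ d"] by simp
qed

lemma low_order_monomial:
  assumes "coeff2 x 0 0 = 0" "coeff2 y 0 0 = 0"
  shows "low_order (i + j) (x ^ i * y ^ j)"
  using assms by (intro low_order_mult low_order_power) (auto simp: low_order_def)

text \<open>Non-units have no constant term, so a product of two of them has order at least two and
  cannot have a linear term.\<close>

lemma cross_irreducible:
  assumes "coeff2 x 0 0 = 0" and "coeff2 x 1 0 \<noteq> 0 \<or> coeff2 x 0 1 \<noteq> 0"
  shows "Factorial_Ring.irreducible x"
proof (rule irreducibleI)
  \<comment> \<open>Invertibility is lifted twice: a nonzero constant term makes the inner series
    \<open>fps_nth g 0\<close> invertible, and this makes the outer series invertible.\<close>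
  have unit: "g dvd 1" if "coeff2 g 0 0 \<noteq> 0" for g :: "complex fps fps"
  proof -
    have "fps_nth g 0 * inverse (fps_nth g 0) = 1"
      using that by (metis coeff2_def inverse_mult_eq_1 mult.commute)
    then have "g * fps_right_inverse g (inverse (fps_nth g 0)) = 1" by (rule fps_right_inverse)
    then show ?thesis by (metis dvd_triv_left)
  qed
  show "x \<noteq> 0" using assms by (auto simp: coeff2_def)
  show "\<not> x dvd 1"
  proof
    assume "x dvd 1"
    then obtain g where "x * g = 1" by (metis dvdE)
    then have "coeff2 (x * g) 0 0 = 1" by (simp add: coeff2_def)
    then show False using assms by (simp add: coeff2_mult)
  qed
  fix g h assume x: "x = g * h"
  show "g dvd 1 \<or> h dvd 1"
  proof (rule ccontr)
    assume "\<not> (g dvd 1 \<or> h dvd 1)"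
    then have "coeff2 g 0 0 = 0" "coeff2 h 0 0 = 0" using unit by blast+
    then have "low_order (1 + 1) x" unfolding x by (intro low_order_mult) (auto simp: low_order_def)
    then show False using assms by (auto simp: low_order_def)
  qed
qed

text \<open>The quotient is summed coefficientwise; below total degree \<open>N\<close> it agrees with a finite sum,
  so that no convergence of power series in two variables is needed.\<close>

lemma expansion_dvd:
  assumes cross: "coeff2 x 0 0 = 0" "coeff2 y 0 0 = 0" "coeff2 z 0 0 = 0"
    and exp: "is_expansion x y h f"
    and Y: "\<And>i j. coeff2 f i j \<noteq> 0 \<Longrightarrow> x ^ i * y ^ j = z * Y i j"
    and low: "\<And>i j. low_order (i + j - 1) (Y i j)"
  shows "z dvd h"
proof
  define G where "G N = (\<Sum>(i, j) \<in> {(i, j). i + j \<le> N}. fps_const (fps_const (coeff2 f i j)) * Y i j)" for N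
  \<comment> \<open>Dividing by \<open>z\<close> lowers the order of a monomial by at most one, so
    terms with \<open>i + j = m + n + 1\<close> may still reach the coefficient with index
    \<open>(m, n)\<close>; hence the \<open>Suc\<close>.\<close>
  define g where "g = Abs_fps (\<lambda>n. Abs_fps (\<lambda>m. coeff2 (G (Suc (m + n))) m n))"
  have fin: "finite {(i, j). i + j \<le> (N::nat)}" for N
    by (rule finite_subset[of _ "{..N} \<times> {..N}"]) auto
  have G: "coeff2 (G N) m n = coeff2 (G (Suc (m + n))) m n" if "m + n < N" for m n N
  proof -
    have "coeff2 (G N) m n = (\<Sum>(i, j) \<in> {(i, j). i + j \<le> N}. coeff2 f i j * coeff2 (Y i j) m n)"
      by (simp add: G_def coeff2_sum coeff2_const_mult case_prod_unfold)
    also have "\<dots> = (\<Sum>(i, j) \<in> {(i, j). i + j \<le> Suc (m + n)}. coeff2 f i j * coeff2 (Y i j) m n)"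
    proof (rule sum.mono_neutral_right[OF fin], use that in force, intro ballI)
      fix k assume "k \<in> {(i, j). i + j \<le> N} - {(i, j). i + j \<le> Suc (m + n)}"
      then have "m + n < fst k + snd k - 1" by auto
      then show "(case k of (i, j) \<Rightarrow> coeff2 f i j * coeff2 (Y i j) m n) = 0"
        using low[of "fst k" "snd k"] by (simp add: low_order_def case_prod_unfold)
    qed
    also have "\<dots> = coeff2 (G (Suc (m + n))) m n"
      by (simp add: G_def coeff2_sum coeff2_const_mult case_prod_unfold)
    finally show ?thesis .
  qed
  show "h = z * g"
  proof (rule fps_fps_eqI)
    fix m n
    \<comment> \<open>Only coefficients of \<open>g\<close> with index at most \<open>(m, n)\<close>
      enter, and on all of them one finite sum agrees with \<open>g\<close>.\<close>
    have "coeff2 (z * g) m n = coeff2 (z * G (Suc (m + n))) m n"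
      unfolding coeff2_mult
    proof (intro sum.cong refl)
      fix i j assume "i \<in> {..m}" "j \<in> {..n}"
      then have "coeff2 (G (Suc (m + n))) (m - i) (n - j) = coeff2 g (m - i) (n - j)"
        by (subst G) (auto simp: g_def coeff2_def)
      then show "coeff2 z i j * coeff2 g (m - i) (n - j) = coeff2 z i j * coeff2 (G (Suc (m + n))) (m - i) (n - j)"
        by simp
    qed
    also have "z * G (Suc (m + n)) =
        (\<Sum>(i, j) \<in> {(i, j). i + j \<le> Suc (m + n)}. fps_const (fps_const (coeff2 f i j)) * (x ^ i * y ^ j))"
      unfolding G_def sum_distrib_left
    proof (intro sum.cong refl, safe)
      fix i j
      show "z * (fps_const (fps_const (coeff2 f i j)) * Y i j) = fps_const (fps_const (coeff2 f i j)) * (x ^ i * y ^ j)"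
        using Y[of i j] by (cases "coeff2 f i j = 0") (simp_all add: mult_ac)
    qed
    also have "coeff2 \<dots> m n =
        (\<Sum>(i, j) \<in> {(i, j). i + j \<le> Suc (m + n)}. coeff2 f i j * coeff2 (x ^ i * y ^ j) m n)"
      by (simp add: coeff2_sum coeff2_const_mult case_prod_unfold)
    also have "\<dots> = (\<Sum>(i, j) \<in> {(i, j). i + j \<le> m + n}. coeff2 f i j * coeff2 (x ^ i * y ^ j) m n)"
    proof (rule sum.mono_neutral_right[OF fin], force, intro ballI)
      fix k assume "k \<in> {(i, j). i + j \<le> Suc (m + n)} - {(i, j). i + j \<le> m + n}"
      then have "m + n < fst k + snd k" by auto
      then show "(case k of (i, j) \<Rightarrow> coeff2 f i j * coeff2 (x ^ i * y ^ j) m n) = 0"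
        using low_order_monomial[OF cross(1,2), of "fst k" "snd k"]
        by (simp add: low_order_def case_prod_unfold)
    qed
    also have "\<dots> = coeff2 h m n" using exp by (simp add: is_expansion_def)
    finally show "coeff2 h m n = coeff2 (z * g) m n" by simp
  qed
qed

text \<open>If \<open>f\<close> had no pure power of \<open>y\<close>, each of its monomials would
  be divisible by \<open>x\<close>, hence so would \<open>h\<close>; as \<open>x\<close> is
  irreducible, \<open>Z(x)\<close> would be a branch. The other case is symmetric.\<close>

lemma pure_powers:
  assumes cross: "defines_cross x y" and exp: "is_expansion x y h f"
    and nx: "\<not> is_branch x h" and ny: "\<not> is_branch y h"
  shows "\<exists>i. coeff2 f i 0 \<noteq> 0" "\<exists>j. coeff2 f 0 j \<noteq> 0"
proof -
  have 0: "coeff2 x 0 0 = 0" "coeff2 y 0 0 = 0" using cross by (auto simp: defines_cross_def)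
  have irr: "Factorial_Ring.irreducible x" "Factorial_Ring.irreducible y"
    using cross by (auto intro!: cross_irreducible simp: defines_cross_def)
  show "\<exists>j. coeff2 f 0 j \<noteq> 0"
  proof (rule ccontr)
    assume none: "\<nexists>j. coeff2 f 0 j \<noteq> 0"
    have "x dvd h"
    proof (rule expansion_dvd[OF 0 0(1) exp])
      fix i j assume "coeff2 f i j \<noteq> 0"
      with none have "i \<noteq> 0" by (intro notI) simp
      then show "x ^ i * y ^ j = x * (x ^ (i - 1) * y ^ j)" by (cases i) auto
    next
      fix i j
      show "low_order (i + j - 1) (x ^ (i - 1) * y ^ j)"
        using low_order_monomial[OF 0, of "i - 1" j] by (auto simp: low_order_def)
    qed
    then show False using nx irr by (simp add: is_branch_def)
  qed
  show "\<exists>i. coeff2 f i 0 \<noteq> 0"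
  proof (rule ccontr)
    assume none: "\<nexists>i. coeff2 f i 0 \<noteq> 0"
    have "y dvd h"
    proof (rule expansion_dvd[OF 0 0(2) exp])
      fix i j assume "coeff2 f i j \<noteq> 0"
      with none have "j \<noteq> 0" by (intro notI) simp
      then show "x ^ i * y ^ j = y * (x ^ i * y ^ (j - 1))" by (cases j) auto
    next
      fix i j
      show "low_order (i + j - 1) (x ^ i * y ^ (j - 1))"
        using low_order_monomial[OF 0, of i "j - 1"] by (auto simp: low_order_def)
    qed
    then show False using ny irr by (simp add: is_branch_def)
  qed
qed

section \<open>Formal functions along the orbit of an interior ray\<close>

text \<open>The convolution has at most one nonzero term, so no membership in the carrier is
  involved; the rule serves rays and two-dimensional cones alike.\<close>

lemma monomial_mult: "(monomial n \<otimes>\<^bsub>formal_functions \<tau>\<^esub> g) m = g (m - n)"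
proof -
  have "(monomial n \<otimes>\<^bsub>formal_functions \<tau>\<^esub> g) m
      = (\<Sum>k | monomial n k \<noteq> 0 \<and> g (m - k) \<noteq> 0. monomial n k * g (m - k))"
    by (simp add: formal_functions_def)
  also have "\<dots> = (\<Sum>k\<in>{n}. monomial n k * g (m - k))"
    by (rule sum.mono_neutral_left) (auto simp: monomial_def split: if_splits)
  finally show ?thesis by (simp add: monomial_def)
qed

text \<open>The ray is spanned by \<open>(p, q)\<close>. As \<open>(a, b)\<close> and \<open>(q, -p)\<close> form a basis of \<open>M\<close>, \<open>deg\<close> and \<open>idx\<close> are the
  coordinates of \<open>M\<close> in this basis.\<close>

locale ray =
  fixes p q a b :: int
  assumes p_pos: "0 < p" and q_pos: "0 < q" and bezout: "p * a + q * b = 1"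
begin

definition deg :: "lattice \<Rightarrow> int" where "deg m = p * fst m + q * snd m"
definition idx :: "lattice \<Rightarrow> int" where "idx m = b * fst m - a * snd m"
definition lat :: "int \<Rightarrow> int \<Rightarrow> lattice" where "lat d k = (d * a + k * q, d * b - k * p)"
definition dirv :: "real \<Rightarrow> real \<times> real" where "dirv t = (t * real_of_int p, t * real_of_int q)"
definition C :: cone where "C = dirv ` {0..}"

abbreviation R where "R \<equiv> formal_functions C"

lemma deg_add [simp]: "deg (m + n) = deg m + deg n" by (simp add: deg_def algebra_simps)
lemma deg_diff [simp]: "deg (m - n) = deg m - deg n" by (simp add: deg_def algebra_simps)
lemma idx_add [simp]: "idx (m + n) = idx m + idx n" by (simp add: idx_def algebra_simps)
lemma idx_diff [simp]: "idx (m - n) = idx m - idx n" by (simp add: idx_def algebra_simps)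
lemma deg_0 [simp]: "deg 0 = 0" by (simp add: deg_def)
lemma idx_0 [simp]: "idx 0 = 0" by (simp add: idx_def)

lemma deg_lat [simp]: "deg (lat d k) = d"
proof -
  have "deg (lat d k) = d * (p * a + q * b)" by (simp add: deg_def lat_def algebra_simps)
  then show ?thesis by (simp add: bezout)
qed

lemma idx_lat [simp]: "idx (lat d k) = k"
proof -
  have "idx (lat d k) = k * (p * a + q * b)" by (simp add: idx_def lat_def algebra_simps)
  then show ?thesis by (simp add: bezout)
qed

lemma lat_deg_idx [simp]: "lat (deg m) (idx m) = m"
proof -
  have "lat (deg m) (idx m) = (fst m * (p * a + q * b), snd m * (p * a + q * b))"
    by (simp add: deg_def idx_def lat_def algebra_simps)
  then show ?thesis by (simp add: bezout)
qed

lemma lat_add: "lat (d + d') (k + k') = lat d k + lat d' k'" by (simp add: lat_def algebra_simps)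
lemma lat_diff: "lat (d - d') (k - k') = lat d k - lat d' k'" by (simp add: lat_def algebra_simps)

lemma lattice_eqI: "deg m = deg n \<Longrightarrow> idx m = idx n \<Longrightarrow> m = n"
  by (metis lat_deg_idx)

lemma inner_pt: "dirv t \<bullet> pt m = t * real_of_int (deg m)"
  by (simp add: pt_def deg_def dirv_def algebra_simps)

lemma dual_cone_C: "m \<in> dual_cone C \<longleftrightarrow> 0 \<le> deg m"
proof
  assume "m \<in> dual_cone C"
  then have "0 \<le> dirv 1 \<bullet> pt m"
    unfolding dual_cone_def C_def by simp
  then show "0 \<le> deg m" unfolding inner_pt by simp
qed (auto simp: dual_cone_def C_def inner_pt)

lemma perp_C: "m \<in> perp C \<longleftrightarrow> deg m = 0"
proof
  assume "m \<in> perp C"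
  then have "dirv 1 \<bullet> pt m = 0"
    unfolding perp_def C_def by simp
  then show "deg m = 0" unfolding inner_pt by simp
qed (auto simp: perp_def C_def inner_pt)

lemma dirv_inj [simp]: "dirv s = dirv t \<longleftrightarrow> s = t"
  using p_pos by (auto simp: dirv_def)

lemma dirv_comb: "u *\<^sub>R dirv s + v *\<^sub>R dirv t = dirv (u * s + v * t)"
  by (simp add: dirv_def algebra_simps)

lemma dirv_mem_C [simp]: "dirv t \<in> C \<longleftrightarrow> 0 \<le> t"
  by (auto simp: C_def)

lemma convex_C: "convex C"
  by (auto simp: convex_def C_def dirv_comb)

text \<open>A point of a convex set is relatively interior iff every segment ending there can be
  prolonged inside the set; the segment from \<open>dirv 1\<close> excludes the apex.\<close>

lemma rel_interior_C: "rel_interior C = dirv ` {0<..}"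
proof -
  have ne: "C \<noteq> {}" by (simp add: C_def)
  note iff = convex_rel_interior_iff[OF convex_C ne]
  show ?thesis
  proof (intro equalityI subsetI)
    fix w assume w: "w \<in> rel_interior C"
    then obtain t where t: "w = dirv t" "0 \<le> t"
      using rel_interior_subset unfolding C_def by (metis atLeast_iff imageE subsetD)
    have "dirv 1 \<in> C" by simp
    with w obtain e where "e > 1" "(1 - e) *\<^sub>R dirv 1 + e *\<^sub>R w \<in> C"
      unfolding iff by blast
    then have "0 \<le> (1 - e) + e * t" unfolding t(1) dirv_comb by simp
    then have "t \<noteq> 0" using \<open>e > 1\<close> by auto
    then show "w \<in> dirv ` {0<..}" using t by simp
  next
    fix w assume "w \<in> dirv ` {0<..}"
    then obtain t where t: "w = dirv t" "0 < t" by auto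
    have "\<exists>e>1. (1 - e) *\<^sub>R x + e *\<^sub>R w \<in> C" if "x \<in> C" for x
    proof -
      from that obtain s where s: "x = dirv s" "0 \<le> s" by (auto simp: C_def)
      \<comment> \<open>Prolonging beyond \<open>w\<close> moves towards the apex by at most
        \<open>t * s / (s + 1)\<close>, which is less than \<open>t\<close>.\<close>
      define e where "e = 1 + t / (s + 1)"
      have "e > 1" using s t by (simp add: e_def)
      have "(1 - e) * s + e * t = t / (s + 1) + t * t / (s + 1)"
        using s by (simp add: e_def field_simps)
      then have "0 \<le> (1 - e) * s + e * t" using s t by simp
      then show ?thesis using \<open>e > 1\<close> unfolding s t(1) dirv_comb by auto
    qed
    then show "w \<in> rel_interior C" unfolding iff by blast
  qed
qed

text \<open>Every vector of the relative interior is a positive multiple of \<open>(p, q)\<close>,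
  so all the finiteness conditions amount to the one for the integer grading
  \<open>deg\<close>.\<close>

lemma carrier_R: "g \<in> carrier R \<longleftrightarrow>
  (\<forall>m. g m \<noteq> 0 \<longrightarrow> 0 \<le> deg m) \<and> (\<forall>c. finite {m. g m \<noteq> 0 \<and> deg m \<le> c})"
proof -
  have "(\<forall>w\<in>rel_interior C. \<forall>c. finite {m. g m \<noteq> 0 \<and> w \<bullet> pt m \<le> c}) \<longleftrightarrow>
      (\<forall>c. finite {m. g m \<noteq> 0 \<and> deg m \<le> c})" (is "?l = ?r")
  proof
    assume l: ?l
    have "dirv 1 \<in> rel_interior C" by (simp add: rel_interior_C)
    then have "finite {m. g m \<noteq> 0 \<and> 1 * real_of_int (deg m) \<le> real_of_int c}" for c
      using l unfolding inner_pt[symmetric] by blast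
    then show ?r by simp
  next
    assume r: ?r
    show ?l
    proof (intro ballI allI)
      fix w c assume "w \<in> rel_interior C"
      then obtain t where t: "w = dirv t" "0 < t" by (auto simp: rel_interior_C)
      have "w \<bullet> pt m \<le> c \<longleftrightarrow> deg m \<le> \<lfloor>c / t\<rfloor>" for m
        unfolding t(1) inner_pt using t(2) by (simp add: le_floor_iff field_simps)
      then show "finite {m. g m \<noteq> 0 \<and> w \<bullet> pt m \<le> c}" using r by simp
    qed
  qed
  then show ?thesis by (simp add: formal_functions_def dual_cone_C)
qed

lemma deg_nonneg: "g \<in> carrier R \<Longrightarrow> g m \<noteq> 0 \<Longrightarrow> 0 \<le> deg m"
  and finite_low: "g \<in> carrier R \<Longrightarrow> finite {m. g m \<noteq> 0 \<and> deg m \<le> c}"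
  unfolding carrier_R by blast+

section \<open>The convolution product of formal functions\<close>

lemma mult_R: "(g \<otimes>\<^bsub>R\<^esub> h) m = (\<Sum>n | g n \<noteq> 0 \<and> h (m - n) \<noteq> 0. g n * h (m - n))"
  by (simp add: formal_functions_def)

lemma mult_R_superset:
  assumes "finite A" "\<And>n. g n \<noteq> 0 \<Longrightarrow> h (m - n) \<noteq> 0 \<Longrightarrow> n \<in> A"
  shows "(g \<otimes>\<^bsub>R\<^esub> h) m = (\<Sum>n\<in>A. g n * h (m - n))"
  unfolding mult_R by (rule sum.mono_neutral_left) (use assms in auto)

text \<open>The second factor vanishes in negative degrees, so one finite index set serves all
  \<open>m\<close> of degree at most \<open>c\<close>. This makes exchanges of summation
  possible.\<close>

lemma mult_R_low:
  assumes "g \<in> carrier R" "h \<in> carrier R" "deg m \<le> c"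
  shows "(g \<otimes>\<^bsub>R\<^esub> h) m = (\<Sum>n | g n \<noteq> 0 \<and> deg n \<le> c. g n * h (m - n))"
proof (rule mult_R_superset)
  fix n assume "g n \<noteq> 0" "h (m - n) \<noteq> 0"
  then have "0 \<le> deg (m - n)" using assms deg_nonneg by blast
  then show "n \<in> {n. g n \<noteq> 0 \<and> deg n \<le> c}" using \<open>g n \<noteq> 0\<close> assms by simp
qed (use assms finite_low in auto)

lemma mult_R_nonzeroE:
  assumes "(g \<otimes>\<^bsub>R\<^esub> h) m \<noteq> 0"
  obtains n where "g n \<noteq> 0" "h (m - n) \<noteq> 0"
proof -
  have "\<exists>n. g n \<noteq> 0 \<and> h (m - n) \<noteq> 0"
  proof (rule ccontr)
    assume "\<nexists>n. g n \<noteq> 0 \<and> h (m - n) \<noteq> 0"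
    then have "(g \<otimes>\<^bsub>R\<^esub> h) m = 0" unfolding mult_R by (intro sum.neutral) blast
    with assms show False by simp
  qed
  with that show ?thesis by blast
qed

text \<open>A term of degree at most \<open>c\<close> comes from two terms of nonnegative degree,
  hence from terms of degree at most \<open>c\<close>, and there are finitely many of those.\<close>

lemma mult_R_closed:
  assumes g: "g \<in> carrier R" and h: "h \<in> carrier R"
  shows "g \<otimes>\<^bsub>R\<^esub> h \<in> carrier R"
  unfolding carrier_R
proof (intro conjI allI impI)
  fix m assume "(g \<otimes>\<^bsub>R\<^esub> h) m \<noteq> 0"
  then obtain n where "g n \<noteq> 0" "h (m - n) \<noteq> 0" by (rule mult_R_nonzeroE)
  then have "0 \<le> deg n" "0 \<le> deg (m - n)" using g h deg_nonneg by blast+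
  then show "0 \<le> deg m" by simp
next
  fix c
  let ?S = "\<lambda>g. {m. g m \<noteq> 0 \<and> deg m \<le> c}"
  have "{m. (g \<otimes>\<^bsub>R\<^esub> h) m \<noteq> 0 \<and> deg m \<le> c} \<subseteq> (\<lambda>(m, n). m + n) ` (?S g \<times> ?S h)"
  proof safe
    fix x y assume *: "(g \<otimes>\<^bsub>R\<^esub> h) (x, y) \<noteq> 0" "deg (x, y) \<le> c"
    then obtain n where n: "g n \<noteq> 0" "h ((x, y) - n) \<noteq> 0" by (elim mult_R_nonzeroE)
    then have "0 \<le> deg n" "0 \<le> deg ((x, y) - n)" using g h deg_nonneg by blast+
    then have "(n, (x, y) - n) \<in> ?S g \<times> ?S h" using n * by simp
    then show "(x, y) \<in> (\<lambda>(m, n). m + n) ` (?S g \<times> ?S h)" by force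
  qed
  then show "finite {m. (g \<otimes>\<^bsub>R\<^esub> h) m \<noteq> 0 \<and> deg m \<le> c}"
    by (rule finite_subset) (use g h finite_low in auto)
qed

lemma add_R: "(g \<oplus>\<^bsub>R\<^esub> h) m = g m + h m" by (simp add: formal_functions_def)
lemma zero_R: "\<zero>\<^bsub>R\<^esub> = (\<lambda>_. 0)" by (simp add: formal_functions_def)
lemma one_R: "\<one>\<^bsub>R\<^esub> = (\<lambda>m. if m = 0 then 1 else 0)" by (simp add: formal_functions_def)

text \<open>Membership in the carrier depends on the support alone; two bounding series are allowed
  in order to cover sums and differences.\<close>

lemma carrier_R_if_low_subset:
  assumes "g \<in> carrier R" "g' \<in> carrier R" "\<And>m. h m \<noteq> 0 \<Longrightarrow> g m \<noteq> 0 \<or> g' m \<noteq> 0"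
  shows "h \<in> carrier R"
  unfolding carrier_R
proof (intro conjI allI impI)
  fix c
  have "{m. h m \<noteq> 0 \<and> deg m \<le> c} \<subseteq> {m. g m \<noteq> 0 \<and> deg m \<le> c} \<union> {m. g' m \<noteq> 0 \<and> deg m \<le> c}"
    using assms(3) by blast
  then show "finite {m. h m \<noteq> 0 \<and> deg m \<le> c}"
    by (rule finite_subset) (use assms finite_low in auto)
qed (use assms deg_nonneg in blast)

text \<open>Both sides are the double sum of \<open>g n' * h (n - n') * k (m - n)\<close>;
  restriction to low degrees makes it finite, and then the summations may be exchanged.\<close>

lemma mult_R_assoc:
  assumes g: "g \<in> carrier R" and h: "h \<in> carrier R" and k: "k \<in> carrier R"
  shows "(g \<otimes>\<^bsub>R\<^esub> h) \<otimes>\<^bsub>R\<^esub> k = g \<otimes>\<^bsub>R\<^esub> (h \<otimes>\<^bsub>R\<^esub> k)"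
proof
  fix m
  define S where "S = {n. g n \<noteq> 0 \<and> deg n \<le> deg m}"
  define T where "T = {n. h n \<noteq> 0 \<and> deg n \<le> deg m}"
  \<comment> \<open>Any \<open>n\<close> contributing to the outer product splits into exponents of
    \<open>g\<close> and of \<open>h\<close>, both of degree at most \<open>deg m\<close>.\<close>
  define U where "U = (\<lambda>(n, n'). n + n') ` (S \<times> T)"
  have fin: "finite S" "finite T" "finite U"
    using finite_low g h by (auto simp: S_def T_def U_def)
  have "((g \<otimes>\<^bsub>R\<^esub> h) \<otimes>\<^bsub>R\<^esub> k) m = (\<Sum>n\<in>U. (g \<otimes>\<^bsub>R\<^esub> h) n * k (m - n))"
  proof (rule mult_R_superset[OF fin(3)])
    fix n assume *: "(g \<otimes>\<^bsub>R\<^esub> h) n \<noteq> 0" "k (m - n) \<noteq> 0"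
    then obtain n' where n': "g n' \<noteq> 0" "h (n - n') \<noteq> 0" by (elim mult_R_nonzeroE)
    then have "0 \<le> deg n'" "0 \<le> deg (n - n')" "0 \<le> deg (m - n)"
      using g h k deg_nonneg * by blast+
    then have "n' \<in> S" "n - n' \<in> T" using n' by (auto simp: S_def T_def)
    then show "n \<in> U" unfolding U_def by force
  qed
  also have "\<dots> = (\<Sum>n\<in>U. \<Sum>n'\<in>S. g n' * h (n - n') * k (m - n))"
  proof (rule sum.cong)
    fix n assume "n \<in> U"
    show "(g \<otimes>\<^bsub>R\<^esub> h) n * k (m - n) = (\<Sum>n'\<in>S. g n' * h (n - n') * k (m - n))"
    proof (cases "k (m - n) = 0")
      case False
      then have "0 \<le> deg (m - n)" using k deg_nonneg by blast
      then have "(g \<otimes>\<^bsub>R\<^esub> h) n = (\<Sum>n'\<in>S. g n' * h (n - n'))"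
        unfolding S_def by (intro mult_R_low g h) simp
      then show ?thesis by (simp add: sum_distrib_right)
    qed auto
  qed simp
  also have "\<dots> = (\<Sum>n'\<in>S. \<Sum>n\<in>U. g n' * (h (n - n') * k (m - n)))"
    by (subst sum.swap) (simp add: mult_ac)
  also have "\<dots> = (\<Sum>n'\<in>S. g n' * (h \<otimes>\<^bsub>R\<^esub> k) (m - n'))"
  proof (rule sum.cong)
    fix n' assume n': "n' \<in> S"
    then have "0 \<le> deg n'" using g deg_nonneg by (auto simp: S_def)
    have "(h \<otimes>\<^bsub>R\<^esub> k) (m - n') = (\<Sum>n\<in>(\<lambda>n. n - n') ` U. h n * k (m - n' - n))"
    proof (rule mult_R_superset)
      fix n assume *: "h n \<noteq> 0" "k (m - n' - n) \<noteq> 0"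
      then have "0 \<le> deg (m - n' - n)" using k deg_nonneg by blast
      then have "n \<in> T" using * \<open>0 \<le> deg n'\<close> by (simp add: T_def)
      then have "n' + n \<in> U" using n' unfolding U_def by force
      then show "n \<in> (\<lambda>n. n - n') ` U" by force
    qed (use fin in simp)
    also have "\<dots> = (\<Sum>n\<in>U. h (n - n') * k (m - n))"
      by (subst sum.reindex) (auto simp: inj_on_def algebra_simps)
    finally show "(\<Sum>n\<in>U. g n' * (h (n - n') * k (m - n))) = g n' * (h \<otimes>\<^bsub>R\<^esub> k) (m - n')"
      by (simp add: sum_distrib_left)
  qed simp
  also have "\<dots> = (g \<otimes>\<^bsub>R\<^esub> (h \<otimes>\<^bsub>R\<^esub> k)) m"
    unfolding S_def by (rule mult_R_low[symmetric]) (use g h k mult_R_closed in auto)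
  finally show "((g \<otimes>\<^bsub>R\<^esub> h) \<otimes>\<^bsub>R\<^esub> k) m = (g \<otimes>\<^bsub>R\<^esub> (h \<otimes>\<^bsub>R\<^esub> k)) m" .
qed

lemma mult_R_comm: "g \<otimes>\<^bsub>R\<^esub> h = h \<otimes>\<^bsub>R\<^esub> g"
proof
  fix m
  show "(g \<otimes>\<^bsub>R\<^esub> h) m = (h \<otimes>\<^bsub>R\<^esub> g) m"
    unfolding mult_R
    by (rule sum.reindex_bij_witness[of _ "\<lambda>n. m - n" "\<lambda>n. m - n"]) (auto simp: mult_ac)
qed

lemma monomial_carrier: "0 \<le> deg n \<Longrightarrow> monomial n \<in> carrier R"
  by (auto simp: carrier_R monomial_def intro: finite_subset[of _ "{n}"] split: if_splits)

lemma cring_R: "cring R"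
proof (rule cringI)
  have z: "\<zero>\<^bsub>R\<^esub> \<in> carrier R" unfolding zero_R carrier_R by simp
  show "abelian_group R"
  proof (rule abelian_groupI)
    fix g h assume gh: "g \<in> carrier R" "h \<in> carrier R"
    then show "g \<oplus>\<^bsub>R\<^esub> h \<in> carrier R"
      by (rule carrier_R_if_low_subset) (auto simp: add_R)
  next
    fix g assume g: "g \<in> carrier R"
    then have "(\<lambda>m. - g m) \<in> carrier R"
      by (rule carrier_R_if_low_subset[OF _ g]) auto
    moreover have "(\<lambda>m. - g m) \<oplus>\<^bsub>R\<^esub> g = \<zero>\<^bsub>R\<^esub>"
      by (auto simp: add_R zero_R)
    ultimately show "\<exists>y\<in>carrier R. y \<oplus>\<^bsub>R\<^esub> g = \<zero>\<^bsub>R\<^esub>" by blast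
  qed (simp_all add: z, auto simp: add_R zero_R fun_eq_iff)
  have one: "\<one>\<^bsub>R\<^esub> = monomial 0" by (auto simp: one_R monomial_def)
  show "comm_monoid R"
  proof (rule comm_monoidI)
    show "\<one>\<^bsub>R\<^esub> \<in> carrier R" unfolding one by (rule monomial_carrier) simp
    fix g assume "g \<in> carrier R"
    show "\<one>\<^bsub>R\<^esub> \<otimes>\<^bsub>R\<^esub> g = g" unfolding one by (rule ext) (simp add: monomial_mult)
  qed (auto intro: mult_R_closed mult_R_assoc mult_R_comm)
  fix g h k assume *: "g \<in> carrier R" "h \<in> carrier R" "k \<in> carrier R"
  show "(g \<oplus>\<^bsub>R\<^esub> h) \<otimes>\<^bsub>R\<^esub> k = g \<otimes>\<^bsub>R\<^esub> k \<oplus>\<^bsub>R\<^esub> h \<otimes>\<^bsub>R\<^esub> k"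
  proof
    fix m
    define S where "S = {n. g n \<noteq> 0 \<and> deg n \<le> deg m} \<union> {n. h n \<noteq> 0 \<and> deg n \<le> deg m}"
    have fin: "finite S" using * finite_low by (auto simp: S_def)
    have in_S: "n \<in> S" if "g n \<noteq> 0 \<or> h n \<noteq> 0" "k (m - n) \<noteq> 0" for n
      using deg_nonneg[OF *(3) that(2)] that(1) by (auto simp: S_def)
    have "((g \<oplus>\<^bsub>R\<^esub> h) \<otimes>\<^bsub>R\<^esub> k) m = (\<Sum>n\<in>S. (g n + h n) * k (m - n))"
      by (subst mult_R_superset[OF fin]) (auto simp: add_R intro!: in_S)
    moreover have "(g \<otimes>\<^bsub>R\<^esub> k) m = (\<Sum>n\<in>S. g n * k (m - n))"
      by (rule mult_R_superset[OF fin]) (auto intro!: in_S)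
    moreover have "(h \<otimes>\<^bsub>R\<^esub> k) m = (\<Sum>n\<in>S. h n * k (m - n))"
      by (rule mult_R_superset[OF fin]) (auto intro!: in_S)
    ultimately show "((g \<oplus>\<^bsub>R\<^esub> h) \<otimes>\<^bsub>R\<^esub> k) m = (g \<otimes>\<^bsub>R\<^esub> k \<oplus>\<^bsub>R\<^esub> h \<otimes>\<^bsub>R\<^esub> k) m"
      by (simp add: add_R ring_distribs sum.distrib)
  qed
qed

end

section \<open>Orders of vanishing on the orbit\<close>

text \<open>Orders at \<open>c\<close> add up in products, and a factor not vanishing at
  \<open>c\<close> has order zero. This is localization at a point of the orbit, seen on
  polynomials.\<close>

lemma monom_dvd_cancel:
  fixes c :: complex
  assumes "poly H c \<noteq> 0" "[:- c, 1:] ^ i dvd H * G"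
  shows "[:- c, 1:] ^ i dvd G"
proof (cases "G = 0")
  case False
  have "H \<noteq> 0" using assms by auto
  then have "i \<le> Polynomial.order c (H * G)" using assms False by (simp add: order_divides)
  also have "\<dots> = Polynomial.order c G"
    using \<open>H \<noteq> 0\<close> False assms by (simp add: order_mult order_0I)
  finally show ?thesis using False by (simp add: order_divides)
qed simp

text \<open>Zero at negative indices, so that shifts of Laurent exponents can be written without
  case distinctions.\<close>

definition coeff_int :: "complex poly \<Rightarrow> int \<Rightarrow> complex" where
  "coeff_int G j = (if j < 0 then 0 else poly.coeff G (nat j))"

lemma coeff_int_of_nat [simp]: "coeff_int G (int n) = poly.coeff G n"
  by (simp add: coeff_int_def)

lemma coeff_int_eqI: "(\<And>j. coeff_int G j = coeff_int H j) \<Longrightarrow> G = H"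
  by (metis coeff_int_of_nat poly_eqI)

context ray
begin

text \<open>With \<open>z = \<chi>\<^sup>(\<^sup>q\<^sup>,\<^sup>-\<^sup>p\<^sup>)\<close>, the restriction of \<open>g\<close> to the orbit is the Laurent polynomial \<open>z\<^sup>-\<^sup>N G(z)\<close>.\<close>

definition rep :: "nat \<Rightarrow> (lattice \<Rightarrow> complex) \<Rightarrow> complex poly \<Rightarrow> bool" where
  "rep N g G \<longleftrightarrow> (\<forall>k. g (lat 0 k) = coeff_int G (k + int N))"

lemma rep_unique: "rep N g G \<Longrightarrow> rep N g H \<Longrightarrow> G = H"
  by (rule coeff_int_eqI) (metis rep_def diff_add_cancel)

lemma finite_idx:
  assumes "g \<in> carrier R" shows "finite {k. g (lat 0 k) \<noteq> 0}"
proof -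
  have "{k. g (lat 0 k) \<noteq> 0} \<subseteq> idx ` {m. g m \<noteq> 0 \<and> deg m \<le> 0}"
  proof
    fix k assume "k \<in> {k. g (lat 0 k) \<noteq> 0}"
    then have "lat 0 k \<in> {m. g m \<noteq> 0 \<and> deg m \<le> 0}" by simp
    then show "k \<in> idx ` {m. g m \<noteq> 0 \<and> deg m \<le> 0}"
      by (rule image_eqI[rotated]) simp
  qed
  then show ?thesis by (rule finite_subset) (use finite_low assms in auto)
qed

text \<open>Only finitely many terms of degree zero occur, so a power of \<open>z\<close> clears the
  negative exponents.\<close>

lemma rep_exists:
  assumes "g \<in> carrier R" obtains N G where "rep N g G"
proof -
  obtain B :: nat where B: "\<forall>k\<in>{k. g (lat 0 k) \<noteq> 0}. \<bar>k\<bar> \<le> int B"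
  proof -
    have "finite (abs ` {k. g (lat 0 k) \<noteq> 0})" using finite_idx[OF assms] by simp
    then have "\<exists>b. \<forall>k\<in>{k. g (lat 0 k) \<noteq> 0}. \<bar>k\<bar> \<le> b"
      by (metis finite_imageI finite_has_maximal2 bdd_above_finite bdd_above.unfold image_eqI)
    then obtain b where "\<forall>k\<in>{k. g (lat 0 k) \<noteq> 0}. \<bar>k\<bar> \<le> b" ..
    then show ?thesis by (intro that[of "nat b"]) fastforce
  qed
  \<comment> \<open>Exponents between \<open>-B\<close> and \<open>B\<close> become degrees between
    \<open>0\<close> and \<open>2 * B\<close> after the shift.\<close>
  have "poly.coeff (Abs_poly (\<lambda>j. g (lat 0 (int j - int B)))) = (\<lambda>j. g (lat 0 (int j - int B)))"
    by (rule coeff_Abs_poly[of "2 * B"]) (use B in force)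
  then have "rep B g (Abs_poly (\<lambda>j. g (lat 0 (int j - int B))))"
    using B by (force simp: rep_def coeff_int_def)
  then show ?thesis by (rule that)
qed

text \<open>Enlarging the denominator from \<open>z^N\<close> to \<open>z^(N + d)\<close> brings
  representations to a common denominator.\<close>

lemma rep_shift: "rep N g G \<Longrightarrow> rep (N + d) g (Polynomial.monom 1 d * G)"
  by (auto simp: rep_def coeff_int_def coeff_monom_mult nat_less_iff nat_diff_distrib
      intro!: arg_cong[of _ _ "poly.coeff G"])

text \<open>Degrees are nonnegative on the carrier, so the degree-zero part of a product comes from
  the degree-zero parts of the factors: restriction to the orbit is multiplicative.\<close>

lemma rep_mult:
  assumes g: "g \<in> carrier R" "rep N g G" and h: "h \<in> carrier R" "rep M h H"
  shows "rep (N + M) (g \<otimes>\<^bsub>R\<^esub> h) (G * H)"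
  unfolding rep_def
proof
  fix k
  define K where "K = k + int (N + M)"
  define A where "A = (\<lambda>j. lat 0 (int j - int N)) ` {j. int j \<le> K}"
  have fin: "finite {j. int j \<le> K}"
    by (rule finite_subset[of _ "{..nat K}"]) auto
  have inj: "inj_on (\<lambda>j. lat 0 (int j - int N)) {j. int j \<le> K}"
    by (rule inj_onI) (metis add_diff_cancel_right' diff_add_cancel idx_lat of_nat_eq_iff)
  have "(g \<otimes>\<^bsub>R\<^esub> h) (lat 0 k) = (\<Sum>n\<in>A. g n * h (lat 0 k - n))"
  proof (rule mult_R_superset)
    fix n assume *: "g n \<noteq> 0" "h (lat 0 k - n) \<noteq> 0"
    then have "0 \<le> deg n" "0 \<le> deg (lat 0 k - n)" using g h deg_nonneg by blast+
    then have n: "n = lat 0 (idx n)" using lat_deg_idx[of n] by simp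
    then have m: "lat 0 k - n = lat 0 (k - idx n)" by (metis diff_self lat_diff)
    have "coeff_int G (idx n + N) \<noteq> 0" "coeff_int H (k - idx n + M) \<noteq> 0"
      using * g h n m by (metis rep_def)+
    then have "0 \<le> idx n + N" "0 \<le> k - idx n + M" by (auto simp: coeff_int_def split: if_splits)
    then have "nat (idx n + N) \<in> {j. int j \<le> K}" by (auto simp: K_def)
    moreover have "n = lat 0 (int (nat (idx n + N)) - int N)"
      using n \<open>0 \<le> idx n + N\<close> by simp
    ultimately show "n \<in> A" unfolding A_def by blast
  qed (simp add: A_def fin)
  also have "\<dots> = (\<Sum>j | int j \<le> K. poly.coeff G j * coeff_int H (K - int j))"
    unfolding A_def sum.reindex[OF inj]
  proof (rule sum.cong)
    fix j
    have "lat 0 k - lat 0 (int j - int N) = lat 0 (k - (int j - int N))"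
      using lat_diff[of 0 0 k "int j - int N"] by simp
    then show "((\<lambda>n. g n * h (lat 0 k - n)) \<circ> (\<lambda>j. lat 0 (int j - int N))) j
        = poly.coeff G j * coeff_int H (K - int j)"
      using g h by (simp add: rep_def K_def algebra_simps)
  qed simp
  also have "\<dots> = coeff_int (G * H) K"
  proof (cases "K < 0")
    case True
    then show ?thesis by (auto simp: coeff_int_def intro!: sum.neutral)
  next
    case False
    then have "{j. int j \<le> K} = {..nat K}" by auto
    moreover have "coeff_int H (K - int j) = poly.coeff H (nat K - j)" if "j \<le> nat K" for j
      using that False by (auto simp: coeff_int_def nat_diff_distrib')
    ultimately show ?thesis using False by (simp add: coeff_int_def coeff_mult)
  qed
  finally show "(g \<otimes>\<^bsub>R\<^esub> h) (lat 0 k) = coeff_int (G * H) (k + int (N + M))" by (simp add: K_def)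
qed

lemma rep_add: "rep N g G \<Longrightarrow> rep N h H \<Longrightarrow> rep N (g \<oplus>\<^bsub>R\<^esub> h) (G + H)"
  by (simp add: rep_def add_R coeff_int_def)

section \<open>Laurent polynomials, constants and closed points of the orbit\<close>

text \<open>A lift of \<open>z^(-N) G(z)\<close> from the orbit to a formal function without terms
  of positive degree. It supplies basis vectors of quotients and multipliers with prescribed
  restriction.\<close>

definition polyfun :: "nat \<Rightarrow> complex poly \<Rightarrow> lattice \<Rightarrow> complex" where
  "polyfun N G m = (if deg m = 0 then coeff_int G (idx m + int N) else 0)"

lemma rep_polyfun: "rep N (polyfun N G) G"
  by (simp add: rep_def polyfun_def)

lemma polyfun_carrier: "polyfun N G \<in> carrier R"
  unfolding carrier_R
proof (intro conjI allI impI)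
  fix c
  have "{m. polyfun N G m \<noteq> 0} \<subseteq> (\<lambda>j. lat 0 (int j - int N)) ` {..Polynomial.degree G}"
  proof
    fix m assume m: "m \<in> {m. polyfun N G m \<noteq> 0}"
    define j where "j = nat (idx m + int N)"
    have "deg m = 0" "idx m + int N = int j" "poly.coeff G j \<noteq> 0"
      using m by (auto simp: polyfun_def coeff_int_def j_def split: if_splits)
    then have "m = lat 0 (int j - int N)" "j \<le> Polynomial.degree G"
      by (auto intro: lattice_eqI le_degree)
    then show "m \<in> (\<lambda>j. lat 0 (int j - int N)) ` {..Polynomial.degree G}" by blast
  qed
  then have "finite {m. polyfun N G m \<noteq> 0}" by (rule finite_subset) simp
  then show "finite {m. polyfun N G m \<noteq> 0 \<and> deg m \<le> c}"
    by (rule rev_finite_subset) auto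
qed (simp add: polyfun_def split: if_splits)

definition scalar :: "complex \<Rightarrow> lattice \<Rightarrow> complex" where
  "scalar c = (\<lambda>m. if m = 0 then c else 0)"

lemma scalar_carrier [simp]: "scalar c \<in> carrier R"
proof -
  have "monomial 0 \<in> carrier R" by (rule monomial_carrier) simp
  then show ?thesis
    by (rule carrier_R_if_low_subset[OF _ \<open>monomial 0 \<in> carrier R\<close>])
      (simp add: scalar_def monomial_def split: if_splits)
qed

lemma mult_scalar: "(scalar c \<otimes>\<^bsub>R\<^esub> g) m = c * g m"
proof -
  have "(scalar c \<otimes>\<^bsub>R\<^esub> g) m = (\<Sum>n\<in>{0}. scalar c n * g (m - n))"
    by (rule mult_R_superset) (auto simp: scalar_def split: if_splits)
  then show ?thesis by (simp add: scalar_def)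
qed

lemma a_inv_R:
  assumes "g \<in> carrier R" shows "(\<ominus>\<^bsub>R\<^esub> g) = scalar (-1) \<otimes>\<^bsub>R\<^esub> g"
proof -
  interpret cring R by (rule cring_R)
  have "scalar (-1) \<otimes>\<^bsub>R\<^esub> g \<oplus>\<^bsub>R\<^esub> g = \<zero>\<^bsub>R\<^esub>"
    by (simp add: fun_eq_iff add_R zero_R mult_scalar)
  then show ?thesis using assms by (metis minus_equality m_closed scalar_carrier)
qed

text \<open>For nonzero \<open>c\<close>, the point of the orbit at which the coordinate
  \<open>z\<close> takes the value \<open>c\<close>.\<close>

definition point_of :: "complex \<Rightarrow> lattice \<Rightarrow> complex" where
  "point_of c = (\<lambda>m. if deg m = 0 then c powi idx m else 0)"

text \<open>The exponents on which a point is nonzero form the group generated by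
  \<open>(q, -p)\<close>, so the point is a character determined by its nonzero value on this
  generator.\<close>

lemma torus_orbit_C: "torus_orbit C = point_of ` (- {0})"
proof (intro equalityI subsetI)
  fix t assume t: "t \<in> torus_orbit C"
  have one: "t 0 = 1" using t by (simp add: torus_orbit_def chart_def)
  have mult: "t (m + n) = t m * t n" if "0 \<le> deg m" "0 \<le> deg n" for m n
    using t that by (auto simp: torus_orbit_def chart_def dual_cone_C)
  have nz: "t m \<noteq> 0 \<longleftrightarrow> deg m = 0" for m
    using t unfolding torus_orbit_def perp_C by blast
  define c where "c = t (lat 0 1)"
  have "c \<noteq> 0" by (simp add: c_def nz)
  have pow: "t (lat 0 (int n)) = c ^ n" for n
  proof (induction n)
    case 0
    then show ?case using one by (simp add: lat_def zero_prod_def)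
  next
    case (Suc n)
    have "lat 0 (int (Suc n)) = lat 0 1 + lat 0 (int n)"
      using lat_add[of 0 0 1 "int n"] by simp
    then show ?case using mult Suc by (simp add: c_def)
  qed
  have "t (lat 0 k) = c powi k" for k
  proof (cases "0 \<le> k")
    case True
    then show ?thesis using pow[of "nat k"] by (simp add: power_int_def)
  next
    case False
    have "t (lat 0 k + lat 0 (int (nat (- k)))) = t (lat 0 k) * c ^ nat (- k)"
      by (simp only: mult[of "lat 0 k" "lat 0 (int (nat (- k)))"] pow deg_lat order_refl)
    moreover have "lat 0 k + lat 0 (int (nat (- k))) = 0"
      using False lat_add[of 0 0 k "- k"] by (simp add: lat_def zero_prod_def)
    ultimately have "t (lat 0 k) * c ^ nat (- k) = 1" using one by simp
    then show ?thesis using False \<open>c \<noteq> 0\<close> by (simp add: power_int_def field_simps)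
  qed
  then have "t = point_of c"
    using nz by (metis (no_types, lifting) ext lat_deg_idx point_of_def)
  then show "t \<in> point_of ` (- {0})" using \<open>c \<noteq> 0\<close> by blast
next
  fix t assume "t \<in> point_of ` (- {0})"
  then obtain c where "t = point_of c" "c \<noteq> 0" by auto
  then show "t \<in> torus_orbit C"
    by (auto simp: torus_orbit_def chart_def dual_cone_C perp_C point_of_def power_int_add)
qed

text \<open>With the denominator of \<open>z^(-N) G(z)\<close> cleared, vanishing at the point
  becomes the condition that \<open>c\<close> is a root of \<open>G\<close>.\<close>

lemma value_at_rep:
  assumes "g \<in> carrier R" "rep N g G" "c \<noteq> 0"
  shows "c ^ N * value_at (point_of c) g = poly G c"
proof -
  let ?e = "\<lambda>j. lat 0 (int j - int N)"
  have inj: "inj_on ?e A" for A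
    by (rule inj_onI) (metis add_diff_cancel_right' diff_add_cancel idx_lat of_nat_eq_iff)
  have "value_at (point_of c) g = (\<Sum>m\<in>?e ` {..Polynomial.degree G}. g m * point_of c m)"
    unfolding value_at_def
  proof (rule sum.mono_neutral_left)
    show "{m. g m \<noteq> 0 \<and> point_of c m \<noteq> 0} \<subseteq> ?e ` {..Polynomial.degree G}"
    proof
      fix m assume m: "m \<in> {m. g m \<noteq> 0 \<and> point_of c m \<noteq> 0}"
      define j where "j = nat (idx m + int N)"
      have "deg m = 0" using m by (auto simp: point_of_def split: if_splits)
      then have "m = lat 0 (idx m)" by (metis lat_deg_idx)
      with m have "coeff_int G (idx m + N) \<noteq> 0"
        using assms(2) unfolding rep_def by (metis (mono_tags, lifting) mem_Collect_eq)
      then have "idx m + int N = int j" "poly.coeff G j \<noteq> 0"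
        by (auto simp: coeff_int_def j_def split: if_splits)
      then have "m = ?e j" "j \<le> Polynomial.degree G"
        using \<open>deg m = 0\<close> by (auto intro: lattice_eqI le_degree)
      then show "m \<in> ?e ` {..Polynomial.degree G}" by blast
    qed
  qed auto
  also have "\<dots> = (\<Sum>j\<le>Polynomial.degree G. poly.coeff G j * c powi (int j - int N))"
    using assms(2) by (subst sum.reindex[OF inj]) (simp add: rep_def point_of_def)
  finally show ?thesis
    using assms(3) by (simp add: poly_altdef sum_distrib_left power_int_diff)
qed

section \<open>The filtration by the order of vanishing at a point of the orbit\<close>

text \<open>Only the restriction to the orbit is constrained: for nonzero \<open>c\<close> this is
  the ideal generated by \<open>(z - c)^i\<close> and all functions vanishing on the orbit.\<close>

definition vanishing :: "complex \<Rightarrow> nat \<Rightarrow> (lattice \<Rightarrow> complex) set" where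
  "vanishing c i = {g \<in> carrier R. \<exists>N G. rep N g ([:- c, 1:] ^ i * G)}"

lemma vanishing_carrier: "vanishing c i \<subseteq> carrier R"
  by (auto simp: vanishing_def)

text \<open>Two representations of a restriction differ by powers of \<open>z\<close>, which is
  nonzero at \<open>c\<close>; so the order of vanishing may be read off any of them.\<close>

lemma vanishing_iff:
  assumes "c \<noteq> 0" "rep N g G"
  shows "g \<in> vanishing c i \<longleftrightarrow> g \<in> carrier R \<and> [:- c, 1:] ^ i dvd G"
proof
  assume g: "g \<in> vanishing c i"
  then obtain M H where "rep M g ([:- c, 1:] ^ i * H)" by (auto simp: vanishing_def)
  then have "rep (M + N) g (Polynomial.monom 1 N * ([:- c, 1:] ^ i * H))" by (rule rep_shift)
  moreover have "rep (M + N) g (Polynomial.monom 1 M * G)" using rep_shift[OF assms(2), of M] by (simp add: add.commute)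
  ultimately have "Polynomial.monom 1 M * G = Polynomial.monom 1 N * ([:- c, 1:] ^ i * H)" by (rule rep_unique[rotated])
  then have "[:- c, 1:] ^ i dvd Polynomial.monom 1 M * G" by simp
  then have "[:- c, 1:] ^ i dvd G" by (rule monom_dvd_cancel[rotated]) (simp add: poly_monom assms)
  with g show "g \<in> carrier R \<and> [:- c, 1:] ^ i dvd G" by (simp add: vanishing_def)
next
  assume "g \<in> carrier R \<and> [:- c, 1:] ^ i dvd G"
  then show "g \<in> vanishing c i" using assms by (force simp: vanishing_def elim: dvdE)
qed

lemma vanishing_0: "vanishing c 0 = carrier R"
  by (force simp: vanishing_def elim: rep_exists)

lemma vanishing_antimono:
  assumes "i \<le> j" shows "vanishing c j \<subseteq> vanishing c i"
proof
  fix g assume "g \<in> vanishing c j"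
  then obtain N G where "g \<in> carrier R" "rep N g ([:- c, 1:] ^ j * G)" by (auto simp: vanishing_def)
  moreover have "[:- c, 1:] ^ j * G = [:- c, 1:] ^ i * ([:- c, 1:] ^ (j - i) * G)"
    using assms by (simp add: mult.assoc[symmetric] power_add[symmetric])
  ultimately show "g \<in> vanishing c i" by (auto simp: vanishing_def simp del: mult_pCons_left)
qed

lemma ideal_vanishing: "ideal (vanishing c i) R"
proof -
  interpret cring R by (rule cring_R)
  have mult: "g \<otimes>\<^bsub>R\<^esub> h \<in> vanishing c i" if g: "g \<in> carrier R" and h: "h \<in> vanishing c i" for g h
  proof -
    from h obtain M H where H: "h \<in> carrier R" "rep M h ([:- c, 1:] ^ i * H)" by (auto simp: vanishing_def)
    obtain N G where "rep N g G" using g by (rule rep_exists)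
    then have "rep (N + M) (g \<otimes>\<^bsub>R\<^esub> h) (G * ([:- c, 1:] ^ i * H))" using rep_mult g H by blast
    then have "rep (N + M) (g \<otimes>\<^bsub>R\<^esub> h) ([:- c, 1:] ^ i * (G * H))" by (simp only: mult_ac)
    then show ?thesis using g H by (auto simp: vanishing_def)
  qed
  have add: "g \<oplus>\<^bsub>R\<^esub> h \<in> vanishing c i" if g: "g \<in> vanishing c i" and h: "h \<in> vanishing c i" for g h
  proof -
    from g obtain N G where G: "g \<in> carrier R" "rep N g ([:- c, 1:] ^ i * G)" by (auto simp: vanishing_def)
    from h obtain M H where H: "h \<in> carrier R" "rep M h ([:- c, 1:] ^ i * H)" by (auto simp: vanishing_def)
    \<comment> \<open>A sum needs the common denominator \<open>z^(N + M)\<close>; the factor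
      \<open>[:- c, 1:] ^ i\<close> survives the change.\<close>
    have "rep (N + M) g (Polynomial.monom 1 M * ([:- c, 1:] ^ i * G))" using G rep_shift by blast
    moreover have "rep (N + M) h (Polynomial.monom 1 N * ([:- c, 1:] ^ i * H))"
      using H rep_shift[of M h _ N] by (simp add: add.commute)
    ultimately have "rep (N + M) (g \<oplus>\<^bsub>R\<^esub> h)
        (Polynomial.monom 1 M * ([:- c, 1:] ^ i * G) + Polynomial.monom 1 N * ([:- c, 1:] ^ i * H))"
      by (rule rep_add)
    then have "rep (N + M) (g \<oplus>\<^bsub>R\<^esub> h) ([:- c, 1:] ^ i * (Polynomial.monom 1 M * G + Polynomial.monom 1 N * H))"
      by (simp only: ring_distribs mult_ac)
    then show ?thesis using G H by (auto simp: vanishing_def)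
  qed
  have zero: "\<zero>\<^bsub>R\<^esub> \<in> vanishing c i"
  proof -
    have "rep 0 \<zero>\<^bsub>R\<^esub> ([:- c, 1:] ^ i * 0)" by (simp add: rep_def zero_R coeff_int_def)
    then show ?thesis unfolding vanishing_def by blast
  qed
  show ?thesis
  proof (rule idealI)
    show "ring R" by (rule ring_axioms)
    show "subgroup (vanishing c i) (add_monoid R)"
    proof (rule add.subgroupI)
      show "vanishing c i \<subseteq> carrier R" by (auto simp: vanishing_def)
      show "vanishing c i \<noteq> {}" using zero by blast
      fix g assume g: "g \<in> vanishing c i"
      then have "g \<in> carrier R" by (auto simp: vanishing_def)
      then show "\<ominus>\<^bsub>R\<^esub> g \<in> vanishing c i" using a_inv_R mult[OF scalar_carrier g] by simp
    qed (use add in auto)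
    fix g h assume gh: "g \<in> vanishing c i" "h \<in> carrier R"
    then have "g \<in> carrier R" by (auto simp: vanishing_def)
    then show "h \<otimes>\<^bsub>R\<^esub> g \<in> vanishing c i" "g \<otimes>\<^bsub>R\<^esub> h \<in> vanishing c i"
      using mult[OF gh(2,1)] m_comm gh by simp_all
  qed
qed

lemma subfield_scalar: "subfield (range scalar) R"
proof -
  interpret cring R by (rule cring_R)
  have mult: "scalar c \<otimes>\<^bsub>R\<^esub> scalar d = scalar (c * d)" for c d
    by (rule ext) (simp add: mult_scalar, simp add: scalar_def)
  have add: "scalar c \<oplus>\<^bsub>R\<^esub> scalar d = scalar (c + d)" for c d
    by (rule ext) (simp add: add_R scalar_def)
  have one: "\<one>\<^bsub>R\<^esub> = scalar 1" and zero: "\<zero>\<^bsub>R\<^esub> = scalar 0"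
    by (simp_all add: one_R zero_R scalar_def fun_eq_iff)
  have inj: "scalar c = scalar d \<longleftrightarrow> c = d" for c d
  proof
    assume "scalar c = scalar d"
    then have "scalar c 0 = scalar d 0" by (rule fun_cong)
    then show "c = d" by (simp add: scalar_def)
  qed simp
  have sub: "subcring (range scalar) R"
  proof (intro subcringI' subringI)
    fix h assume "h \<in> range scalar"
    then show "\<ominus>\<^bsub>R\<^esub> h \<in> range scalar" using a_inv_R mult by auto
  next
    show "range scalar \<subseteq> carrier R" by auto
    show "\<one>\<^bsub>R\<^esub> \<in> range scalar" unfolding one by (rule rangeI)
    fix h h' assume "h \<in> range scalar" "h' \<in> range scalar"
    then obtain c d where h: "h = scalar c" "h' = scalar d" by blast
    show "h \<otimes>\<^bsub>R\<^esub> h' \<in> range scalar" "h \<oplus>\<^bsub>R\<^esub> h' \<in> range scalar"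
      unfolding h mult add by (rule rangeI)+
  qed
  show ?thesis
  proof (rule subfieldI[OF sub], rule Set.set_eqI, rule iffI)
    fix u assume "u \<in> Units (R\<lparr>carrier := range scalar\<rparr>)"
    then obtain c d where "u = scalar c" "scalar c \<otimes>\<^bsub>R\<^esub> scalar d = \<one>\<^bsub>R\<^esub>"
      unfolding Units_def by force
    then have "u = scalar c" "c * d = 1" unfolding mult one inj by auto
    then show "u \<in> range scalar - {\<zero>\<^bsub>R\<^esub>}" unfolding zero by (auto simp: inj)
  next
    fix u assume "u \<in> range scalar - {\<zero>\<^bsub>R\<^esub>}"
    then obtain c where c: "u = scalar c" "c \<noteq> 0" unfolding zero by blast
    then have "scalar (1 / c) \<otimes>\<^bsub>R\<^esub> u = \<one>\<^bsub>R\<^esub>" "u \<otimes>\<^bsub>R\<^esub> scalar (1 / c) = \<one>\<^bsub>R\<^esub>"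
      unfolding c(1) mult one using c(2) by simp_all
    then show "u \<in> Units (R\<lparr>carrier := range scalar\<rparr>)" unfolding Units_def using c(1) by simp blast
  qed
qed

text \<open>One step of the expansion in powers of \<open>z - c\<close>: removing the leading term
  raises the order of vanishing.\<close>

lemma vanishing_decompose:
  assumes c: "c \<noteq> 0" and g: "g \<in> vanishing c i"
  obtains \<alpha> e where "e \<in> vanishing c (Suc i)"
    "g = scalar \<alpha> \<otimes>\<^bsub>R\<^esub> polyfun 0 ([:- c, 1:] ^ i) \<oplus>\<^bsub>R\<^esub> e"
proof -
  let ?l = "[:- c, 1:]"
  from g obtain N G where G: "g \<in> carrier R" "rep N g (?l ^ i * G)" by (auto simp: vanishing_def)
  \<comment> \<open>The restriction is \<open>(z - c)^i\<close> times \<open>z^(-N) G(z)\<close>,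
    and this is the value of the second factor at \<open>c\<close>.\<close>
  define \<alpha> where "\<alpha> = poly G c / c ^ N"
  define e where "e = (\<lambda>m. g m - \<alpha> * polyfun 0 (?l ^ i) m)"
  have eq: "g = scalar \<alpha> \<otimes>\<^bsub>R\<^esub> polyfun 0 (?l ^ i) \<oplus>\<^bsub>R\<^esub> e"
    by (rule ext) (simp add: add_R mult_scalar e_def)
  have e: "e \<in> carrier R"
    by (rule carrier_R_if_low_subset[OF G(1) polyfun_carrier[of 0 "?l ^ i"]]) (auto simp: e_def)
  \<comment> \<open>The numerator of \<open>z^(-N) G(z) - \<alpha>\<close> over \<open>z^N\<close>;
    it vanishes at \<open>c\<close> and so provides the additional factor.\<close>
  define H where "H = G - Polynomial.smult \<alpha> (Polynomial.monom 1 N)"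
  have "poly H c = 0" using c by (simp add: H_def \<alpha>_def poly_monom)
  then obtain K where K: "H = ?l * K" by (auto simp: poly_eq_0_iff_dvd elim: dvdE)
  have "rep N (polyfun 0 (?l ^ i)) (Polynomial.monom 1 N * ?l ^ i)"
    using rep_shift[OF rep_polyfun, of 0 N] by simp
  then have "rep N e (?l ^ i * G - Polynomial.smult \<alpha> (Polynomial.monom 1 N * ?l ^ i))"
    using G by (simp add: rep_def e_def coeff_int_def)
  also have "?l ^ i * G - Polynomial.smult \<alpha> (Polynomial.monom 1 N * ?l ^ i) = ?l ^ i * H"
    by (simp only: H_def right_diff_distrib mult_smult_right mult.commute[of "Polynomial.monom 1 N"])
  also have "\<dots> = ?l ^ Suc i * K" by (simp only: K power_Suc mult_ac)
  finally have "e \<in> vanishing c (Suc i)" using e unfolding vanishing_def by blast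
  then show ?thesis using eq that by blast
qed

text \<open>The ideals \<open>vanishing c i\<close>, for \<open>i\<close> from \<open>\<mu>\<close>
  down to \<open>0\<close>, form a chain up to the whole ring in which each step adds one line,
  spanned by \<open>(z - c)^i\<close>. For \<open>0 < \<mu>\<close> the quotient is nonzero, as is
  required for the image of the constants to be a subfield.\<close>

lemma quotient_dim_vanishing:
  assumes c: "c \<noteq> 0" and \<mu>: "0 < \<mu>"
  shows "quotient_dim R (vanishing c \<mu>) = enat \<mu>"
proof -
  let ?V = "vanishing c" and ?l = "[:- c, 1:]"
  interpret R: cring R by (rule cring_R)
  interpret I: ideal "?V \<mu>" R by (rule ideal_vanishing)
  define Q where "Q = R Quot ?V \<mu>"
  define \<pi> where "\<pi> g = ?V \<mu> +>\<^bsub>R\<^esub> g" for g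
  interpret Q: cring Q unfolding Q_def by (rule I.quotient_is_cring) (rule cring_R)
  have hom: "ring_hom_ring R Q \<pi>"
    using I.rcos_ring_hom_ring unfolding Q_def \<pi>_def by simp
  interpret hom: ring_hom_ring R Q \<pi> by (rule hom)
  note Vc = vanishing_carrier[of c]
  have zero: "\<zero>\<^bsub>Q\<^esub> = ?V \<mu>" by (simp add: Q_def FactRing_def)
  have \<pi>_zero: "\<pi> g = \<zero>\<^bsub>Q\<^esub>" if "g \<in> ?V \<mu>" for g
    unfolding zero \<pi>_def using that by (rule I.a_rcos_const)
  have \<pi>_eqD: "\<exists>d\<in>?V \<mu>. g = d \<oplus>\<^bsub>R\<^esub> h" if "\<pi> g = \<pi> h" "g \<in> carrier R" for g h
    using I.a_rcos_self[OF that(2)] that(1) unfolding \<pi>_def a_r_coset_def' by auto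
  have carr: "carrier Q = \<pi> ` carrier R"
    by (auto simp: Q_def \<pi>_def FactRing_def A_RCOSETS_def')
  let ?F = "\<pi> ` range scalar"
  have v: "polyfun 0 (?l ^ i) \<in> ?V i" for i
    using rep_polyfun[of 0 "?l ^ i"] polyfun_carrier[of 0 "?l ^ i"]
    unfolding vanishing_def by (metis (mono_tags, lifting) mem_Collect_eq mult.right_neutral)
  have v': "polyfun 0 (?l ^ i) \<notin> ?V (Suc i)" for i
  proof
    assume "polyfun 0 (?l ^ i) \<in> ?V (Suc i)"
    then have "?l ^ Suc i dvd ?l ^ i" using vanishing_iff[OF c rep_polyfun] by blast
    then have "Polynomial.degree (?l ^ Suc i) \<le> Polynomial.degree (?l ^ i)"
      by (rule dvd_imp_degree_le) simp
    then show False by (simp only: degree_linear_power)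
  qed
  have "\<one>\<^bsub>R\<^esub> \<notin> ?V \<mu>"
  proof
    assume "\<one>\<^bsub>R\<^esub> \<in> ?V \<mu>"
    then have "?V \<mu> = carrier R" by (rule I.one_imp_carrier)
    then have "polyfun 0 (?l ^ 0) \<in> ?V \<mu>" using polyfun_carrier by blast
    then have "polyfun 0 (?l ^ 0) \<in> ?V (Suc 0)" using vanishing_antimono[of "Suc 0" \<mu> c] \<mu> by auto
    then show False using v' by blast
  qed
  have "\<one>\<^bsub>Q\<^esub> \<noteq> \<zero>\<^bsub>Q\<^esub>"
  proof
    assume "\<one>\<^bsub>Q\<^esub> = \<zero>\<^bsub>Q\<^esub>"
    then have "\<pi> \<one>\<^bsub>R\<^esub> = \<pi> \<zero>\<^bsub>R\<^esub>" by simp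
    then obtain d where d: "d \<in> ?V \<mu>" "\<one>\<^bsub>R\<^esub> = d \<oplus>\<^bsub>R\<^esub> \<zero>\<^bsub>R\<^esub>"
      using \<pi>_eqD R.one_closed by blast
    then have "d \<in> carrier R" using Vc by blast
    with d have "\<one>\<^bsub>R\<^esub> = d" by (simp only: R.r_zero)
    with d \<open>\<one>\<^bsub>R\<^esub> \<notin> ?V \<mu>\<close> show False by simp
  qed
  then have sub: "subfield ?F Q" by (rule hom.img_is_subfield(2)[OF subfield_scalar])
  \<comment> \<open>The induction climbs from the zero space, the image of
    \<open>vanishing c \<mu>\<close>; its last stage is the image of the whole ring.\<close>
  have dim: "Q.dimension k ?F (\<pi> ` ?V (\<mu> - k))" if "k \<le> \<mu>" for k
    using that
  proof (induction k)
    case 0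
    have "\<pi> ` ?V \<mu> = {\<zero>\<^bsub>Q\<^esub>}" using \<pi>_zero v[of \<mu>] by force
    then show ?case by simp
  next
    case (Suc k)
    define i where "i = \<mu> - Suc k"
    then have Si: "\<mu> - k = Suc i" using Suc by simp
    let ?v = "polyfun 0 (?l ^ i)"
    have vc: "?v \<in> carrier R" by (rule polyfun_carrier)
    \<comment> \<open>Elements with equal images differ by an element of
      \<open>vanishing c \<mu>\<close>, which is contained in \<open>vanishing c (Suc i)\<close>; so
      \<open>(z - c)^i\<close> would vanish to order \<open>i + 1\<close>.\<close>
    have "\<pi> ?v \<notin> \<pi> ` ?V (Suc i)"
    proof
      assume "\<pi> ?v \<in> \<pi> ` ?V (Suc i)"
      then obtain e where e: "e \<in> ?V (Suc i)" "\<pi> ?v = \<pi> e" by blast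
      with vc obtain d where d: "d \<in> ?V \<mu>" "?v = d \<oplus>\<^bsub>R\<^esub> e" using \<pi>_eqD by blast
      then have "d \<in> ?V (Suc i)" using vanishing_antimono[of "Suc i" \<mu> c] Suc.prems i_def
        by (simp add: subset_iff)
      interpret J: ideal "?V (Suc i)" R by (rule ideal_vanishing)
      have "?v \<in> ?V (Suc i)" using d e \<open>d \<in> ?V (Suc i)\<close> J.a_closed by simp
      with v' show False by blast
    qed
    then have "Q.dimension (Suc k) ?F (Q.line_extension ?F (\<pi> ?v) (\<pi> ` ?V (Suc i)))"
      using Suc Si vc by (intro Q.Suc_dim) auto
    also have "Q.line_extension ?F (\<pi> ?v) (\<pi> ` ?V (Suc i)) = \<pi> ` ?V i"
    proof (intro equalityI subsetI)
      fix w assume "w \<in> Q.line_extension ?F (\<pi> ?v) (\<pi> ` ?V (Suc i))"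
      then obtain \<alpha> e where w: "w = \<pi> (scalar \<alpha>) \<otimes>\<^bsub>Q\<^esub> \<pi> ?v \<oplus>\<^bsub>Q\<^esub> \<pi> e" "e \<in> ?V (Suc i)"
        unfolding Q.line_extension_mem_iff by blast
      then have "e \<in> ?V i" using vanishing_antimono[of i "Suc i" c] by auto
      interpret J: ideal "?V i" R by (rule ideal_vanishing)
      have "scalar \<alpha> \<otimes>\<^bsub>R\<^esub> ?v \<oplus>\<^bsub>R\<^esub> e \<in> ?V i"
        using v[of i] \<open>e \<in> ?V i\<close> J.I_l_closed J.a_closed by simp
      moreover have "w = \<pi> (scalar \<alpha> \<otimes>\<^bsub>R\<^esub> ?v \<oplus>\<^bsub>R\<^esub> e)"
        using w vc \<open>e \<in> ?V i\<close> Vc by (simp add: subset_iff)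
      ultimately show "w \<in> \<pi> ` ?V i" by blast
    next
      fix w assume "w \<in> \<pi> ` ?V i"
      then obtain g where g: "g \<in> ?V i" "w = \<pi> g" by blast
      from g(1) obtain \<alpha> e where "e \<in> ?V (Suc i)" "g = scalar \<alpha> \<otimes>\<^bsub>R\<^esub> ?v \<oplus>\<^bsub>R\<^esub> e"
        by (rule vanishing_decompose[OF c])
      then have "e \<in> carrier R" using Vc by blast
      then have "\<pi> (scalar \<alpha> \<otimes>\<^bsub>R\<^esub> ?v \<oplus>\<^bsub>R\<^esub> e) = \<pi> (scalar \<alpha>) \<otimes>\<^bsub>Q\<^esub> \<pi> ?v \<oplus>\<^bsub>Q\<^esub> \<pi> e"
        using vc scalar_carrier R.m_closed by (metis hom.hom_add hom.hom_mult)
      then have "w = \<pi> (scalar \<alpha>) \<otimes>\<^bsub>Q\<^esub> \<pi> ?v \<oplus>\<^bsub>Q\<^esub> \<pi> e"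
        using g(2) \<open>g = scalar \<alpha> \<otimes>\<^bsub>R\<^esub> ?v \<oplus>\<^bsub>R\<^esub> e\<close> by (simp only:)
      then show "w \<in> Q.line_extension ?F (\<pi> ?v) (\<pi> ` ?V (Suc i))"
        unfolding Q.line_extension_mem_iff using \<open>e \<in> ?V (Suc i)\<close>
        by (intro bexI[of _ "\<pi> (scalar \<alpha>)"] bexI[of _ "\<pi> e"]) simp_all
    qed
    finally show ?case by (simp add: i_def)
  qed
  have "\<pi> ` ?V (\<mu> - \<mu>) = carrier Q" for \<mu> :: nat
    by (simp only: carr diff_self_eq_0 vanishing_0)
  with dim[OF order_refl] have dim_\<mu>: "Q.dimension \<mu> ?F (carrier Q)" by (rule subst[rotated])
  \<comment> \<open>The definite description in \<open>quotient_dim\<close> requires the dimension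
    to be unique.\<close>
  have dim_iff: "Q.dimension n ?F (carrier Q) \<longleftrightarrow> n = \<mu>" for n
    using Q.dimension_is_inj[OF sub _ dim_\<mu>] dim_\<mu> by blast
  have F: "range (\<lambda>c'. ?V \<mu> +>\<^bsub>R\<^esub> (\<lambda>m. if m = 0 then c' else 0)) = ?F"
    by (simp only: image_image \<pi>_def scalar_def)
  have "(THE n. Q.dimension n ?F (carrier Q)) = \<mu>"
    by (simp only: dim_iff the_eq_trivial)
  moreover have "\<exists>n. Q.dimension n ?F (carrier Q)" using dim_\<mu> ..
  ultimately show ?thesis
    unfolding quotient_dim_def Let_def F Q_def[symmetric] by (simp only: if_True)
qed

end

section \<open>The strict transform along the orbit of an interior ray\<close>

text \<open>The part of \<open>f\<close> of lowest degree starts at \<open>A\<close> and ends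
  \<open>l\<close> primitive steps \<open>(q, -p)\<close> further on. This is the form in which the
  Newton polygon enters the analysis along the orbit.\<close>

locale ray_edge = ray +
  fixes f :: "complex fps fps" and A :: lattice and l :: nat
  assumes min_deg: "lattice_coeff f m \<noteq> 0 \<Longrightarrow> deg A \<le> deg m"
    and edge_idx: "lattice_coeff f m \<noteq> 0 \<Longrightarrow> deg m = deg A \<Longrightarrow> idx A \<le> idx m \<and> idx m \<le> idx A + int l"
    and start_nonzero: "lattice_coeff f A \<noteq> 0"
    and end_nonzero: "lattice_coeff f (A + lat 0 (int l)) \<noteq> 0"
begin

abbreviation F where "F \<equiv> lattice_coeff f"
abbreviation J where "J \<equiv> strict_transform_ideal f C"

definition edge_poly :: "complex poly" where
  "edge_poly = Abs_poly (\<lambda>k. F (A + lat 0 (int k)))"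

definition shifted :: "lattice \<Rightarrow> complex" where
  "shifted m = F (m + A)"

lemma coeff_edge_poly: "poly.coeff edge_poly k = F (A + lat 0 (int k))"
proof -
  have "F (A + lat 0 (int i)) = 0" if "i > l" for i
    using edge_idx[of "A + lat 0 (int i)"] that by auto
  then show ?thesis
    unfolding edge_poly_def by (subst coeff_Abs_poly[of l]) auto
qed

lemma degree_edge_poly: "Polynomial.degree edge_poly = l"
proof (rule antisym)
  show "Polynomial.degree edge_poly \<le> l"
  proof (rule degree_le, intro allI impI)
    fix i assume "l < i"
    then show "poly.coeff edge_poly i = 0"
      unfolding coeff_edge_poly using edge_idx[of "A + lat 0 (int i)"] by auto
  qed
  show "l \<le> Polynomial.degree edge_poly"
    by (rule le_degree) (simp add: coeff_edge_poly end_nonzero)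
qed

lemma lat_0_0: "lat 0 0 = 0" by (simp add: lat_def zero_prod_def)

lemma edge_poly_0: "poly edge_poly 0 \<noteq> 0"
  by (simp add: poly_0_coeff_0 coeff_edge_poly lat_0_0 start_nonzero)

lemma edge_poly_nonzero: "edge_poly \<noteq> 0"
  using edge_poly_0 by auto

lemma F_carrier: "F \<in> carrier R"
  unfolding carrier_R
proof (intro conjI allI impI)
  fix m assume "F m \<noteq> 0"
  then show "0 \<le> deg m"
    using p_pos q_pos by (auto simp: lattice_coeff_def deg_def split: if_splits)
next
  fix c
  have "{m. F m \<noteq> 0 \<and> deg m \<le> c} \<subseteq> {0..c} \<times> {0..c}"
  proof
    fix m assume "m \<in> {m. F m \<noteq> 0 \<and> deg m \<le> c}"
    then have m: "0 \<le> fst m" "0 \<le> snd m" "deg m \<le> c"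
      by (auto simp: lattice_coeff_def split: if_splits)
    have "fst m \<le> p * fst m" "snd m \<le> q * snd m" "0 \<le> p * fst m" "0 \<le> q * snd m"
      using m p_pos q_pos mult_right_mono[of 1 p "fst m"] mult_right_mono[of 1 q "snd m"] by auto
    with m show "m \<in> {0..c} \<times> {0..c}" by (cases m) (auto simp: deg_def)
  qed
  then show "finite {m. F m \<noteq> 0 \<and> deg m \<le> c}" by (rule finite_subset) simp
qed

lemma deg_A: "0 \<le> deg A"
  using deg_nonneg[OF F_carrier start_nonzero] .

lemma shift_carrier:
  assumes "g \<in> carrier R" "\<And>m. g m \<noteq> 0 \<Longrightarrow> deg s \<le> deg m"
  shows "(\<lambda>m. g (m + s)) \<in> carrier R"
  unfolding carrier_R
proof (intro conjI allI impI)
  fix m assume "g (m + s) \<noteq> 0"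
  then show "0 \<le> deg m" using assms(2)[of "m + s"] by simp
next
  fix c
  have "{m. g (m + s) \<noteq> 0 \<and> deg m \<le> c} \<subseteq> (\<lambda>m. m - s) ` {m. g m \<noteq> 0 \<and> deg m \<le> c + deg s}"
  proof
    fix m assume "m \<in> {m. g (m + s) \<noteq> 0 \<and> deg m \<le> c}"
    then have "m + s \<in> {m. g m \<noteq> 0 \<and> deg m \<le> c + deg s}" by simp
    then show "m \<in> (\<lambda>m. m - s) ` {m. g m \<noteq> 0 \<and> deg m \<le> c + deg s}"
      by (rule image_eqI[rotated]) simp
  qed
  then show "finite {m. g (m + s) \<noteq> 0 \<and> deg m \<le> c}"
    by (rule finite_subset) (use finite_low[OF assms(1)] in simp)
qed

lemma shifted_carrier: "shifted \<in> carrier R"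
  using shift_carrier[OF F_carrier min_deg] unfolding shifted_def[abs_def] .

lemma rep_shifted: "rep 0 shifted edge_poly"
  unfolding rep_def
proof
  fix k
  show "shifted (lat 0 k) = coeff_int edge_poly (k + int 0)"
  proof (cases "k < 0")
    case True
    then have "F (lat 0 k + A) = 0" using edge_idx[of "lat 0 k + A"] by fastforce
    with True show ?thesis by (simp add: coeff_int_def shifted_def)
  qed (simp add: coeff_int_def coeff_edge_poly shifted_def add.commute)
qed

lemma deg_axis: "deg (int k, 0) = int k * p" "deg (0, int k) = int k * q"
  by (simp_all add: deg_def)

section \<open>The saturated ideal is principal\<close>

text \<open>A monomial of degree at least \<open>deg A\<close> absorbs the factor
  \<open>\<chi>^(-A)\<close>, so large powers of \<open>x\<close> and of \<open>y\<close> carry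
  \<open>\<chi>^(-A) f\<close> into the ideal generated by \<open>f\<close>.\<close>

lemma mult_shifted_mem_strict:
  assumes r: "r \<in> carrier R"
  shows "r \<otimes>\<^bsub>R\<^esub> shifted \<in> J"
proof -
  interpret cring R by (rule cring_R)
  have *: "monomial n \<otimes>\<^bsub>R\<^esub> (r \<otimes>\<^bsub>R\<^esub> shifted) \<in> PIdl\<^bsub>R\<^esub> F" if "deg A \<le> deg n" for n
  proof -
    have n: "monomial n \<in> carrier R" "monomial (n - A) \<in> carrier R"
      using that deg_A by (auto intro: monomial_carrier)
    have "monomial n \<otimes>\<^bsub>R\<^esub> shifted = monomial (n - A) \<otimes>\<^bsub>R\<^esub> F"
      by (rule ext) (simp add: monomial_mult shifted_def algebra_simps)
    then have "monomial n \<otimes>\<^bsub>R\<^esub> (r \<otimes>\<^bsub>R\<^esub> shifted) = (r \<otimes>\<^bsub>R\<^esub> monomial (n - A)) \<otimes>\<^bsub>R\<^esub> F"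
      using m_lcomm[OF n(1) r shifted_carrier] m_assoc[OF r n(2) F_carrier] by simp
    then show ?thesis using m_closed[OF r n(2)] unfolding cgenideal_def by blast
  qed
  \<comment> \<open>The exponent \<open>deg A\<close> is large enough, because \<open>x\<close> and
    \<open>y\<close> have degrees \<open>p\<close> and \<open>q\<close>, both at least
    \<open>1\<close>.\<close>
  have "nat (deg A) * p \<ge> deg A" "nat (deg A) * q \<ge> deg A"
    using deg_A p_pos q_pos mult_left_mono[of 1 p "deg A"] mult_left_mono[of 1 q "deg A"] by auto
  then have "monomial (int (nat (deg A)), 0) \<otimes>\<^bsub>R\<^esub> (r \<otimes>\<^bsub>R\<^esub> shifted) \<in> PIdl\<^bsub>R\<^esub> F"
    "monomial (0, int (nat (deg A))) \<otimes>\<^bsub>R\<^esub> (r \<otimes>\<^bsub>R\<^esub> shifted) \<in> PIdl\<^bsub>R\<^esub> F"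
    by (auto intro!: * simp only: deg_axis)
  then show ?thesis
    using m_closed[OF r shifted_carrier] unfolding strict_transform_ideal_def Let_def by blast
qed

text \<open>In \<open>r \<cdot> f\<close>, the product of the extreme terms of the lowest part of \<open>r\<close> and of the edge does not
  cancel.\<close>

lemma deg_quotient:
  assumes r: "r \<in> carrier R" and jdeg: "\<And>m. (r \<otimes>\<^bsub>R\<^esub> F) m \<noteq> 0 \<Longrightarrow> D \<le> deg m"
    and "r m \<noteq> 0"
  shows "D - deg A \<le> deg m"
proof (rule ccontr)
  assume "\<not> D - deg A \<le> deg m"
  \<comment> \<open>Truncation at \<open>deg m\<close> leaves finitely many exponents and keeps
    those at which \<open>r\<close> attains its lowest degree.\<close>
  define T where "T = {n. r n \<noteq> 0 \<and> deg n \<le> deg m}"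
  have T: "finite T" "m \<in> T" using finite_low[OF r] \<open>r m \<noteq> 0\<close> by (auto simp: T_def)
  define d where "d = Min (deg ` T)"
  have d: "d \<in> deg ` T" "d \<le> deg m" unfolding d_def using T by (auto intro: Min_in Min_le)
  have d_min: "d \<le> deg n" if "r n \<noteq> 0" for n
  proof (cases "deg n \<le> deg m")
    case True
    then have "n \<in> T" using that by (simp add: T_def)
    then show ?thesis unfolding d_def using T by (intro Min_le) auto
  qed (use d in auto)
  define U where "U = {n \<in> T. deg n = d}"
  have U: "finite U" "U \<noteq> {}" using T d by (auto simp: U_def)
  define e where "e = Max (idx ` U)"
  have "e \<in> idx ` U" unfolding e_def using U by (intro Max_in) auto
  then obtain m0 where m0: "m0 \<in> U" "idx m0 = e" by blast
  let ?B = "A + lat 0 (int l)"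
  have "(r \<otimes>\<^bsub>R\<^esub> F) (m0 + ?B) = (\<Sum>n\<in>{m0}. r n * F (m0 + ?B - n))"
  proof (rule mult_R_superset)
    fix n assume n: "r n \<noteq> 0" "F (m0 + ?B - n) \<noteq> 0"
    have "deg A \<le> deg (m0 + ?B - n)" using min_deg n by blast
    moreover have "deg m0 = d" using m0 by (simp add: U_def)
    moreover have "d \<le> deg n" using d_min n by blast
    ultimately have "deg n = d" by simp
    then have "n \<in> U" using n d by (simp add: U_def T_def)
    then have "idx n \<le> e" unfolding e_def using U by (intro Max_ge) auto
    moreover have "idx (m0 + ?B - n) \<le> idx A + int l"
      using edge_idx[OF n(2)] \<open>deg n = d\<close> \<open>deg m0 = d\<close> by simp
    ultimately have "idx n = idx m0" using m0 by simp
    then show "n \<in> {m0}" using \<open>deg n = d\<close> \<open>deg m0 = d\<close> by (simp add: lattice_eqI)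
  qed simp
  also have "\<dots> \<noteq> 0" using end_nonzero m0 by (simp add: U_def T_def)
  finally have "D \<le> deg (m0 + ?B)" by (rule jdeg)
  then show False using m0 d \<open>\<not> D - deg A \<le> deg m\<close> by (simp add: U_def)
qed

text \<open>If \<open>\<chi>^n j = r f\<close> with \<open>\<chi>^n\<close> a power of
  \<open>x\<close>, then \<open>r\<close> has no terms of degree below \<open>deg n - deg A\<close>,
  so \<open>\<chi>^(A - n) r\<close> is again a formal function; it is the required factor.\<close>

lemma strict_mem_mult_shifted:
  assumes "j \<in> J"
  obtains r where "r \<in> carrier R" "j = r \<otimes>\<^bsub>R\<^esub> shifted"
proof -
  from assms obtain k r where j: "j \<in> carrier R" and r: "r \<in> carrier R"
    and eq: "monomial (int k, 0) \<otimes>\<^bsub>R\<^esub> j = r \<otimes>\<^bsub>R\<^esub> F"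
    unfolding strict_transform_ideal_def Let_def cgenideal_def by blast
  let ?n = "(int k, 0) :: lattice"
  have j_eq: "j m = (r \<otimes>\<^bsub>R\<^esub> F) (m + ?n)" for m
    unfolding eq[symmetric] by (simp add: monomial_mult)
  define s where "s = ?n - A"
  have "deg s \<le> deg m" if "r m \<noteq> 0" for m
    unfolding s_def deg_diff
  proof (rule deg_quotient[OF r _ that])
    fix m assume "(r \<otimes>\<^bsub>R\<^esub> F) m \<noteq> 0"
    then have "j (m - ?n) \<noteq> 0" by (simp add: j_eq)
    then show "deg ?n \<le> deg m" using deg_nonneg[OF j] by fastforce
  qed
  then have r': "(\<lambda>m. r (m + s)) \<in> carrier R" by (rule shift_carrier[OF r])
  moreover have "j = (\<lambda>m. r (m + s)) \<otimes>\<^bsub>R\<^esub> shifted"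
  proof
    fix m
    show "j m = ((\<lambda>m. r (m + s)) \<otimes>\<^bsub>R\<^esub> shifted) m"
      unfolding j_eq mult_R
      by (rule sum.reindex_bij_witness[of _ "\<lambda>n. n + s" "\<lambda>n. n - s"])
        (auto simp: shifted_def s_def algebra_simps)
  qed
  ultimately show ?thesis by (rule that)
qed

lemma shifted_mem_strict: "shifted \<in> J"
proof -
  interpret cring R by (rule cring_R)
  show ?thesis using mult_shifted_mem_strict[OF one_closed] shifted_carrier by simp
qed

text \<open>The ideal is generated by \<open>shifted\<close>, whose restriction to the orbit is
  \<open>edge_poly\<close>.\<close>

lemma strict_vanishes_iff:
  assumes c: "c \<noteq> 0"
  shows "(\<forall>g\<in>J. value_at (point_of c) g = 0) \<longleftrightarrow> poly edge_poly c = 0"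
proof
  assume "\<forall>g\<in>J. value_at (point_of c) g = 0"
  then have "value_at (point_of c) shifted = 0" using shifted_mem_strict by blast
  then show "poly edge_poly c = 0" using value_at_rep[OF shifted_carrier rep_shifted c] by simp
next
  assume root: "poly edge_poly c = 0"
  show "\<forall>g\<in>J. value_at (point_of c) g = 0"
  proof
    fix g assume "g \<in> J"
    then obtain r where r: "r \<in> carrier R" "g = r \<otimes>\<^bsub>R\<^esub> shifted" by (rule strict_mem_mult_shifted)
    obtain N G where G: "rep N r G" using r(1) by (rule rep_exists)
    have "rep (N + 0) g (G * edge_poly)"
      unfolding r(2) by (rule rep_mult[OF r(1) G shifted_carrier rep_shifted])
    from value_at_rep[OF _ this c] show "value_at (point_of c) g = 0"
      using root c mult_R_closed[OF r(1) shifted_carrier] r(2) by simp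
  qed
qed

section \<open>Local intersection multiplicities with the orbit closure\<close>

lemma orbit_ideal_C: "i \<in> orbit_closure_ideal C C \<longleftrightarrow> i \<in> carrier R \<and> (\<forall>k. i (lat 0 k) = 0)"
proof -
  have "(\<forall>m\<in>perp C. i m = 0) \<longleftrightarrow> (\<forall>k. i (lat 0 k) = 0)"
  proof
    assume *: "\<forall>k. i (lat 0 k) = 0"
    show "\<forall>m\<in>perp C. i m = 0"
    proof
      fix m assume "m \<in> perp C"
      then have "m = lat 0 (idx m)" by (intro lattice_eqI) (simp_all add: perp_C)
      then show "i m = 0" using * by metis
    qed
  qed (simp add: perp_C)
  then show ?thesis by (simp add: orbit_closure_ideal_def)
qed

text \<open>Modulo functions vanishing on the orbit, the ideal is generated by
  \<open>edge_poly = (z - c)^\<mu> Q\<close>, where \<open>Q\<close> does not vanish at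
  \<open>c\<close> and hence is a unit of the local ring.\<close>

lemma local_contraction_C:
  assumes c: "c \<noteq> 0"
  shows "local_contraction C (point_of c) (J <+>\<^bsub>R\<^esub> orbit_closure_ideal C C) =
    vanishing c (Polynomial.order c edge_poly)"
proof (rule Set.set_eqI, rule iffI)
  let ?l = "[:- c, 1:]" and ?\<mu> = "Polynomial.order c edge_poly"
  have dvd: "?l ^ ?\<mu> dvd edge_poly" by (rule order_1)
  fix g
  {
    assume "g \<in> local_contraction C (point_of c) (J <+>\<^bsub>R\<^esub> orbit_closure_ideal C C)"
    then obtain h j i where g: "g \<in> carrier R" and h: "h \<in> carrier R"
      and val: "value_at (point_of c) h \<noteq> 0" and j: "j \<in> J" and i: "i \<in> orbit_closure_ideal C C"
      and eq: "h \<otimes>\<^bsub>R\<^esub> g = j \<oplus>\<^bsub>R\<^esub> i"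
      unfolding local_contraction_def Let_def set_add_def' by auto
    from j obtain r where r: "r \<in> carrier R" "j = r \<otimes>\<^bsub>R\<^esub> shifted" by (rule strict_mem_mult_shifted)
    obtain N G where G: "rep N r G" using r(1) by (rule rep_exists)
    have "rep (N + 0) j (G * edge_poly)"
      unfolding r(2) by (rule rep_mult[OF r(1) G shifted_carrier rep_shifted])
    \<comment> \<open>Elements of the ideal of the orbit have no terms of degree zero, so the
      restriction is that of \<open>j\<close>.\<close>
    then have hg: "rep (N + 0) (h \<otimes>\<^bsub>R\<^esub> g) (G * edge_poly)"
      using i unfolding eq orbit_ideal_C by (simp add: rep_def add_R)
    have "h \<otimes>\<^bsub>R\<^esub> g \<in> vanishing c ?\<mu>"
      unfolding vanishing_iff[OF c hg] using dvd mult_R_closed[OF h g] by simp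
    moreover obtain N1 H where H: "rep N1 h H" using h by (rule rep_exists)
    moreover obtain N2 K where K: "rep N2 g K" using g by (rule rep_exists)
    ultimately have "?l ^ ?\<mu> dvd H * K" using vanishing_iff[OF c rep_mult[OF h H g K]] by blast
    moreover have "poly H c \<noteq> 0" using val value_at_rep[OF h H c] c by auto
    ultimately have "?l ^ ?\<mu> dvd K" using monom_dvd_cancel by blast
    then show "g \<in> vanishing c ?\<mu>" using vanishing_iff[OF c K] g by blast
  }
  {
    assume g: "g \<in> vanishing c ?\<mu>"
    then obtain N G where G: "g \<in> carrier R" "rep N g (?l ^ ?\<mu> * G)" by (auto simp: vanishing_def)
    obtain Q where Q: "edge_poly = ?l ^ ?\<mu> * Q" "\<not> ?l dvd Q"
      using order_decomp[OF edge_poly_nonzero] by blast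
    \<comment> \<open>The cofactor \<open>Q\<close> is the multiplier: it completes
      \<open>(z - c)^\<mu>\<close> to \<open>edge_poly\<close>.\<close>
    define h where "h = polyfun 0 Q"
    have h: "h \<in> carrier R" "rep 0 h Q" by (simp_all add: h_def polyfun_carrier rep_polyfun)
    have val: "value_at (point_of c) h \<noteq> 0"
      using value_at_rep[OF h c] Q(2) by (auto simp: poly_eq_0_iff_dvd)
    define r where "r = polyfun N G"
    have r: "r \<in> carrier R" "rep N r G" by (simp_all add: r_def polyfun_carrier rep_polyfun)
    have rs: "rep N (r \<otimes>\<^bsub>R\<^esub> shifted) (G * edge_poly)"
      using rep_mult[OF r shifted_carrier rep_shifted] by simp
    have "rep N (h \<otimes>\<^bsub>R\<^esub> g) (Q * (?l ^ ?\<mu> * G))"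
      using rep_mult[OF h G] by simp
    also have "Q * (?l ^ ?\<mu> * G) = G * edge_poly" by (subst Q(1)) (simp only: mult_ac)
    finally have hg: "rep N (h \<otimes>\<^bsub>R\<^esub> g) (G * edge_poly)" .
    \<comment> \<open>Both products have the same restriction to the orbit, so their difference lies
      in the ideal of the orbit.\<close>
    define i where "i = (\<lambda>m. (h \<otimes>\<^bsub>R\<^esub> g) m - (r \<otimes>\<^bsub>R\<^esub> shifted) m)"
    have "i \<in> carrier R"
      by (rule carrier_R_if_low_subset[OF mult_R_closed[OF h(1) G(1)] mult_R_closed[OF r(1) shifted_carrier]])
        (auto simp: i_def)
    then have "i \<in> orbit_closure_ideal C C"
      using hg rs by (simp add: orbit_ideal_C i_def rep_def)
    moreover have "h \<otimes>\<^bsub>R\<^esub> g = (r \<otimes>\<^bsub>R\<^esub> shifted) \<oplus>\<^bsub>R\<^esub> i"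
      by (rule ext) (simp add: i_def add_R)
    ultimately show "g \<in> local_contraction C (point_of c) (J <+>\<^bsub>R\<^esub> orbit_closure_ideal C C)"
      using G(1) h val mult_shifted_mem_strict[OF r(1)]
      unfolding local_contraction_def Let_def set_add_def' by blast
  }
qed

lemma intersection_multiplicity_C:
  assumes "poly edge_poly c = 0"
  shows "intersection_multiplicity f C (C, point_of c) = enat (Polynomial.order c edge_poly)"
proof -
  have c: "c \<noteq> 0" using assms edge_poly_0 by auto
  have "0 < Polynomial.order c edge_poly"
    using assms order_root[of edge_poly c] edge_poly_nonzero by blast
  then show ?thesis
    by (simp add: intersection_multiplicity_def local_contraction_C[OF c] quotient_dim_vanishing[OF c])
qed

lemma inj_point_of: "inj point_of"
proof (rule injI)
  fix c d assume "point_of c = point_of d"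
  then have "point_of c (lat 0 1) = point_of d (lat 0 1)" by simp
  then show "c = d" by (simp add: point_of_def)
qed

lemma strict_points_C:
  "{t \<in> torus_orbit C. \<forall>g\<in>J. value_at t g = 0} = point_of ` {c. poly edge_poly c = 0}"
proof -
  have "(\<forall>g\<in>J. value_at (point_of c) g = 0) \<longleftrightarrow> poly edge_poly c = 0" if "c \<in> - {0}" for c
    using strict_vanishes_iff that by blast
  moreover have "c \<in> - {0}" if "poly edge_poly c = 0" for c
    using that edge_poly_0 by auto
  ultimately show ?thesis unfolding torus_orbit_C by blast
qed

lemma finite_strict_points_C: "finite {t \<in> torus_orbit C. \<forall>g\<in>J. value_at t g = 0}"
  unfolding strict_points_C by (simp add: poly_roots_finite edge_poly_nonzero)

text \<open>Over the complex numbers the orders of the roots of \<open>edge_poly\<close> add up to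
  its degree; \<open>point_of\<close> matches roots and intersection points one to one.\<close>

lemma sum_intersection_multiplicity:
  "(\<Sum>P\<in>{C} \<times> {t \<in> torus_orbit C. \<forall>g\<in>J. value_at t g = 0}. intersection_multiplicity f C P) = enat l"
proof -
  let ?Z = "{c. poly edge_poly c = 0}"
  have inj: "inj_on (\<lambda>c. (C, point_of c)) ?Z"
    using inj_point_of by (auto simp: inj_on_def)
  have "{C} \<times> {t \<in> torus_orbit C. \<forall>g\<in>J. value_at t g = 0} = (\<lambda>c. (C, point_of c)) ` ?Z"
    unfolding strict_points_C by auto
  then have "(\<Sum>P\<in>{C} \<times> {t \<in> torus_orbit C. \<forall>g\<in>J. value_at t g = 0}. intersection_multiplicity f C P)
      = (\<Sum>c\<in>?Z. enat (Polynomial.order c edge_poly))"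
    by (simp add: sum.reindex[OF inj] intersection_multiplicity_C)
  also have "\<dots> = enat (\<Sum>c\<in>?Z. Polynomial.order c edge_poly)"
    using poly_roots_finite[OF edge_poly_nonzero]
    by (induction rule: finite_induct) (auto simp: zero_enat_def)
  also have "(\<Sum>c\<in>?Z. Polynomial.order c edge_poly) = size (proots edge_poly)"
    unfolding size_multiset_overloaded_eq using edge_poly_nonzero
    by (simp add: set_count_proots)
  also have "\<dots> = l" by (simp add: size_proots_complex degree_edge_poly)
  finally show ?thesis .
qed

end

section \<open>Smoothness of the boundary along an interior ray\<close>

context ray
begin

text \<open>The monomial \<open>xy\<close> has degree \<open>p + q\<close>, and some multiple of
  \<open>deg m\<close> reaches this number iff \<open>deg m\<close> is positive.\<close>

lemma boundary_monomials_C: "m \<in> boundary_monomials C \<longleftrightarrow> 0 < deg m"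
proof
  assume "m \<in> boundary_monomials C"
  then obtain k where m: "0 \<le> deg m" "0 \<le> deg (int k * fst m - 1, int k * snd m - 1)"
    by (auto simp: boundary_monomials_def dual_cone_C)
  have "deg (int k * fst m - 1, int k * snd m - 1) = int k * deg m - (p + q)"
    by (simp add: deg_def algebra_simps)
  with m have "0 < int k * deg m" using p_pos q_pos by simp
  then show "0 < deg m" by (simp add: zero_less_mult_iff)
next
  assume m: "0 < deg m"
  \<comment> \<open>The multiple \<open>p + q\<close> is enough, since a positive degree is at least
    \<open>1\<close>.\<close>
  have "deg (int (nat (p + q)) * fst m - 1, int (nat (p + q)) * snd m - 1) = (p + q) * deg m - (p + q)"
    using p_pos q_pos by (simp add: deg_def algebra_simps)
  moreover have "(p + q) * 1 \<le> (p + q) * deg m"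
    using m p_pos q_pos by (intro mult_left_mono) auto
  ultimately have "(int (nat (p + q)) * fst m - 1, int (nat (p + q)) * snd m - 1) \<in> dual_cone C"
    by (simp add: dual_cone_C)
  then show "m \<in> boundary_monomials C"
    unfolding boundary_monomials_def using m dual_cone_C[of m]
    by (intro CollectI conjI exI[of _ "nat (p + q)"]) simp_all
qed

text \<open>In the chart of the ray the boundary is the orbit itself, a punctured line with
  coordinate \<open>z\<close>, so its tangent space at a point is spanned by one derivation.\<close>

lemma smooth_C:
  assumes "t \<in> torus_orbit C"
  shows "smooth_point_of_boundary (C, t)"
proof -
  obtain c where c: "t = point_of c" "c \<noteq> 0" using assms by (auto simp: torus_orbit_C)
  \<comment> \<open>The derivation \<open>z d/dz\<close> at the point: it multiplies the value of
    \<open>z^k\<close> by \<open>k\<close>.\<close>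
  define D where "D = (\<lambda>m. of_int (idx m) * t m)"
  let ?T = "boundary_tangent_space (C, t)"
  \<comment> \<open>Monomials of positive degree lie in the ideal of the boundary and those of
    negative degree lie outside the chart; so a tangent vector is concentrated in degree
    zero.\<close>
  have T_iff: "E \<in> ?T \<longleftrightarrow>
      (\<forall>m n. 0 \<le> deg m \<longrightarrow> 0 \<le> deg n \<longrightarrow> E (m + n) = t m * E n + t n * E m) \<and> (\<forall>m. deg m \<noteq> 0 \<longrightarrow> E m = 0)"
    for E
    unfolding boundary_tangent_space_def boundary_monomials_C Ball_def dual_cone_C
    by (auto simp: not_le linorder_neq_iff boundary_monomials_C dual_cone_C)
  have "D \<in> ?T"
    unfolding T_iff
  proof (intro conjI allI impI)
    fix m n assume "0 \<le> deg m" "0 \<le> deg n"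
    then show "D (m + n) = t m * D n + t n * D m"
      using c by (auto simp: D_def point_of_def power_int_add algebra_simps)
  qed (simp add: D_def c point_of_def)
  moreover have "D \<noteq> (\<lambda>_. 0)"
  proof
    assume "D = (\<lambda>_. 0)"
    then have "D (lat 0 1) = 0" by simp
    then show False using c by (simp add: D_def point_of_def)
  qed
  moreover have "\<exists>x. E = (\<lambda>m. x * D m)" if E: "E \<in> ?T" for E
  proof -
    have add: "E (m + n) = t m * E n + t n * E m" if "0 \<le> deg m" "0 \<le> deg n" for m n
      using E that unfolding T_iff by blast
    have off: "E m = 0" if "deg m \<noteq> 0" for m using E that unfolding T_iff by blast
    \<comment> \<open>Dividing by the value of \<open>z^k\<close> turns the Leibniz rule into
      additivity in \<open>k\<close>, which makes \<open>e\<close> linear on the integers.\<close>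
    define e where "e k = E (lat 0 k) / c powi k" for k
    have e_add: "e (j + k) = e j + e k" for j k
    proof -
      have "E (lat 0 (j + k)) = c powi j * E (lat 0 k) + c powi k * E (lat 0 j)"
        using add[of "lat 0 j" "lat 0 k"] lat_add[of 0 0 j k] c by (simp add: point_of_def)
      then show ?thesis using c(2) by (simp add: e_def power_int_add field_simps)
    qed
    have e_nat: "e (int n) = of_nat n * e 1" for n
    proof (induction n)
      case 0
      then show ?case using e_add[of 0 0] by simp
    next
      case (Suc n)
      then show ?case using e_add[of "int n" 1] by (simp add: algebra_simps)
    qed
    have e_int: "e k = of_int k * e 1" for k
    proof (cases "0 \<le> k")
      case True
      then show ?thesis using e_nat[of "nat k"] by simp
    next
      case False
      then have "e k + e (int (nat (- k))) = 0" using e_add[of k "- k"] e_nat[of 0] by simp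
      then have "e k + of_nat (nat (- k)) * e 1 = 0" by (simp only: e_nat)
      with False show ?thesis by (simp add: add_eq_0_iff)
    qed
    have "E m = e 1 * D m" for m
    proof (cases "deg m = 0")
      case True
      then have "m = lat 0 (idx m)" using lat_deg_idx[of m] by simp
      then have "e (idx m) * t m = E m" using True c by (simp add: e_def point_of_def)
      then show ?thesis by (simp add: D_def e_int[of "idx m"] mult_ac)
    qed (simp add: off D_def c point_of_def)
    then show ?thesis by blast
  qed
  ultimately show ?thesis unfolding smooth_point_of_boundary_def by blast
qed

end

section \<open>Faces of the Newton polygon\<close>

abbreviation supp :: "complex fps fps \<Rightarrow> lattice set" where
  "supp f \<equiv> {m. lattice_coeff f m \<noteq> 0}"

section \<open>Points of the support minimizing a linear form\<close>

definition minimizers :: "complex fps fps \<Rightarrow> real \<times> real \<Rightarrow> lattice set" where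
  "minimizers f w = {m \<in> supp f. \<forall>n \<in> supp f. w \<bullet> pt m \<le> w \<bullet> pt n}"

definition cone_ray :: "real \<times> real \<Rightarrow> cone" where
  "cone_ray w = {t *\<^sub>R w | t. 0 \<le> t}"

lemma pt_add: "pt (m + n) = pt m + pt n" and pt_diff: "pt (m - n) = pt m - pt n"
  by (simp_all add: pt_def)

lemma pt_inj [simp]: "pt m = pt n \<longleftrightarrow> m = n"
  by (auto simp: pt_def prod_eq_iff)

lemma supp_nonneg: "m \<in> supp f \<Longrightarrow> 0 \<le> fst m \<and> 0 \<le> snd m"
  by (auto simp: lattice_coeff_def split: if_splits)

text \<open>Both weights are positive, so a bound on \<open>w\<close> bounds each coordinate. This
  replaces compactness, since the support may be infinite.\<close>

lemma finite_supp_below: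
  assumes "0 < fst w" "0 < snd w"
  shows "finite {m \<in> supp f. w \<bullet> pt m \<le> c}"
proof -
  have "{m \<in> supp f. w \<bullet> pt m \<le> c} \<subseteq> {0..\<lceil>c / fst w\<rceil>} \<times> {0..\<lceil>c / snd w\<rceil>}"
  proof
    fix m assume m: "m \<in> {m \<in> supp f. w \<bullet> pt m \<le> c}"
    then have nn: "0 \<le> fst m" "0 \<le> snd m" using supp_nonneg[of m f] by simp_all
    have "fst w * fst m + snd w * snd m \<le> c"
      using m by (simp add: pt_def inner_prod_def)
    moreover have "0 \<le> fst w * fst m" "0 \<le> snd w * snd m" using nn assms by simp_all
    ultimately have "fst w * fst m \<le> c" "snd w * snd m \<le> c" by linarith+
    then have "fst m \<le> c / fst w" "snd m \<le> c / snd w" using assms by (simp_all add: field_simps)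
    then have "fst m \<le> \<lceil>c / fst w\<rceil>" "snd m \<le> \<lceil>c / snd w\<rceil>" by linarith+
    then show "m \<in> {0..\<lceil>c / fst w\<rceil>} \<times> {0..\<lceil>c / snd w\<rceil>}" using nn by (cases m) auto
  qed
  then show ?thesis by (rule finite_subset) simp
qed

lemma minimizers_nonempty:
  assumes "0 < fst w" "0 < snd w" "supp f \<noteq> {}"
  obtains v where "v \<in> minimizers f w"
proof -
  obtain m0 where m0: "m0 \<in> supp f" using assms by blast
  define T where "T = {m \<in> supp f. w \<bullet> pt m \<le> w \<bullet> pt m0}"
  have T: "finite T" "m0 \<in> T" using finite_supp_below assms m0 by (auto simp: T_def)
  obtain v where v: "v \<in> T" "\<And>m. m \<in> T \<Longrightarrow> w \<bullet> pt v \<le> w \<bullet> pt m"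
  proof -
    have "Min ((\<lambda>m. w \<bullet> pt m) ` T) \<in> (\<lambda>m. w \<bullet> pt m) ` T" using T by (intro Min_in) auto
    then obtain v where "v \<in> T" "w \<bullet> pt v = Min ((\<lambda>m. w \<bullet> pt m) ` T)" by auto
    then show ?thesis using T by (intro that[of v]) (auto intro: Min_le)
  qed
  have "w \<bullet> pt v \<le> w \<bullet> pt n" if "n \<in> supp f" for n
  proof (cases "n \<in> T")
    case False
    then have "w \<bullet> pt m0 < w \<bullet> pt n" using that by (simp add: T_def)
    then show ?thesis using v(2)[OF T(2)] by simp
  qed (rule v(2))
  then have "v \<in> minimizers f w" using v(1) by (simp add: minimizers_def T_def)
  then show ?thesis by (rule that)
qed

lemma finite_minimizers:
  assumes "0 < fst w" "0 < snd w" shows "finite (minimizers f w)"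
proof (cases "minimizers f w = {}")
  case False
  then obtain v where "v \<in> minimizers f w" by blast
  then have "minimizers f w \<subseteq> {m \<in> supp f. w \<bullet> pt m \<le> w \<bullet> pt v}"
    unfolding minimizers_def by blast
  then show ?thesis by (rule finite_subset) (rule finite_supp_below[OF assms])
qed simp

lemma minimizers_eq: "m \<in> minimizers f w \<Longrightarrow> n \<in> minimizers f w \<Longrightarrow> w \<bullet> pt m = w \<bullet> pt n"
  unfolding minimizers_def by (intro antisym) blast+

section \<open>The polygon as a convex set and its supporting lines\<close>

lemma supp_in_polygon:
  assumes "m \<in> supp f" shows "pt m \<in> newton_polygon f"
proof -
  have "pt m + 0 \<in> {pt m + v | m v. lattice_coeff f m \<noteq> 0 \<and> v \<in> quadrant}"
    using assms unfolding quadrant_def by (intro CollectI exI[of _ m] exI[of _ 0]) simp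
  then show ?thesis unfolding newton_polygon_def add_0_right by (rule hull_inc)
qed

lemma convex_polygon: "convex (newton_polygon f)"
  by (simp add: newton_polygon_def)

text \<open>Translation by \<open>v\<close> maps the generating set into itself, hence also its
  convex hull.\<close>

lemma polygon_add_quadrant:
  assumes "z \<in> newton_polygon f" "v \<in> quadrant"
  shows "z + v \<in> newton_polygon f"
proof -
  let ?X = "{pt m + v | m v. lattice_coeff f m \<noteq> 0 \<and> v \<in> quadrant}"
  have X: "(\<lambda>x. v + x) ` ?X \<subseteq> ?X"
  proof
    fix y assume "y \<in> (\<lambda>x. v + x) ` ?X"
    then obtain m u where m: "lattice_coeff f m \<noteq> 0" "u \<in> quadrant" "y = v + (pt m + u)" by blast
    then have "y = pt m + (u + v)" "u + v \<in> quadrant"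
      using assms(2) by (auto simp: quadrant_def)
    then show "y \<in> ?X" using m by blast
  qed
  have "v + z \<in> (\<lambda>x. v + x) ` newton_polygon f" using assms by blast
  also have "\<dots> = convex hull ((\<lambda>x. v + x) ` ?X)"
    by (simp add: newton_polygon_def convex_hull_translation)
  also have "\<dots> \<subseteq> newton_polygon f" unfolding newton_polygon_def by (rule hull_mono[OF X])
  finally show ?thesis by (simp add: add.commute)
qed

definition face_at :: "complex fps fps \<Rightarrow> real \<times> real \<Rightarrow> (real \<times> real) set" where
  "face_at f w = convex hull (pt ` minimizers f w)"

lemma face_at_hyperplane:
  assumes "v \<in> minimizers f w" shows "face_at f w \<subseteq> {z. w \<bullet> z = w \<bullet> pt v}"
proof -
  have "pt ` minimizers f w \<subseteq> {z. w \<bullet> z = w \<bullet> pt v}"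
    using minimizers_eq[OF _ assms] by blast
  then show ?thesis unfolding face_at_def by (rule hull_minimal) (rule convex_hyperplane)
qed

text \<open>The face together with the open half-plane above it is convex and contains all
  generators of the polygon, so it contains the polygon; both claims are read off from this.\<close>

lemma polygon_min:
  assumes w: "0 < fst w" "0 < snd w" and v: "v \<in> minimizers f w" and z: "z \<in> newton_polygon f"
  shows "w \<bullet> pt v \<le> w \<bullet> z" "w \<bullet> z = w \<bullet> pt v \<Longrightarrow> z \<in> face_at f w"
proof -
  let ?H = "face_at f w" and ?Q = "face_at f w \<union> {z. w \<bullet> pt v < w \<bullet> z}"
  have H: "w \<bullet> x = w \<bullet> pt v" if "x \<in> ?H" for x
    using face_at_hyperplane[OF v] that by blast
  have "convex ?Q"
    unfolding convex_def
  proof (intro ballI allI impI)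
    fix x y and s t :: real
    assume xy: "x \<in> ?Q" "y \<in> ?Q" and st: "0 \<le> s" "0 \<le> t" "s + t = 1"
    show "s *\<^sub>R x + t *\<^sub>R y \<in> ?Q"
    proof (cases "x \<in> ?H \<and> y \<in> ?H \<or> s = 0 \<or> t = 0")
      case True
      then show ?thesis
      proof (elim disjE)
        assume "x \<in> ?H \<and> y \<in> ?H"
        then show ?thesis using st convex_convex_hull[of "pt ` minimizers f w"]
          unfolding face_at_def convex_def by blast
      qed (use xy st in auto)
    next
      case False
      then have pos: "0 < s" "0 < t" using st by auto
      have ge: "w \<bullet> pt v \<le> w \<bullet> x" "w \<bullet> pt v \<le> w \<bullet> y"
        using xy H[of x] H[of y] by auto
      have "w \<bullet> pt v < w \<bullet> x \<or> w \<bullet> pt v < w \<bullet> y" using False xy by auto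
      then have "s * (w \<bullet> pt v) + t * (w \<bullet> pt v) < s * (w \<bullet> x) + t * (w \<bullet> y)"
      proof
        assume "w \<bullet> pt v < w \<bullet> x"
        then show ?thesis using pos ge by (intro add_less_le_mono mult_strict_left_mono mult_left_mono) auto
      next
        assume "w \<bullet> pt v < w \<bullet> y"
        then show ?thesis using pos ge by (intro add_le_less_mono mult_strict_left_mono mult_left_mono) auto
      qed
      then have "w \<bullet> pt v < w \<bullet> (s *\<^sub>R x + t *\<^sub>R y)"
        using st by (simp add: inner_add_right distrib_right[symmetric])
      then show ?thesis by simp
    qed
  qed
  moreover have "{pt m + u | m u. lattice_coeff f m \<noteq> 0 \<and> u \<in> quadrant} \<subseteq> ?Q"
  proof
    fix x assume "x \<in> {pt m + u | m u. lattice_coeff f m \<noteq> 0 \<and> u \<in> quadrant}"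
    then obtain m u where m: "lattice_coeff f m \<noteq> 0" and u: "u \<in> quadrant" and x: "x = pt m + u" by blast
    show "x \<in> ?Q"
    proof (cases "w \<bullet> pt v < w \<bullet> (pt m + u)")
      case nH: False
    have "w \<bullet> pt v \<le> w \<bullet> pt m" using v m unfolding minimizers_def by blast
    moreover have wu: "w \<bullet> u = fst w * fst u + snd w * snd u" by (simp add: inner_prod_def)
    moreover have u0: "0 \<le> fst w * fst u" "0 \<le> snd w * snd u" using u w by (simp_all add: quadrant_def)
    \<comment> \<open>No excess over the minimum is left; as both weights are positive,
      \<open>u = 0\<close>, and \<open>m\<close> itself is a minimizer.\<close>
    ultimately have eq: "w \<bullet> pt v = w \<bullet> pt m" "fst w * fst u = 0" "snd w * snd u = 0"
      using nH by (simp_all only: inner_add_right)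
    then have "u = 0" using w by (simp add: prod_eq_iff)
    moreover have "m \<in> minimizers f w"
    proof -
      have "\<forall>n\<in>supp f. w \<bullet> pt v \<le> w \<bullet> pt n" using v unfolding minimizers_def by blast
      then show ?thesis using m unfolding minimizers_def eq(1) by blast
    qed
    ultimately have "pt m + u \<in> ?H" unfolding face_at_def by (simp add: hull_inc)
    then show ?thesis using x by blast
    qed (use x in simp)
  qed
  ultimately have "newton_polygon f \<subseteq> ?Q" unfolding newton_polygon_def by (rule hull_minimal[rotated])
  with z have zQ: "z \<in> ?H \<or> w \<bullet> pt v < w \<bullet> z" by blast
  then show "w \<bullet> pt v \<le> w \<bullet> z" using H[of z] by linarith
  show "z \<in> ?H" if "w \<bullet> z = w \<bullet> pt v" using zQ that by simp
qed

lemma face_at_eq: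
  assumes w: "0 < fst w" "0 < snd w" and v: "v \<in> minimizers f w"
  shows "face_at f w = newton_polygon f \<inter> {z. w \<bullet> z = w \<bullet> pt v}"
proof
  have "face_at f w \<subseteq> newton_polygon f"
    unfolding face_at_def by (rule hull_minimal) (auto simp: minimizers_def convex_polygon intro: supp_in_polygon)
  moreover note face_at_hyperplane[OF v]
  ultimately show "face_at f w \<subseteq> newton_polygon f \<inter> {z. w \<bullet> z = w \<bullet> pt v}" by (rule Int_greatest)
  show "newton_polygon f \<inter> {z. w \<bullet> z = w \<bullet> pt v} \<subseteq> face_at f w"
    using polygon_min(2)[OF assms] by auto
qed

lemma face_at_face:
  assumes w: "0 < fst w" "0 < snd w" and v: "v \<in> minimizers f w"
  shows "face_at f w face_of newton_polygon f"
  unfolding face_at_eq[OF assms]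
  by (rule face_of_Int_supporting_hyperplane_ge[OF convex_polygon]) (rule polygon_min[OF assms])

lemma aff_dim_face_at:
  assumes w: "0 < fst w" "0 < snd w" and v: "v \<in> minimizers f w"
  shows "aff_dim (face_at f w) \<le> 1"
proof -
  have "w \<noteq> 0" using w by auto
  have "aff_dim (face_at f w) \<le> aff_dim {z. w \<bullet> z = w \<bullet> pt v}"
    by (rule aff_dim_subset) (simp add: face_at_eq[OF assms])
  also have "\<dots> = 1" using \<open>w \<noteq> 0\<close> by (simp add: aff_dim_hyperplane)
  finally show ?thesis .
qed

text \<open>Two distinct minimizers make the dimension at least one, the supporting line makes it at
  most one.\<close>

lemma face_at_edge:
  assumes w: "0 < fst w" "0 < snd w" and v: "v \<in> minimizers f w" "v' \<in> minimizers f w" "v \<noteq> v'"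
  shows "face_at f w edge_of newton_polygon f" "compact (face_at f w)"
proof -
  have "{pt v, pt v'} \<subseteq> face_at f w"
    using v by (auto simp: face_at_def intro: hull_inc)
  then have "aff_dim {pt v, pt v'} \<le> aff_dim (face_at f w)" by (rule aff_dim_subset)
  then show "face_at f w edge_of newton_polygon f"
    using aff_dim_face_at[OF w v(1)] face_at_face[OF w v(1)] v(3) by (simp add: edge_of_def aff_dim_2)
  show "compact (face_at f w)"
    unfolding face_at_def using finite_minimizers[OF w]
    by (intro compact_convex_hull finite_imp_compact) simp
qed

section \<open>Compact edges and their normals\<close>

lemma edge_two_points:
  assumes "aff_dim (e :: (real \<times> real) set) = 1"
  obtains z1 z2 where "z1 \<in> e" "z2 \<in> e" "z1 \<noteq> z2"
proof -
  have "e \<noteq> {}" using assms by auto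
  then obtain z1 where z1: "z1 \<in> e" by blast
  have "e \<noteq> {z1}" using assms by auto
  then show ?thesis using z1 that by blast
qed

lemma perp_multiple:
  fixes w x y :: "real \<times> real"
  assumes "0 < fst w" "0 < snd w" "w \<bullet> x = 0" "w \<bullet> y = 0" "x \<noteq> 0"
  obtains \<alpha> where "y = \<alpha> *\<^sub>R x"
proof -
  have e: "fst w * fst x + snd w * snd x = 0" "fst w * fst y + snd w * snd y = 0"
    using assms by (simp_all add: inner_prod_def)
  have x1: "fst x \<noteq> 0"
  proof
    assume "fst x = 0"
    then have "snd x = 0" using e(1) assms by simp
    with \<open>fst x = 0\<close> assms(5) show False by (simp add: prod_eq_iff)
  qed
  have s: "snd x = - (fst w * fst x) / snd w" "snd y = - (fst w * fst y) / snd w"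
    using e assms by (simp_all add: field_simps)
  have "y = (fst y / fst x) *\<^sub>R x" using x1 s by (simp add: prod_eq_iff)
  then show ?thesis by (rule that)
qed

text \<open>If an edge orthogonal to \<open>w\<close> lay strictly above the face in direction \<open>w\<close>, its midpoint would
  be interior to the polygon.\<close>

lemma edge_orthogonal:
  assumes w: "0 < fst w" "0 < snd w" and v: "v \<in> minimizers f w"
    and e: "e edge_of newton_polygon f" and orth: "\<And>x y. x \<in> e \<Longrightarrow> y \<in> e \<Longrightarrow> w \<bullet> (x - y) = 0"
  shows "e = face_at f w"
proof -
  let ?P = "newton_polygon f"
  have face: "e face_of ?P" and dim: "aff_dim e = 1" using e by (auto simp: edge_of_def)
  have eP: "e \<subseteq> ?P" using face by (rule face_of_imp_subset)
  obtain z1 z2 where z: "z1 \<in> e" "z2 \<in> e" "z1 \<noteq> z2" using dim by (rule edge_two_points)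
  define d where "d = z2 - z1"
  define mid where "mid = midpoint z1 z2"
  have convex_e: "convex e" using face by (rule face_of_imp_convex)
  have mid: "mid \<in> e"
    unfolding mid_def using z convex_e midpoint_in_closed_segment[of z1 z2] unfolding convex_contains_segment by blast
  have d: "w \<bullet> d = 0" "d \<noteq> 0" using orth[OF z(2,1)] z by (simp_all add: d_def)
  have min: "w \<bullet> pt v \<le> w \<bullet> mid" using polygon_min[OF w v] mid eP by blast
  have "w \<bullet> mid = w \<bullet> pt v"
  proof (rule ccontr)
    assume "w \<bullet> mid \<noteq> w \<bullet> pt v"
    with min have less: "w \<bullet> pt v < w \<bullet> mid" by simp
    define \<delta> where "\<delta> = mid - pt v"
    \<comment> \<open>Chosen so that \<open>\<delta> - (\<beta>, \<beta>)\<close> is orthogonal to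
      \<open>w\<close>: the displacement splits into a part along the edge and a part pointing into
      the interior of the quadrant.\<close>
    define \<beta> where "\<beta> = (w \<bullet> \<delta>) / (fst w + snd w)"
    have \<beta>: "0 < \<beta>" using less w by (simp add: \<beta>_def \<delta>_def inner_diff_right)
    have "w \<bullet> (\<delta> - (\<beta>, \<beta>)) = w \<bullet> \<delta> - \<beta> * (fst w + snd w)"
      by (simp add: inner_diff_right inner_prod_def algebra_simps)
    also have "\<dots> = 0" using w by (simp add: \<beta>_def)
    finally obtain \<alpha> where \<alpha>: "\<delta> - (\<beta>, \<beta>) = \<alpha> *\<^sub>R d"
      using perp_multiple[OF w d(1) _ d(2)] by blast
    \<comment> \<open>Small enough for \<open>mid\<close>, moved by
      \<open>\<epsilon> * \<alpha>\<close> times \<open>d\<close>, to stay on the edge: the midpoint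
      leaves half a segment on either side.\<close>
    define \<epsilon> where "\<epsilon> = 1 / (2 * (\<bar>\<alpha>\<bar> + 1))"
    have \<epsilon>: "0 < \<epsilon>" "\<bar>\<epsilon> * \<alpha>\<bar> \<le> 1 / 2"
      by (simp_all add: \<epsilon>_def abs_mult field_simps)
    have "mid + (\<epsilon> * \<alpha>) *\<^sub>R d = (1 / 2 - \<epsilon> * \<alpha>) *\<^sub>R z1 + (1 / 2 + \<epsilon> * \<alpha>) *\<^sub>R z2"
      by (simp add: mid_def midpoint_def d_def algebra_simps)
    also have "\<dots> \<in> e"
      using convex_e z \<epsilon> unfolding convex_def by (auto simp: abs_le_iff)
    finally have "mid + (\<epsilon> * \<alpha>) *\<^sub>R d \<in> ?P" using eP by blast
    moreover have "(\<epsilon> * \<beta>, \<epsilon> * \<beta>) \<in> quadrant" using \<epsilon> \<beta> by (simp add: quadrant_def)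
    ultimately have "(mid + (\<epsilon> * \<alpha>) *\<^sub>R d) + (\<epsilon> * \<beta>, \<epsilon> * \<beta>) \<in> ?P" by (rule polygon_add_quadrant)
    also have "(mid + (\<epsilon> * \<alpha>) *\<^sub>R d) + (\<epsilon> * \<beta>, \<epsilon> * \<beta>) = mid + \<epsilon> *\<^sub>R (\<alpha> *\<^sub>R d + (\<beta>, \<beta>))"
      by (simp add: algebra_simps)
    also have "\<alpha> *\<^sub>R d + (\<beta>, \<beta>) = \<delta>" using \<alpha> by (simp add: algebra_simps)
    finally have y: "mid + \<epsilon> *\<^sub>R \<delta> \<in> ?P" .
    \<comment> \<open>With this weight \<open>mid\<close> lies between \<open>pt v\<close> and
      \<open>mid + \<epsilon> *\<^sub>R \<delta>\<close>; the face property then draws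
      \<open>pt v\<close> into \<open>e\<close>, although it is strictly lower in direction
      \<open>w\<close>.\<close>
    define \<kappa> where "\<kappa> = 1 / (1 + \<epsilon>)"
    have \<kappa>: "\<kappa> * (1 + \<epsilon>) = 1" "0 < \<kappa>" "\<kappa> < 1" using \<epsilon> by (simp_all add: \<kappa>_def)
    have "(1 - \<kappa>) *\<^sub>R pt v + \<kappa> *\<^sub>R (mid + \<epsilon> *\<^sub>R \<delta>) =
        (1 - \<kappa> * (1 + \<epsilon>)) *\<^sub>R pt v + (\<kappa> * (1 + \<epsilon>)) *\<^sub>R mid"
      by (simp add: \<delta>_def algebra_simps)
    then have "mid = (1 - \<kappa>) *\<^sub>R pt v + \<kappa> *\<^sub>R (mid + \<epsilon> *\<^sub>R \<delta>)"
      unfolding \<kappa>(1) by simp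
    moreover have "pt v \<noteq> mid + \<epsilon> *\<^sub>R \<delta>"
    proof
      assume "pt v = mid + \<epsilon> *\<^sub>R \<delta>"
      then have "(1 + \<epsilon>) *\<^sub>R \<delta> = 0" by (simp add: \<delta>_def algebra_simps)
      then have "\<delta> = 0" using \<epsilon> by simp
      then show False using less by (simp add: \<delta>_def)
    qed
    ultimately have "mid \<in> open_segment (pt v) (mid + \<epsilon> *\<^sub>R \<delta>)"
      using \<kappa> unfolding in_segment by (intro conjI exI[of _ \<kappa>]) auto
    moreover have "pt v \<in> ?P" using v by (auto simp: minimizers_def intro: supp_in_polygon)
    ultimately have "pt v \<in> e" using face y mid unfolding face_of_def by blast
    then have "w \<bullet> (pt v - mid) = 0" using orth mid by blast
    then show False using less by (simp add: inner_diff_right)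
  qed
  moreover have "w \<bullet> z = w \<bullet> mid" if "z \<in> e" for z
    using orth[OF that mid] by (simp add: inner_diff_right)
  ultimately have "e \<subseteq> {z. w \<bullet> z = w \<bullet> pt v}" by auto
  then have sub: "e \<subseteq> face_at f w" unfolding face_at_eq[OF w v] using eP by blast
  then have "e face_of face_at f w"
    using face face_at_eq[OF w v] by (metis face_of_subset inf_le1)
  \<comment> \<open>A proper face would have smaller dimension.\<close>
  then show ?thesis
    using face_of_aff_dim_lt[of "face_at f w" e] aff_dim_face_at[OF w v] dim
    by (force simp: face_at_def)
qed

text \<open>The polygon is stable under adding the quadrant, so an edge with direction in the
  quadrant would be unbounded. A compact edge thus has a direction with coordinates of opposite
  signs, whence a normal with positive coordinates.\<close>

lemma compact_edge_direction:
  assumes e: "e edge_of newton_polygon f" and compact: "compact e"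
  obtains w where "0 < fst w" "0 < snd w"
    "{w' \<in> quadrant. \<forall>x\<in>e. \<forall>y\<in>e. w' \<bullet> (x - y) = 0} = cone_ray w"
    "\<And>x y. x \<in> e \<Longrightarrow> y \<in> e \<Longrightarrow> w \<bullet> (x - y) = 0"
proof -
  let ?P = "newton_polygon f"
  have face: "e face_of ?P" and dim: "aff_dim e = 1" using e by (auto simp: edge_of_def)
  have eP: "e \<subseteq> ?P" using face by (rule face_of_imp_subset)
  obtain z1 z2 where z: "z1 \<in> e" "z2 \<in> e" "z1 \<noteq> z2" using dim by (rule edge_two_points)
  have not_quadrant: False if "x \<in> e" "y \<in> e" "x \<noteq> y" "y - x \<in> quadrant" for x y
  proof -
    have unb: "x + t *\<^sub>R (y - x) \<in> e" if t: "1 < t" for t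
    proof -
      have "t *\<^sub>R (y - x) \<in> quadrant" using \<open>y - x \<in> quadrant\<close> t by (auto simp: quadrant_def)
      then have P: "x + t *\<^sub>R (y - x) \<in> ?P" using \<open>x \<in> e\<close> eP by (intro polygon_add_quadrant) auto
      \<comment> \<open>As \<open>y\<close> lies between \<open>x\<close> and a farther point of the
        polygon, the face property draws that point into the edge.\<close>
      have "y = (1 - 1 / t) *\<^sub>R x + (1 / t) *\<^sub>R (x + t *\<^sub>R (y - x))"
        using t by (simp add: prod_eq_iff field_simps)
      moreover have "x \<noteq> x + t *\<^sub>R (y - x)" using t \<open>x \<noteq> y\<close> by simp
      ultimately have "y \<in> open_segment x (x + t *\<^sub>R (y - x))"
        using t unfolding in_segment by (intro conjI exI[of _ "1 / t"]) auto
      then show ?thesis using face P \<open>x \<in> e\<close> \<open>y \<in> e\<close> eP unfolding face_of_def by blast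
    qed
    obtain B where B: "\<And>z. z \<in> e \<Longrightarrow> norm z \<le> B"
      using compact_imp_bounded[OF compact] unfolding bounded_iff by blast
    \<comment> \<open>Large enough for \<open>x + t *\<^sub>R (y - x)\<close> to leave the ball of
      radius \<open>B\<close>.\<close>
    define t where "t = (B + norm x + 1) / norm (y - x) + 1 + 1"
    have n: "0 < norm (y - x)" using \<open>x \<noteq> y\<close> by simp
    have "0 \<le> B" using B[OF \<open>x \<in> e\<close>] norm_ge_zero[of x] by linarith
    then have "1 < t" using n by (simp add: t_def add_nonneg_pos)
    have "t * norm (y - x) = norm (t *\<^sub>R (y - x))" using \<open>1 < t\<close> by simp
    also have "\<dots> \<le> norm (x + t *\<^sub>R (y - x)) + norm x"
      using norm_triangle_ineq4[of "x + t *\<^sub>R (y - x)" x] by simp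
    also have "\<dots> \<le> B + norm x" using B unb[OF \<open>1 < t\<close>] by simp
    also have "t * norm (y - x) = (B + norm x + 1) + norm (y - x) + norm (y - x)"
      unfolding t_def distrib_right using n by simp
    finally have "(B + norm x + 1) + norm (y - x) + norm (y - x) \<le> B + norm x" .
    then show False using n by simp
  qed
  have "collinear e" using dim by (simp add: collinear_aff_dim)
  then obtain u where u: "\<And>x y. x \<in> e \<Longrightarrow> y \<in> e \<Longrightarrow> \<exists>c. x - y = c *\<^sub>R u"
    unfolding collinear_def by blast
  obtain c where c: "z2 - z1 = c *\<^sub>R u" using u z by blast
  then have c0: "c \<noteq> 0" using z by auto
  have d: "z2 - z1 \<notin> quadrant" "z1 - z2 \<notin> quadrant" using not_quadrant z by blast+
  define D where "D = z2 - z1"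
  have D: "fst D < 0 \<and> 0 < snd D \<or> 0 < fst D \<and> snd D < 0"
    using d by (auto simp: D_def quadrant_def)
  \<comment> \<open>A quarter turn of \<open>D\<close>, up to sign; it is orthogonal to
    \<open>D\<close> because the coordinates of \<open>D\<close> have opposite signs.\<close>
  define w where "w = (\<bar>snd D\<bar>, \<bar>fst D\<bar>)"
  have w: "0 < fst w" "0 < snd w" using D by (auto simp: w_def)
  have orth: "w \<bullet> (x - y) = 0" if xy: "x \<in> e" "y \<in> e" for x y
  proof -
    obtain k where "x - y = k *\<^sub>R u" using u[OF xy] by blast
    moreover have "u = (1 / c) *\<^sub>R D" using c c0 by (simp add: D_def)
    moreover have "w \<bullet> D = 0" using D by (auto simp: w_def inner_prod_def)
    ultimately show ?thesis by simp
  qed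
  have "{w' \<in> quadrant. \<forall>x\<in>e. \<forall>y\<in>e. w' \<bullet> (x - y) = 0} = cone_ray w"
  proof (intro equalityI subsetI)
    fix w' assume w': "w' \<in> {w' \<in> quadrant. \<forall>x\<in>e. \<forall>y\<in>e. w' \<bullet> (x - y) = 0}"
    then have "w' \<bullet> D = 0" using z by (auto simp: D_def)
    then have e: "fst w' * fst D + snd w' * snd D = 0" by (simp add: inner_prod_def)
    have q: "0 \<le> fst w'" "0 \<le> snd w'" using w' by (auto simp: quadrant_def)
    have "fst w' * snd w = snd w' * fst w" using D e by (auto simp: w_def)
    then have "w' = (fst w' / fst w) *\<^sub>R w" using w by (simp add: prod_eq_iff field_simps)
    moreover have "0 \<le> fst w' / fst w" using q w by simp
    ultimately show "w' \<in> cone_ray w" unfolding cone_ray_def by blast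
  next
    fix w' assume "w' \<in> cone_ray w"
    then show "w' \<in> {w' \<in> quadrant. \<forall>x\<in>e. \<forall>y\<in>e. w' \<bullet> (x - y) = 0}"
      using w orth by (auto simp: cone_ray_def quadrant_def)
  qed
  then show ?thesis using that w orth by blast
qed

lemma minimizers_scale:
  assumes "0 < t" shows "minimizers f (t *\<^sub>R w) = minimizers f w"
  using assms by (simp add: minimizers_def)

lemma cone_ray_scale:
  assumes "0 < t" shows "cone_ray (t *\<^sub>R w) = cone_ray w"
proof
  show "cone_ray (t *\<^sub>R w) \<subseteq> cone_ray w"
  proof
    fix x assume "x \<in> cone_ray (t *\<^sub>R w)"
    then obtain s where "x = (s * t) *\<^sub>R w" "0 \<le> s" by (auto simp: cone_ray_def)
    moreover have "0 \<le> s * t" using \<open>0 \<le> s\<close> assms by simp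
    ultimately show "x \<in> cone_ray w" unfolding cone_ray_def by blast
  qed
  show "cone_ray w \<subseteq> cone_ray (t *\<^sub>R w)"
  proof
    fix x assume "x \<in> cone_ray w"
    then obtain s where "x = s *\<^sub>R w" "0 \<le> s" by (auto simp: cone_ray_def)
    then have "x = (s / t) *\<^sub>R (t *\<^sub>R w)" "0 \<le> s / t" using assms by simp_all
    then show "x \<in> cone_ray (t *\<^sub>R w)" unfolding cone_ray_def by blast
  qed
qed

lemma edge1_cone_ray: "edge1 = cone_ray (1, 0)" and edge2_cone_ray: "edge2 = cone_ray (0, 1)"
  by (auto simp: edge1_def edge2_def cone_ray_def)

section \<open>Integral length of the edge and rationality of its normal\<close>

context ray
begin

lemma dirv_scale: "dirv t = t *\<^sub>R dirv 1"
  by (simp add: dirv_def)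

lemma C_cone_ray: "C = cone_ray (dirv 1)"
proof -
  have "C = (\<lambda>t. t *\<^sub>R dirv 1) ` {0..}" unfolding C_def by (simp only: dirv_scale[symmetric])
  then show ?thesis by (auto simp: cone_ray_def)
qed

lemma inner_dirv: "dirv 1 \<bullet> pt m = real_of_int (deg m)"
  by (simp add: inner_pt)

lemma dirv_pos: "0 < fst (dirv 1)" "0 < snd (dirv 1)"
  using p_pos q_pos by (simp_all add: dirv_def)

text \<open>The minimizers lie on one line of constant degree, where \<open>idx\<close> counts
  primitive steps; its extreme values give the end points. The step \<open>(q, -p)\<close> is
  primitive by the Bezout relation.\<close>

lemma ray_edge_exists:
  assumes "supp f \<noteq> {}"
  obtains A l where "ray_edge p q a b f A l" "has_integral_length (face_at f (dirv 1)) l"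
proof -
  define M where "M = minimizers f (dirv 1)"
  have M: "finite M" "M \<noteq> {}"
    using finite_minimizers[OF dirv_pos] minimizers_nonempty[OF dirv_pos assms] by (auto simp: M_def)
  have "Min (idx ` M) \<in> idx ` M" "Max (idx ` M) \<in> idx ` M" using M by simp_all
  then obtain A B where A: "A \<in> M" "idx A = Min (idx ` M)" and B: "B \<in> M" "idx B = Max (idx ` M)"
    by (metis imageE)
  have between: "idx A \<le> idx m" "idx m \<le> idx B" if "m \<in> M" for m
    using that A B M by simp_all
  have degM: "deg m = deg A" if "m \<in> M" for m
    using minimizers_eq[of m f "dirv 1" A] that A by (simp add: M_def inner_dirv)
  define l where "l = nat (idx B - idx A)"
  have l: "int l = idx B - idx A" using between(1)[OF B(1)] by (simp add: l_def)
  have B_eq: "B = A + lat 0 (int l)" using degM[OF B(1)] l by (intro lattice_eqI) simp_all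
  have supp: "A \<in> supp f" "B \<in> supp f" using A B by (simp_all add: M_def minimizers_def)
  have min: "deg A \<le> deg m" if "m \<in> supp f" for m
  proof -
    have "dirv 1 \<bullet> pt A \<le> dirv 1 \<bullet> pt m" using A(1) that unfolding M_def minimizers_def by blast
    then show ?thesis by (simp add: inner_dirv)
  qed
  have "ray_edge p q a b f A l"
  proof
    fix m assume m: "lattice_coeff f m \<noteq> 0"
    then show "deg A \<le> deg m" using min by simp
    assume "deg m = deg A"
    then have "m \<in> M" using m min unfolding M_def minimizers_def by (simp add: inner_dirv)
    then show "idx A \<le> idx m \<and> idx m \<le> idx A + int l" using between l by simp
  qed (use supp B_eq in auto)
  moreover have "face_at f (dirv 1) = closed_segment (pt A) (pt B)"
  proof
    have "pt ` M \<subseteq> closed_segment (pt A) (pt B)"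
    proof
      fix z assume "z \<in> pt ` M"
      then obtain m where m: "m \<in> M" "z = pt m" by blast
      define k where "k = idx m - idx A"
      have k: "0 \<le> k" "k \<le> int l" using between[OF m(1)] l by (simp_all add: k_def)
      have meq: "m = A + lat 0 k" using degM[OF m(1)] by (intro lattice_eqI) (simp_all add: k_def)
      show "z \<in> closed_segment (pt A) (pt B)"
      proof (cases "l = 0")
        case True
        then have "z = pt A" using k m meq by (simp add: lat_def zero_prod_def[symmetric])
        then show ?thesis by simp
      next
        case False
        define s where "s = real_of_int k / real l"
        have s: "0 \<le> s" "s \<le> 1" using k False by (simp_all add: s_def)
        have "pt (lat 0 k) = s *\<^sub>R pt (lat 0 (int l))"
          using False by (simp add: pt_def lat_def s_def)
        then have "z = (1 - s) *\<^sub>R pt A + s *\<^sub>R pt B"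
          unfolding m(2) meq B_eq by (simp add: pt_add algebra_simps)
        then show ?thesis using s unfolding closed_segment_def by blast
      qed
    qed
    then show "face_at f (dirv 1) \<subseteq> closed_segment (pt A) (pt B)"
      unfolding face_at_def M_def by (rule hull_minimal) simp
    show "closed_segment (pt A) (pt B) \<subseteq> face_at f (dirv 1)"
      unfolding segment_convex_hull face_at_def
      by (rule hull_mono) (use A B in \<open>simp add: M_def\<close>)
  qed
  moreover have "coprime q (- p)"
  proof (rule coprimeI)
    fix d assume "d dvd q" "d dvd - p"
    then have "d dvd p * a + q * b" by simp
    then show "d dvd 1" by (simp add: bezout)
  qed
  ultimately have "has_integral_length (face_at f (dirv 1)) l"
    unfolding has_integral_length_def B_eq
    by (intro exI[of _ A] exI[of _ "A + lat 0 (int l)"] exI[of _ "(q, - p)"]) (simp add: lat_def)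
  then show ?thesis using \<open>ray_edge p q a b f A l\<close> that by blast
qed

end

text \<open>A tie makes \<open>w\<close> orthogonal to a nonzero lattice vector, hence proportional
  to an integral vector; dividing by the gcd makes this one primitive.\<close>

lemma integral_direction:
  assumes w: "0 < fst w" "0 < snd w"
    and v: "v \<in> minimizers f w" "v' \<in> minimizers f w" "v \<noteq> v'"
  obtains p q a b t where "ray p q a b" "0 < t" "w = t *\<^sub>R ray.dirv p q 1"
proof -
  define x where "x = \<bar>fst v - fst v'\<bar>"
  define y where "y = \<bar>snd v - snd v'\<bar>"
  have "w \<bullet> pt v = w \<bullet> pt v'" using minimizers_eq v by blast
  then have e: "fst w * (fst v - fst v') = - (snd w * (snd v - snd v'))"
    by (simp add: pt_def inner_prod_def algebra_simps)
  then have "\<bar>fst w * (fst v - fst v')\<bar> = \<bar>snd w * (snd v - snd v')\<bar>" by simp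
  then have e': "fst w * x = snd w * y" using w by (simp add: abs_mult x_def y_def)
  have "x \<noteq> 0 \<or> y \<noteq> 0" using v(3) by (auto simp: x_def y_def prod_eq_iff)
  moreover have "x = 0 \<longleftrightarrow> y = 0" using e' w by auto
  ultimately have xy: "0 < x" "0 < y" by (auto simp: x_def y_def)
  define g where "g = gcd y x"
  have g: "0 < g" "g dvd x" "g dvd y" using xy by (simp_all add: g_def)
  define p where "p = y div g"
  define q where "q = x div g"
  have pq: "y = g * p" "x = g * q" using g by (simp_all add: p_def q_def)
  have pos: "0 < p" "0 < q" using xy g(1) unfolding pq by (simp_all add: zero_less_mult_iff)
  have "coprime p q" unfolding p_def q_def g_def using xy by (intro div_gcd_coprime) simp
  then obtain a b where "p * a + q * b = 1"
    using bezout_int[of p q] by (auto simp: mult.commute coprime_iff_gcd_eq_1)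
  then have ray: "ray p q a b" using pos by (simp add: ray_def)
  then interpret ray p q a b .
  have "fst w * q = snd w * p" using e' g(1) unfolding pq by simp
  then have "w = (fst w / p) *\<^sub>R dirv 1" using pos by (simp add: dirv_def prod_eq_iff field_simps)
  moreover have "0 < fst w / p" using w pos by simp
  ultimately show ?thesis using that ray by blast
qed

text \<open>An edge needs two minimizers, and their tie makes its normal rational; this brings every
  interior ray into the scope of the locale \<open>ray\<close>.\<close>

lemma interior_ray:
  assumes S: "supp f \<noteq> {}" and \<rho>: "\<rho> \<in> newton_rays f - {edge1, edge2}"
  obtains p q a b e where "ray p q a b" "\<rho> = ray.C p q"
    "face_at f (ray.dirv p q 1) edge_of newton_polygon f"
proof -
  from \<rho> obtain e where e: "e edge_of newton_polygon f" "compact e"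
    and \<rho>_eq: "\<rho> = {w \<in> quadrant. \<forall>u\<in>e. \<forall>v\<in>e. w \<bullet> (u - v) = 0}"
    by (auto simp: newton_rays_def)
  obtain w where w: "0 < fst w" "0 < snd w" and ray: "\<rho> = cone_ray w"
    and orth: "\<And>x y. x \<in> e \<Longrightarrow> y \<in> e \<Longrightarrow> w \<bullet> (x - y) = 0"
    using compact_edge_direction[OF e] unfolding \<rho>_eq by blast
  obtain v where v: "v \<in> minimizers f w" using minimizers_nonempty[OF w S] .
  have e_eq: "e = face_at f w" by (rule edge_orthogonal[OF w v e(1) orth])
  have "minimizers f w \<noteq> {v}"
  proof
    assume "minimizers f w = {v}"
    then have "aff_dim e = 0" by (simp add: e_eq face_at_def)
    then show False using e by (simp add: edge_of_def)
  qed
  then obtain v' where v': "v' \<in> minimizers f w" "v \<noteq> v'" using v by blast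
  obtain p q a b t where r: "ray p q a b" and t: "0 < t" "w = t *\<^sub>R ray.dirv p q 1"
    using integral_direction[OF w v v'] .
  interpret ray p q a b by (rule r)
  have "\<rho> = C" unfolding ray t(2) cone_ray_scale[OF t(1)] C_cone_ray ..
  moreover have "face_at f (dirv 1) = e"
    unfolding e_eq face_at_def t(2) minimizers_scale[OF t(1)] ..
  ultimately show ?thesis using that r e(1) by simp
qed

lemma newton_rays_cone_ray:
  assumes S: "supp f \<noteq> {}" and "\<rho> \<in> newton_rays f"
  obtains a where "\<rho> = cone_ray a" "a \<in> quadrant" "a \<noteq> 0"
proof (cases "\<rho> \<in> {edge1, edge2}")
  case True
  then show ?thesis
  proof
    assume "\<rho> = edge1"
    then show ?thesis by (intro that[of "(1, 0)"]) (simp_all add: edge1_cone_ray quadrant_def zero_prod_def)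
  next
    assume "\<rho> \<in> {edge2}"
    then show ?thesis by (intro that[of "(0, 1)"]) (simp_all add: edge2_cone_ray quadrant_def zero_prod_def)
  qed
next
  case False
  then have "\<rho> \<in> newton_rays f - {edge1, edge2}" using assms by blast
  then obtain p q a b where r: "ray p q a b" "\<rho> = ray.C p q"
    by (rule interior_ray[OF S])
  interpret ray p q a b by (rule r)
  show ?thesis
  proof (rule that)
    show "\<rho> = cone_ray (dirv 1)" unfolding r(2) by (rule C_cone_ray)
    show "dirv 1 \<in> quadrant" using dirv_pos unfolding quadrant_def by simp
    show "dirv 1 \<noteq> 0" using dirv_pos(1) by (metis fst_zero less_irrefl)
  qed
qed

text \<open>The direction \<open>w\<close> is orthogonal to the compact edge spanned by its
  minimizers, and such directions in the quadrant form a single ray. So ties occur only along rays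
  of the fan.\<close>

lemma minimizing_direction_ray:
  assumes w: "0 < fst w" "0 < snd w"
    and v: "v \<in> minimizers f w" "v' \<in> minimizers f w" "v \<noteq> v'"
  shows "cone_ray w \<in> newton_rays f"
proof -
  note e = face_at_edge[OF w v]
  obtain w' where w': "0 < fst w'" "0 < snd w'"
    "{u \<in> quadrant. \<forall>x\<in>face_at f w. \<forall>y\<in>face_at f w. u \<bullet> (x - y) = 0} = cone_ray w'"
    "\<And>x y. x \<in> face_at f w \<Longrightarrow> y \<in> face_at f w \<Longrightarrow> w' \<bullet> (x - y) = 0"
    using compact_edge_direction[OF e] by blast
  have "w \<bullet> (x - y) = 0" if "x \<in> face_at f w" "y \<in> face_at f w" for x y
  proof -
    have "w \<bullet> x = w \<bullet> pt v" "w \<bullet> y = w \<bullet> pt v" using face_at_hyperplane[OF v(1)] that by blast+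
    then show ?thesis by (simp add: inner_diff_right)
  qed
  then have "w \<in> cone_ray w'" unfolding w'(3)[symmetric] using w by (simp add: quadrant_def)
  then obtain t where t: "w = t *\<^sub>R w'" "0 \<le> t" by (auto simp: cone_ray_def)
  then have "0 < t" using w(1) by (cases "t = 0") auto
  then have "cone_ray w = cone_ray w'" unfolding t(1) by (rule cone_ray_scale)
  then show ?thesis using w'(3) e unfolding newton_rays_def by blast
qed

section \<open>Two-dimensional cones of the Newton fan\<close>

lemma convex_hull_cone_rays:
  "convex hull (cone_ray a \<union> cone_ray b) = {s *\<^sub>R a + t *\<^sub>R b | s t. 0 \<le> s \<and> 0 \<le> t}" (is "?H = ?Q")
proof
  have "convex ?Q"
    unfolding convex_def
  proof (intro ballI allI impI)
    fix x y and u v :: real assume xy: "x \<in> ?Q" "y \<in> ?Q" and uv: "0 \<le> u" "0 \<le> v" "u + v = 1"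
    then obtain s t s' t' where eq: "x = s *\<^sub>R a + t *\<^sub>R b" "y = s' *\<^sub>R a + t' *\<^sub>R b"
      and pos: "0 \<le> s" "0 \<le> t" "0 \<le> s'" "0 \<le> t'" by blast
    have "u *\<^sub>R x + v *\<^sub>R y = (u * s + v * s') *\<^sub>R a + (u * t + v * t') *\<^sub>R b"
      unfolding eq by (simp add: algebra_simps)
    moreover have "0 \<le> u * s + v * s'" "0 \<le> u * t + v * t'" using pos uv by simp_all
    ultimately show "u *\<^sub>R x + v *\<^sub>R y \<in> ?Q" by blast
  qed
  moreover have "cone_ray a \<union> cone_ray b \<subseteq> ?Q"
  proof
    fix x assume "x \<in> cone_ray a \<union> cone_ray b"
    then show "x \<in> ?Q"
    proof
      assume "x \<in> cone_ray a"
      then obtain t where "0 \<le> t" "x = t *\<^sub>R a" by (auto simp: cone_ray_def)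
      then have "x = t *\<^sub>R a + 0 *\<^sub>R b \<and> 0 \<le> t \<and> (0::real) \<le> 0" by simp
      then show ?thesis by blast
    next
      assume "x \<in> cone_ray b"
      then obtain t where "0 \<le> t" "x = t *\<^sub>R b" by (auto simp: cone_ray_def)
      then have "x = 0 *\<^sub>R a + t *\<^sub>R b \<and> (0::real) \<le> 0 \<and> 0 \<le> t" by simp
      then show ?thesis by blast
    qed
  qed
  ultimately show "?H \<subseteq> ?Q" by (rule hull_minimal[rotated])
  show "?Q \<subseteq> ?H"
  proof
    fix x assume "x \<in> ?Q"
    then obtain s t where x: "x = s *\<^sub>R a + t *\<^sub>R b" "0 \<le> s" "0 \<le> t" by blast
    have "u *\<^sub>R c \<in> cone_ray c" if "0 \<le> u" for u c
      using that unfolding cone_ray_def by blast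
    \<comment> \<open>The point \<open>s a + t b\<close> is the midpoint of \<open>2 s a\<close> and
      \<open>2 t b\<close>.\<close>
    then have "(2 * s) *\<^sub>R a \<in> cone_ray a" "(2 * t) *\<^sub>R b \<in> cone_ray b"
      using x(2,3) by simp_all
    then have "(2 * s) *\<^sub>R a \<in> ?H" "(2 * t) *\<^sub>R b \<in> ?H"
      by (meson UnI1 UnI2 hull_inc)+
    then have "(1 / 2) *\<^sub>R ((2 * s) *\<^sub>R a) + (1 / 2) *\<^sub>R ((2 * t) *\<^sub>R b) \<in> ?H"
      by (intro convexD[OF convex_convex_hull]) simp_all
    then show "x \<in> ?H" by (simp add: x(1))
  qed
qed

text \<open>Moving from \<open>a + b\<close> towards \<open>a\<close>, the minimizer can only change at a direction where two
  points of the support tie, that is, at a ray of the Newton fan.\<close>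

lemma minimizer_extends:
  assumes ab: "a \<in> quadrant" "b \<in> quadrant" "0 < fst (a + b)" "0 < snd (a + b)"
    and uniq: "\<And>s t v v'. 0 < s \<Longrightarrow> 0 < t \<Longrightarrow> v \<in> minimizers f (s *\<^sub>R a + t *\<^sub>R b) \<Longrightarrow>
      v' \<in> minimizers f (s *\<^sub>R a + t *\<^sub>R b) \<Longrightarrow> v = v'"
    and v: "v \<in> minimizers f (a + b)" and m: "m \<in> supp f"
  shows "a \<bullet> pt v \<le> a \<bullet> pt m"
proof (rule ccontr)
  assume contra: "\<not> a \<bullet> pt v \<le> a \<bullet> pt m"
  \<comment> \<open>In direction \<open>a + s b\<close> the point \<open>n\<close> exceeds
    \<open>v\<close> by \<open>\<alpha> n + s * \<beta> n\<close>, which is linear in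
    \<open>s\<close> and, on the support, nonnegative at \<open>s = 1\<close>.\<close>
  define \<alpha> where "\<alpha> n = a \<bullet> pt n - a \<bullet> pt v" for n
  define \<beta> where "\<beta> n = b \<bullet> pt n - b \<bullet> pt v" for n
  have diff: "(1 *\<^sub>R a + s *\<^sub>R b) \<bullet> pt n - (1 *\<^sub>R a + s *\<^sub>R b) \<bullet> pt v = \<alpha> n + s * \<beta> n" for s n
    by (simp add: \<alpha>_def \<beta>_def inner_add_left algebra_simps)
  have sum: "0 \<le> \<alpha> n + \<beta> n" if "n \<in> supp f" for n
  proof -
    have "(a + b) \<bullet> pt v \<le> (a + b) \<bullet> pt n" using v that unfolding minimizers_def by blast
    then show ?thesis using diff[of 1 n] by simp
  qed
  have \<alpha>m: "\<alpha> m < 0" using contra by (simp add: \<alpha>_def)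
  then have \<beta>m: "0 < \<beta> m" "- \<alpha> m \<le> \<beta> m" using sum[OF m] by simp_all
  \<comment> \<open>Half of the parameter at which \<open>m\<close> ties with \<open>v\<close>:
    there \<open>m\<close> is already strictly lower, and \<open>0 < s1\<close> keeps the direction
    in the open quadrant, where finiteness holds.\<close>
  define s1 where "s1 = - \<alpha> m / (2 * \<beta> m)"
  have s1: "0 < s1" "s1 < 1" using \<alpha>m \<beta>m by (simp_all add: s1_def field_simps)
  have hm: "\<alpha> m + s1 * \<beta> m < 0" using \<alpha>m \<beta>m by (simp add: s1_def)
  have pos: "0 < fst (1 *\<^sub>R a + s *\<^sub>R b)" "0 < snd (1 *\<^sub>R a + s *\<^sub>R b)" if "0 < s" for s
  proof -
    have "0 \<le> fst a" "0 \<le> fst b" "0 \<le> snd a" "0 \<le> snd b" using ab by (simp_all add: quadrant_def)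
    moreover have "0 < fst a \<or> 0 < fst b" "0 < snd a \<or> 0 < snd b"
      using ab(3,4) calculation by auto
    ultimately show "0 < fst (1 *\<^sub>R a + s *\<^sub>R b)" "0 < snd (1 *\<^sub>R a + s *\<^sub>R b)"
      using that by (auto intro: add_nonneg_pos add_pos_nonneg)
  qed
  define B where "B = {n \<in> supp f. \<alpha> n + s1 * \<beta> n < 0}"
  have "B \<subseteq> {n \<in> supp f. (1 *\<^sub>R a + s1 *\<^sub>R b) \<bullet> pt n \<le> (1 *\<^sub>R a + s1 *\<^sub>R b) \<bullet> pt v}"
  proof
    fix n assume "n \<in> B"
    then show "n \<in> {n \<in> supp f. (1 *\<^sub>R a + s1 *\<^sub>R b) \<bullet> pt n \<le> (1 *\<^sub>R a + s1 *\<^sub>R b) \<bullet> pt v}"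
      using diff[of s1 n] by (simp add: B_def)
  qed
  then have B: "finite B" "m \<in> B"
    using finite_supp_below[OF pos[OF s1(1)]] m hm by (auto simp: B_def intro: finite_subset)
  \<comment> \<open>The parameter at which \<open>n\<close> ties with \<open>v\<close>; the largest
    one is the first tie met on the way from \<open>1\<close> down to \<open>s1\<close>.\<close>
  define r where "r n = - \<alpha> n / \<beta> n" for n
  have \<beta>_pos: "0 < \<beta> n" if "n \<in> B" for n
  proof -
    have "\<alpha> n + s1 * \<beta> n < 0" "0 \<le> \<alpha> n + \<beta> n" using that sum by (simp_all add: B_def)
    then have "0 < (1 - s1) * \<beta> n" by (simp add: algebra_simps)
    then show ?thesis using s1 by (simp add: zero_less_mult_iff)
  qed
  have "Max (r ` B) \<in> r ` B" using B by (intro Max_in) auto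
  then obtain n0 where n0: "n0 \<in> B" "r n0 = Max (r ` B)" by auto
  define s where "s = r n0"
  have r_le: "r n \<le> s" if "n \<in> B" for n using that B n0 by (simp add: s_def)
  have root: "\<alpha> n0 + s * \<beta> n0 = 0" using \<beta>_pos[OF n0(1)] by (simp add: s_def r_def)
  have "s1 * \<beta> n0 < s * \<beta> n0" using root n0(1) by (simp add: B_def)
  then have s: "s1 < s" using \<beta>_pos[OF n0(1)] by simp
  have "s * \<beta> n0 \<le> 1 * \<beta> n0" using root sum[of n0] n0(1) by (simp add: B_def)
  then have s': "s \<le> 1" using \<beta>_pos[OF n0(1)] by simp
  have nonneg: "0 \<le> \<alpha> n + s * \<beta> n" if "n \<in> supp f" for n
  proof (cases "n \<in> B")
    case True
    then have "- \<alpha> n \<le> s * \<beta> n" using r_le \<beta>_pos by (simp add: r_def field_simps)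
    then show ?thesis by simp
  next
    case False
    then have "0 \<le> \<alpha> n + s1 * \<beta> n" using that by (simp add: B_def)
    moreover have "0 \<le> \<alpha> n + \<beta> n" using sum that .
    \<comment> \<open>Linear interpolation between the parameters \<open>s1\<close> and
      \<open>1\<close>, at which the excess of \<open>n\<close> is nonnegative.\<close>
    ultimately have "0 \<le> (1 - s) * (\<alpha> n + s1 * \<beta> n) + (s - s1) * (\<alpha> n + \<beta> n)"
      using s s' by simp
    also have "\<dots> = (1 - s1) * (\<alpha> n + s * \<beta> n)" by (simp add: algebra_simps)
    finally show ?thesis using s1 by (simp add: zero_le_mult_iff)
  qed
  let ?w = "1 *\<^sub>R a + s *\<^sub>R b"
  have min: "?w \<bullet> pt v \<le> ?w \<bullet> pt n" if "n \<in> supp f" for n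
    using nonneg[OF that] diff[of s n] by simp
  have eq: "?w \<bullet> pt n0 = ?w \<bullet> pt v" using root diff[of s n0] by simp
  have supp: "v \<in> supp f" "n0 \<in> supp f" using v n0(1) by (simp_all add: minimizers_def B_def)
  have "v \<in> minimizers f ?w" unfolding minimizers_def using supp(1) min by simp
  moreover have "n0 \<in> minimizers f ?w" unfolding minimizers_def using supp(2) min eq by simp
  ultimately have "v = n0" using s s1 by (intro uniq[of 1 s]) simp_all
  then show False using n0(1) by (simp add: B_def \<alpha>_def \<beta>_def)
qed

text \<open>Positivity is asked of \<open>a + b\<close> only, so that a generator may span an edge
  of \<open>\<sigma>_0\<close>. Minimality of \<open>v\<close> at \<open>a\<close> and at
  \<open>b\<close> passes to the whole cone.\<close>

locale cone2 =
  fixes f :: "complex fps fps" and \<tau> :: cone and a b :: "real \<times> real" and v :: lattice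
  assumes cone: "\<tau> = {s *\<^sub>R a + t *\<^sub>R b | s t. 0 \<le> s \<and> 0 \<le> t}"
    and quad: "a \<in> quadrant" "b \<in> quadrant" and pos: "0 < fst (a + b)" "0 < snd (a + b)"
    and indep: "fst a * snd b - snd a * fst b \<noteq> 0"
    and v: "v \<in> supp f"
    and min: "\<And>m. m \<in> supp f \<Longrightarrow> a \<bullet> pt v \<le> a \<bullet> pt m \<and> b \<bullet> pt v \<le> b \<bullet> pt m"
begin

lemma comb: "(s *\<^sub>R a + t *\<^sub>R b) \<bullet> x = s * (a \<bullet> x) + t * (b \<bullet> x)"
  by (simp add: inner_add_left)

lemma mem: "a \<in> \<tau>" "b \<in> \<tau>" "a + b \<in> \<tau>"
proof -
  have "s *\<^sub>R a + t *\<^sub>R b \<in> \<tau>" if "0 \<le> s" "0 \<le> t" for s t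
    using that unfolding cone by blast
  from this[of 1 0] this[of 0 1] this[of 1 1] show "a \<in> \<tau>" "b \<in> \<tau>" "a + b \<in> \<tau>" by simp_all
qed

lemma dual: "m \<in> dual_cone \<tau> \<longleftrightarrow> 0 \<le> a \<bullet> pt m \<and> 0 \<le> b \<bullet> pt m"
proof
  assume "m \<in> dual_cone \<tau>"
  then show "0 \<le> a \<bullet> pt m \<and> 0 \<le> b \<bullet> pt m" using mem unfolding dual_cone_def by blast
next
  assume m: "0 \<le> a \<bullet> pt m \<and> 0 \<le> b \<bullet> pt m"
  show "m \<in> dual_cone \<tau>"
    unfolding dual_cone_def
  proof (intro CollectI ballI)
    fix w assume "w \<in> \<tau>"
    then obtain s t where "w = s *\<^sub>R a + t *\<^sub>R b" "0 \<le> s" "0 \<le> t" unfolding cone by blast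
    then show "0 \<le> w \<bullet> pt m" using m by (simp only: comb) simp
  qed
qed

lemma perp_0:
  assumes "m \<in> perp \<tau>" shows "m = 0"
proof -
  have "a \<bullet> pt m = 0" "b \<bullet> pt m = 0" using assms mem unfolding perp_def by blast+
  then have e: "fst a * fst m + snd a * snd m = 0" "fst b * fst m + snd b * snd m = 0"
    by (simp_all add: pt_def inner_prod_def)
  let ?d = "fst a * snd b - snd a * fst b"
  have "?d * fst m = snd b * (fst a * fst m + snd a * snd m) - snd a * (fst b * fst m + snd b * snd m)"
    "?d * snd m = fst a * (fst b * fst m + snd b * snd m) - fst b * (fst a * fst m + snd a * snd m)"
    by (simp_all add: algebra_simps)
  then have "?d * fst m = 0" "?d * snd m = 0" unfolding e by simp_all
  then show "m = 0" using indep by (simp add: prod_eq_iff)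
qed

lemma zero_in_perp: "0 \<in> perp \<tau>"
  by (simp add: perp_def pt_def zero_prod_def[symmetric])

text \<open>Prolonging the segment from \<open>a + b\<close> slightly beyond \<open>w\<close> stays
  in the quadrant, so \<open>w\<close> is a convex combination in which \<open>a + b\<close>, with
  its positive coordinates, has positive weight.\<close>

lemma rel_interior_pos:
  assumes w: "w \<in> rel_interior \<tau>" shows "0 < fst w" "0 < snd w"
proof -
  have convex: "convex \<tau>"
    unfolding cone convex_hull_cone_rays[symmetric] by (rule convex_convex_hull)
  have "\<tau> \<noteq> {}" using mem by blast
  then obtain e where e: "e > 1" "(1 - e) *\<^sub>R (a + b) + e *\<^sub>R w \<in> \<tau>"
    using w mem(3) unfolding convex_rel_interior_iff[OF convex \<open>\<tau> \<noteq> {}\<close>] by blast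
  then obtain s t where "(1 - e) *\<^sub>R (a + b) + e *\<^sub>R w = s *\<^sub>R a + t *\<^sub>R b" "0 \<le> s" "0 \<le> t"
    unfolding cone by blast
  then have "0 \<le> fst ((1 - e) *\<^sub>R (a + b) + e *\<^sub>R w)" "0 \<le> snd ((1 - e) *\<^sub>R (a + b) + e *\<^sub>R w)"
    using quad by (simp_all add: quadrant_def)
  then have le: "(e - 1) * fst (a + b) \<le> e * fst w" "(e - 1) * snd (a + b) \<le> e * snd w"
    by (simp_all add: algebra_simps)
  have "0 < (e - 1) * fst (a + b)" "0 < (e - 1) * snd (a + b)"
    using e(1) pos by (simp_all only: mult_pos_pos diff_gt_0_iff_gt)
  with le have "0 < e * fst w" "0 < e * snd w" by linarith+
  then show "0 < fst w" "0 < snd w" using e(1) by (simp_all add: zero_less_mult_iff)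
qed

lemma shifted_carrier: "(\<lambda>m. lattice_coeff f (m + v)) \<in> carrier (formal_functions \<tau>)"
proof -
  have "m \<in> dual_cone \<tau>" if "lattice_coeff f (m + v) \<noteq> 0" for m
    using min[of "m + v"] that by (simp add: dual pt_add inner_add_right)
  moreover have "finite {m. lattice_coeff f (m + v) \<noteq> 0 \<and> w \<bullet> pt m \<le> c}" if "w \<in> rel_interior \<tau>" for w c
  proof -
    have "{m. lattice_coeff f (m + v) \<noteq> 0 \<and> w \<bullet> pt m \<le> c} \<subseteq>
        (\<lambda>m. m - v) ` {m \<in> supp f. w \<bullet> pt m \<le> c + w \<bullet> pt v}"
    proof
      fix m assume "m \<in> {m. lattice_coeff f (m + v) \<noteq> 0 \<and> w \<bullet> pt m \<le> c}"
      then have "m + v \<in> {m \<in> supp f. w \<bullet> pt m \<le> c + w \<bullet> pt v}"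
        by (simp add: pt_add inner_add_right)
      then show "m \<in> (\<lambda>m. m - v) ` {m \<in> supp f. w \<bullet> pt m \<le> c + w \<bullet> pt v}"
        by (rule image_eqI[rotated]) simp
    qed
    then show ?thesis
      by (rule finite_subset) (intro finite_imageI finite_supp_below rel_interior_pos[OF that])
  qed
  ultimately show ?thesis unfolding formal_functions_def by simp
qed

lemma monomial_carrier:
  assumes "n \<in> dual_cone \<tau>" shows "monomial n \<in> carrier (formal_functions \<tau>)"
proof -
  have "finite {m. monomial n m \<noteq> 0 \<and> w \<bullet> pt m \<le> c}" for w c
    by (rule finite_subset[of _ "{n}"]) (auto simp: monomial_def)
  then show ?thesis using assms unfolding formal_functions_def by (simp add: monomial_def)
qed

text \<open>As \<open>x^i\<close> and \<open>y^j\<close> occur in \<open>f\<close>, neither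
  generator of the cone is larger at \<open>v\<close> than at \<open>(i, 0)\<close> or
  \<open>(0, j)\<close>. Hence \<open>\<chi>^(-v) x^k\<close> and \<open>\<chi>^(-v) y^k\<close> are
  regular on the chart for \<open>k = max i j\<close>, even if the cone borders an edge of
  \<open>\<sigma>_0\<close>.\<close>

lemma shifted_strict:
  assumes "coeff2 f i 0 \<noteq> 0" "coeff2 f 0 j \<noteq> 0"
  shows "(\<lambda>m. lattice_coeff f (m + v)) \<in> strict_transform_ideal f \<tau>"
proof -
  let ?g = "\<lambda>m. lattice_coeff f (m + v)"
  have ij: "(int i, 0) \<in> supp f" "(0, int j) \<in> supp f"
    using assms by (simp_all add: lattice_coeff_def)
  have nn: "0 \<le> fst a" "0 \<le> snd a" "0 \<le> fst b" "0 \<le> snd b" using quad by (simp_all add: quadrant_def)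
  have ineq: "a \<bullet> pt v \<le> real i * fst a" "b \<bullet> pt v \<le> real i * fst b"
    "a \<bullet> pt v \<le> real j * snd a" "b \<bullet> pt v \<le> real j * snd b"
    using min[OF ij(1)] min[OF ij(2)] by (simp_all add: pt_def inner_prod_def mult.commute)
  define k where "k = max i j"
  have "real i * c \<le> real k * c" "real j * c \<le> real k * c" if "0 \<le> c" for c
    using that by (simp_all add: k_def mult_right_mono)
  then have "a \<bullet> pt v \<le> real k * fst a" "b \<bullet> pt v \<le> real k * fst b"
    "a \<bullet> pt v \<le> real k * snd a" "b \<bullet> pt v \<le> real k * snd b"
    using ineq nn by (meson order_trans)+
  then have k: "(int k, 0) - v \<in> dual_cone \<tau>" "(0, int k) - v \<in> dual_cone \<tau>"
    unfolding dual pt_diff inner_diff_right by (simp_all add: pt_def inner_prod_def mult.commute)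
  have "monomial n \<otimes>\<^bsub>formal_functions \<tau>\<^esub> ?g \<in> PIdl\<^bsub>formal_functions \<tau>\<^esub> (lattice_coeff f)"
    if "n - v \<in> dual_cone \<tau>" for n
  proof -
    have "monomial n \<otimes>\<^bsub>formal_functions \<tau>\<^esub> ?g = monomial (n - v) \<otimes>\<^bsub>formal_functions \<tau>\<^esub> lattice_coeff f"
      by (rule ext) (simp add: monomial_mult algebra_simps)
    then show ?thesis using monomial_carrier[OF that] unfolding cgenideal_def by blast
  qed
  with k show ?thesis
    using shifted_carrier unfolding strict_transform_ideal_def Let_def by blast
qed

lemma no_strict_point:
  assumes "coeff2 f i 0 \<noteq> 0" "coeff2 f 0 j \<noteq> 0"
  shows "(\<tau>, p) \<notin> strict_transform f"
proof
  let ?g = "\<lambda>m. lattice_coeff f (m + v)"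
  assume "(\<tau>, p) \<in> strict_transform f"
  then have p: "p \<in> torus_orbit \<tau>" and "value_at p ?g = 0"
    using shifted_strict[OF assms] by (auto simp: strict_transform_def toric_surface_def)
  have nz: "p m \<noteq> 0 \<longleftrightarrow> m \<in> perp \<tau>" for m using p unfolding torus_orbit_def by blast
  have "p 0 = 1" using p by (simp add: torus_orbit_def chart_def)
  have "{m. ?g m \<noteq> 0 \<and> p m \<noteq> 0} = {0}"
    unfolding nz using perp_0 zero_in_perp v by auto
  then have "value_at p ?g = lattice_coeff f v" using \<open>p 0 = 1\<close> by (simp add: value_at_def)
  then show False using v \<open>value_at p ?g = 0\<close> by simp
qed

end

section \<open>Cones spanned by consecutive rays\<close>

lemma cone_ray_eqI:
  assumes "a \<in> quadrant" "b \<in> quadrant" "a \<noteq> 0" "b \<noteq> 0" "fst a * snd b - snd a * fst b = 0"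
  shows "cone_ray a = cone_ray b"
proof -
  have nn: "0 \<le> fst a" "0 \<le> snd a" "0 \<le> fst b" "0 \<le> snd b" using assms by (simp_all add: quadrant_def)
  obtain t where t: "0 \<le> t" "b = t *\<^sub>R a"
  proof (cases "fst a = 0")
    case True
    then have "snd a \<noteq> 0" using assms(3) by (simp add: prod_eq_iff)
    then have "fst b = 0" using assms(5) True by simp
    then have "b = (snd b / snd a) *\<^sub>R a" using True \<open>snd a \<noteq> 0\<close> by (simp add: prod_eq_iff)
    then show ?thesis using nn by (intro that) simp_all
  next
    case False
    then have "b = (fst b / fst a) *\<^sub>R a" using assms(5) by (simp add: prod_eq_iff field_simps)
    then show ?thesis using nn by (intro that) simp_all
  qed
  then have "0 < t" using assms(4) by (cases "t = 0") auto
  then show ?thesis unfolding t(2) by (rule cone_ray_scale[symmetric])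
qed

text \<open>A tie inside the cone would give a ray of the fan strictly between two consecutive ones.
  So minimizers are unique at interior directions, and the one at \<open>a + b\<close> stays minimal
  at both generators.\<close>

lemma cone2_of_consecutive:
  assumes S: "supp f \<noteq> {}" and rays: "\<rho> \<in> newton_rays f" "\<rho>' \<in> newton_rays f" "\<rho> \<noteq> \<rho>'"
    and consecutive: "\<forall>\<rho>''\<in>newton_rays f. \<rho>'' \<subseteq> convex hull (\<rho> \<union> \<rho>') \<longrightarrow> \<rho>'' = \<rho> \<or> \<rho>'' = \<rho>'"
  obtains a b v where "cone2 f (convex hull (\<rho> \<union> \<rho>')) a b v"
proof -
  obtain a where a: "\<rho> = cone_ray a" "a \<in> quadrant" "a \<noteq> 0"
    using newton_rays_cone_ray[OF S rays(1)] .
  obtain b where b: "\<rho>' = cone_ray b" "b \<in> quadrant" "b \<noteq> 0"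
    using newton_rays_cone_ray[OF S rays(2)] .
  let ?det = "fst a * snd b - snd a * fst b"
  have indep: "?det \<noteq> 0" using cone_ray_eqI[OF a(2) b(2) a(3) b(3)] a b rays(3) by blast
  have nn: "0 \<le> fst a" "0 \<le> snd a" "0 \<le> fst b" "0 \<le> snd b" using a b by (simp_all add: quadrant_def)
  have pos: "0 < fst (s *\<^sub>R a + t *\<^sub>R b)" "0 < snd (s *\<^sub>R a + t *\<^sub>R b)" if "0 < s" "0 < t" for s t
  proof -
    have "0 < fst a \<or> 0 < fst b" "0 < snd a \<or> 0 < snd b" using nn indep by force+
    then show "0 < fst (s *\<^sub>R a + t *\<^sub>R b)" "0 < snd (s *\<^sub>R a + t *\<^sub>R b)"
      using nn that by (auto intro: add_nonneg_pos add_pos_nonneg)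
  qed
  note hull = convex_hull_cone_rays[of a b]
  have uniq: "v = v'" if st: "0 < s" "0 < t" and v: "v \<in> minimizers f (s *\<^sub>R a + t *\<^sub>R b)"
    "v' \<in> minimizers f (s *\<^sub>R a + t *\<^sub>R b)" for s t v v'
  proof (rule ccontr)
    let ?w = "s *\<^sub>R a + t *\<^sub>R b"
    assume "v \<noteq> v'"
    then have ray: "cone_ray ?w \<in> newton_rays f" by (rule minimizing_direction_ray[OF pos[OF st] v])
    have "cone_ray ?w \<subseteq> convex hull (\<rho> \<union> \<rho>')"
      unfolding a b hull
    proof
      fix x assume "x \<in> cone_ray ?w"
      then obtain r where "0 \<le> r" "x = r *\<^sub>R ?w" by (auto simp: cone_ray_def)
      then have "x = (r * s) *\<^sub>R a + (r * t) *\<^sub>R b" "0 \<le> r * s" "0 \<le> r * t"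
        using st by (simp_all add: scaleR_add_right)
      then show "x \<in> {s *\<^sub>R a + t *\<^sub>R b | s t. 0 \<le> s \<and> 0 \<le> t}" by blast
    qed
    with ray have "cone_ray ?w = cone_ray a \<or> cone_ray ?w = cone_ray b"
      using consecutive a b by blast
    moreover have "?w \<in> cone_ray ?w" unfolding cone_ray_def by (intro CollectI exI[of _ 1]) simp
    ultimately obtain r where "?w = r *\<^sub>R a \<or> ?w = r *\<^sub>R b" by (auto simp: cone_ray_def)
    \<comment> \<open>Proportionality to \<open>a\<close> or to \<open>b\<close> is tested by
      determinants, which equal \<open>t\<close> and \<open>s\<close> times the nonzero determinant
      of \<open>a\<close> and \<open>b\<close>.\<close>
    then have "fst a * snd ?w - snd a * fst ?w = 0 \<or> fst ?w * snd b - snd ?w * fst b = 0"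
      by (elim disjE) (simp_all only: fst_scaleR snd_scaleR, simp_all)
    moreover have "fst a * snd ?w - snd a * fst ?w = t * ?det"
      "fst ?w * snd b - snd ?w * fst b = s * ?det" by (simp_all add: algebra_simps)
    ultimately have "t * ?det = 0 \<or> s * ?det = 0" by (simp only:)
    then have "t = 0 \<or> s = 0" using indep unfolding mult_eq_0_iff by blast
    then show False using st by simp
  qed
  have ab: "0 < fst (a + b)" "0 < snd (a + b)" using pos[of 1 1] by simp_all
  obtain v where v: "v \<in> minimizers f (a + b)" using minimizers_nonempty[OF ab S] .
  have "cone2 f (convex hull (\<rho> \<union> \<rho>')) a b v"
  proof
    show "convex hull (\<rho> \<union> \<rho>') = {s *\<^sub>R a + t *\<^sub>R b | s t. 0 \<le> s \<and> 0 \<le> t}"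
      unfolding a b by (rule hull)
    show "v \<in> supp f" using v by (simp add: minimizers_def)
    fix m assume m: "m \<in> supp f"
    have "a \<bullet> pt v \<le> a \<bullet> pt m"
      by (rule minimizer_extends[OF a(2) b(2) ab uniq v m])
    moreover have "b \<bullet> pt v \<le> b \<bullet> pt m"
    proof (rule minimizer_extends[OF b(2) a(2) _ _ _ _ m])
      show "0 < fst (b + a)" "0 < snd (b + a)" "v \<in> minimizers f (b + a)"
        using ab v by (simp_all add: add.commute)
      show "v = v'" if "0 < s" "0 < t" "v \<in> minimizers f (s *\<^sub>R b + t *\<^sub>R a)"
        "v' \<in> minimizers f (s *\<^sub>R b + t *\<^sub>R a)" for s t v v'
        using uniq[of t s v v'] that by (simp add: add.commute)
    qed
    ultimately show "a \<bullet> pt v \<le> a \<bullet> pt m \<and> b \<bullet> pt v \<le> b \<bullet> pt m" ..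
  qed (use a b ab indep in auto)
  then show ?thesis by (rule that)
qed

section \<open>Position of the strict transform in the toric surface\<close>

text \<open>Over \<open>o\<close> both \<open>x\<close> and \<open>y\<close> vanish, which excludes
  the orbits of \<open>{0}\<close> and of the edges of \<open>\<sigma>_0\<close>; two-dimensional
  cones are excluded by \<open>cone2.no_strict_point\<close>.\<close>

lemma strict_point_cone:
  assumes "coeff2 f i 0 \<noteq> 0" "coeff2 f 0 j \<noteq> 0" and P: "(\<tau>, p) \<in> strict_transform f"
  shows "\<tau> \<in> newton_rays f - {edge1, edge2}"
proof -
  have "(int i, 0) \<in> supp f" using assms by (simp add: lattice_coeff_def)
  then have S: "supp f \<noteq> {}" by blast
  have \<tau>: "\<tau> \<in> newton_fan f" and p: "p \<in> torus_orbit \<tau>" and "p (1, 0) = 0" "p (0, 1) = 0"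
    using P by (auto simp: strict_transform_def toric_surface_def modification_map_def)
  have nz: "p m \<noteq> 0 \<longleftrightarrow> m \<in> perp \<tau>" for m using p unfolding torus_orbit_def by blast
  then have not_perp: "(1, 0) \<notin> perp \<tau>" "(0, 1) \<notin> perp \<tau>"
    using \<open>p (1, 0) = 0\<close> \<open>p (0, 1) = 0\<close> by blast+
  have "(0, 1) \<in> perp edge1" "(1, 0) \<in> perp edge2" "(1, 0) \<in> perp {0}"
    by (auto simp: perp_def edge1_def edge2_def pt_def)
  with not_perp have "\<tau> \<noteq> edge1" "\<tau> \<noteq> edge2" "\<tau> \<noteq> {0}" by blast+
  moreover have False if c: "\<rho> \<in> newton_rays f" "\<rho>' \<in> newton_rays f" "\<rho> \<noteq> \<rho>'"
    "\<forall>\<rho>''\<in>newton_rays f. \<rho>'' \<subseteq> convex hull (\<rho> \<union> \<rho>') \<longrightarrow> \<rho>'' = \<rho> \<or> \<rho>'' = \<rho>'"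
    "\<tau> = convex hull (\<rho> \<union> \<rho>')" for \<rho> \<rho>'
  proof -
    obtain a b v where "cone2 f \<tau> a b v"
      using cone2_of_consecutive[OF S c(1-4)] unfolding c(5)[symmetric] .
    then show False using cone2.no_strict_point[OF _ assms(1,2)] P by blast
  qed
  ultimately show ?thesis using \<tau> unfolding newton_fan_def fan_of_rays_def by blast
qed

text \<open>The points of the strict transform lie on orbits of interior rays, and a ray that is a
  face of another one is equal to it; so only the orbit itself is met.\<close>

lemma strict_inter_orbit_closure:
  assumes pure: "coeff2 f i 0 \<noteq> 0" "coeff2 f 0 j \<noteq> 0"
    and \<rho>: "\<rho> \<in> newton_rays f - {edge1, edge2}"
  shows "strict_transform f \<inter> orbit_closure (newton_fan f) \<rho> =
    {\<rho>} \<times> {t \<in> torus_orbit \<rho>. \<forall>g\<in>strict_transform_ideal f \<rho>. value_at t g = 0}" (is "?L = ?R")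
proof -
  have "(int i, 0) \<in> supp f" using assms by (simp add: lattice_coeff_def)
  then have S: "supp f \<noteq> {}" by blast
  obtain p q a b where r: "ray p q a b" "\<rho> = ray.C p q" by (rule interior_ray[OF S \<rho>])
  interpret ray p q a b by (rule r)
  have \<rho>_eq: "\<rho> = cone_ray (dirv 1)" unfolding r(2) by (rule C_cone_ray)
  have "\<tau> = \<rho>" if P: "(\<tau>, t) \<in> ?L" for \<tau> t
  proof -
    have \<tau>: "\<tau> \<in> newton_rays f - {edge1, edge2}" using strict_point_cone[OF pure] P by blast
    obtain p' q' a' b' where r': "ray p' q' a' b'" "\<tau> = ray.C p' q'"
      by (rule interior_ray[OF S \<tau>])
    interpret r': ray p' q' a' b' by (rule r')
    have "\<rho> face_of \<tau>" using P by (auto simp: orbit_closure_def)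
    then have "\<rho> \<subseteq> \<tau>" by (rule face_of_imp_subset)
    then have "dirv 1 \<in> r'.C" unfolding r r'(2) by auto
    then obtain s where s: "dirv 1 = s *\<^sub>R r'.dirv 1" "0 \<le> s"
      unfolding r'.C_cone_ray by (auto simp: cone_ray_def)
    then have "s \<noteq> 0" using dirv_pos(1) by auto
    then have "0 < s" using s(2) by simp
    then show ?thesis unfolding r'(2) r'.C_cone_ray \<rho>_eq s(1) by (rule cone_ray_scale[symmetric])
  qed
  then have "?L \<subseteq> ?R" by (auto simp: strict_transform_def toric_surface_def)
  moreover have "?R \<subseteq> ?L"
  proof
    fix P assume "P \<in> ?R"
    then obtain t where P: "P = (\<rho>, t)" and t: "t \<in> torus_orbit \<rho>"
      and zero: "\<forall>g\<in>strict_transform_ideal f \<rho>. value_at t g = 0" by blast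
    have "\<rho> \<in> newton_fan f" using \<rho> by (simp add: newton_fan_def fan_of_rays_def)
    then have surf: "(\<rho>, t) \<in> toric_surface (newton_fan f)" using t by (simp add: toric_surface_def)
    have nz: "t m \<noteq> 0 \<longleftrightarrow> deg m = 0" for m
      using t unfolding r(2) torus_orbit_def perp_C by blast
    have "deg (1, 0) \<noteq> 0" "deg (0, 1) \<noteq> 0" using p_pos q_pos by (simp_all add: deg_def)
    then have "modification_map (\<rho>, t) = (0, 0)"
      using nz[of "(1, 0)"] nz[of "(0, 1)"] by (simp add: modification_map_def)
    then have "(\<rho>, t) \<in> strict_transform f" using surf zero by (simp add: strict_transform_def)
    \<comment> \<open>Points of the chart already vanish outside the dual cone, so \<open>t\<close>
      belongs to the set whose closure is taken.\<close>
    moreover have "(\<lambda>m. if m \<in> dual_cone \<rho> then t m else 0) = t"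
      using t by (auto simp: torus_orbit_def chart_def)
    then have "t \<in> closure ((\<lambda>q m. if m \<in> dual_cone \<rho> then q m else 0) ` torus_orbit \<rho>)"
      using t by (intro subsetD[OF closure_subset]) (metis (no_types, lifting) image_eqI)
    then have "(\<rho>, t) \<in> orbit_closure (newton_fan f) \<rho>"
      using surf convex_C by (simp add: orbit_closure_def face_of_refl r(2))
    ultimately show "P \<in> ?L" unfolding P by blast
  qed
  ultimately show ?thesis by (rule antisym)
qed

theorem proposition4p18:
  fixes x y h f :: "complex fps fps"
  assumes "defines_cross x y"
    and "curve_singularity h"
    and "\<not> is_branch x h"
    and "\<not> is_branch y h"
    and "is_expansion x y h f"
  shows "(\<forall>P \<in> strict_transform f \<inter> boundary (newton_fan f). smooth_point_of_boundary P) \<and>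
    (\<forall>\<rho> \<in> newton_rays f - {edge1, edge2}.
       strict_transform f \<inter> orbit_closure (newton_fan f) \<rho> \<subseteq> orbit \<rho> \<and>
       finite (strict_transform f \<inter> orbit_closure (newton_fan f) \<rho>) \<and>
       (\<exists>!e. e edge_of newton_polygon f \<and> orthogonal_to_segment \<rho> e) \<and>
       (\<forall>e. e edge_of newton_polygon f \<and> orthogonal_to_segment \<rho> e \<longrightarrow>
          (\<exists>l. has_integral_length e l \<and>
             (\<Sum>P \<in> strict_transform f \<inter> orbit_closure (newton_fan f) \<rho>.
                intersection_multiplicity f \<rho> P) = enat l)))"
proof -
  \<comment> \<open>The hypotheses on the branches enter as the presence of both pure
    powers.\<close>
  obtain i j where pure: "coeff2 f i 0 \<noteq> 0" "coeff2 f 0 j \<noteq> 0"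
    using pure_powers[OF assms(1,5,3,4)] by blast
  have "(int i, 0) \<in> supp f" using pure by (simp add: lattice_coeff_def)
  then have S: "supp f \<noteq> {}" by blast
  show ?thesis
  proof (intro conjI ballI)
    fix P assume P: "P \<in> strict_transform f \<inter> boundary (newton_fan f)"
    obtain \<tau> t where Pt: "P = (\<tau>, t)" by (cases P)
    then have \<tau>: "\<tau> \<in> newton_rays f - {edge1, edge2}" using strict_point_cone[OF pure] P by blast
    obtain p q a b where r: "ray p q a b" "\<tau> = ray.C p q" by (rule interior_ray[OF S \<tau>])
    have "t \<in> torus_orbit \<tau>" using P Pt by (auto simp: strict_transform_def toric_surface_def)
    then show "smooth_point_of_boundary P" unfolding Pt r(2) by (rule ray.smooth_C[OF r(1)])
  next
    fix \<rho> assume \<rho>: "\<rho> \<in> newton_rays f - {edge1, edge2}"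
    note inter = strict_inter_orbit_closure[OF pure \<rho>]
    obtain p q a b where r: "ray p q a b" "\<rho> = ray.C p q"
      and edge: "face_at f (ray.dirv p q 1) edge_of newton_polygon f" by (rule interior_ray[OF S \<rho>])
    interpret ray p q a b by (rule r)
    obtain A l where re: "ray_edge p q a b f A l" and len: "has_integral_length (face_at f (dirv 1)) l"
      by (rule ray_edge_exists[OF S])
    interpret ray_edge p q a b f A l by (rule re)
    obtain v where v: "v \<in> minimizers f (dirv 1)" using minimizers_nonempty[OF dirv_pos S] .
    have unique: "e = face_at f (dirv 1)"
      if "e edge_of newton_polygon f" "orthogonal_to_segment \<rho> e" for e
    proof (rule edge_orthogonal[OF dirv_pos v that(1)])
      fix x y assume "x \<in> e" "y \<in> e"
      moreover have "dirv 1 \<in> \<rho>" unfolding r(2) by simp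
      ultimately show "dirv 1 \<bullet> (x - y) = 0" using that(2) unfolding orthogonal_to_segment_def by blast
    qed
    have "orthogonal_to_segment \<rho> (face_at f (dirv 1))"
      unfolding orthogonal_to_segment_def
    proof (intro ballI)
      fix w x y assume w: "w \<in> \<rho>" and xy: "x \<in> face_at f (dirv 1)" "y \<in> face_at f (dirv 1)"
      from w obtain t where "w = t *\<^sub>R dirv 1" unfolding r(2) C_cone_ray by (auto simp: cone_ray_def)
      moreover have "dirv 1 \<bullet> x = dirv 1 \<bullet> pt v" "dirv 1 \<bullet> y = dirv 1 \<bullet> pt v"
        using face_at_hyperplane[OF v] xy by blast+
      ultimately show "w \<bullet> (x - y) = 0" by (simp add: inner_diff_right)
    qed
    then show "\<exists>!e. e edge_of newton_polygon f \<and> orthogonal_to_segment \<rho> e"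
      using edge unique by blast
    show "strict_transform f \<inter> orbit_closure (newton_fan f) \<rho> \<subseteq> orbit \<rho>"
      unfolding inter orbit_def by blast
    show "finite (strict_transform f \<inter> orbit_closure (newton_fan f) \<rho>)"
      unfolding inter unfolding r(2) using finite_strict_points_C by simp
    show "\<forall>e. e edge_of newton_polygon f \<and> orthogonal_to_segment \<rho> e \<longrightarrow>
          (\<exists>l. has_integral_length e l \<and>
             (\<Sum>P \<in> strict_transform f \<inter> orbit_closure (newton_fan f) \<rho>.
                intersection_multiplicity f \<rho> P) = enat l)"
    proof (intro allI impI exI conjI)
      fix e assume "e edge_of newton_polygon f \<and> orthogonal_to_segment \<rho> e"
      then show "has_integral_length e l" using unique len by blast
      show "(\<Sum>P \<in> strict_transform f \<inter> orbit_closure (newton_fan f) \<rho>.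
                intersection_multiplicity f \<rho> P) = enat l"
        unfolding inter unfolding r(2) by (rule sum_intersection_multiplicity)
    qed
  qed
qed

end
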